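(* Let $H=-\Delta+x^2+y^2$ be the isotropic quantum harmonic oscillator on $L^2(\mathbb{R}^2)$, and let $(f_i)_{i\ge1}$ be the eigenfunctions of $H$, with eigenvalues ordered in increasing order with multiplicities. Then, for any $n\ge1$ and any linear combination $f=\sum_{i=1}^n a_if_i$ with real coefficients $a_i$, we have $\beta_0(f)\le n$.
   Context: $(f_i)$ is a basis of real eigenfunctions of $H$, ordered so that the corresponding eigenvalues are nondecreasing, each eigenvalue being repeated according to its multiplicity. Explicitly, a basis of eigenfunctions is given by $H_{a,b}(x,y)=e^{-(x^2+y^2)/2}H_a(x)H_b(y)$, $a,b\in\mathbb{N}$ (including $0$), where $H_n$ is the $n$-th Hermite polynomial; the associated eigenvalue is $2(a+b+1)$, with multiplicity $a+b+1$. For a real continuous function $f$ on $\mathbb{R}^2$, the nodal domains of $f$ are the connected components of $\mathbb{R}^2\setminus f^{-1}(0)$ and $\beta_0(f)$ is their number. *)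

theory Defs
  imports
    "HOL-Analysis.Analysis"
    "HOL-Library.Function_Algebras"
    "HOL-Library.Extended_Nat"
begin

definition partial_deriv :: "(real \<times> real \<Rightarrow> real) \<Rightarrow> real \<times> real \<Rightarrow> real \<times> real \<Rightarrow> real" where
  "partial_deriv u b p = frechet_derivative u (at p) b"

definition C1 :: "(real \<times> real \<Rightarrow> real) \<Rightarrow> bool" where
  "C1 u \<longleftrightarrow> u differentiable_on UNIV \<and>
     (\<forall>b\<in>Basis. continuous_on UNIV (partial_deriv u b))"

definition C2 :: "(real \<times> real \<Rightarrow> real) \<Rightarrow> bool" where
  "C2 u \<longleftrightarrow> C1 u \<and> (\<forall>b\<in>Basis. C1 (partial_deriv u b))"

definition laplacian :: "(real \<times> real \<Rightarrow> real) \<Rightarrow> real \<times> real \<Rightarrow> real" where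
  "laplacian u p = (\<Sum>b\<in>Basis. partial_deriv (partial_deriv u b) b p)"

definition oscillator :: "(real \<times> real \<Rightarrow> real) \<Rightarrow> real \<times> real \<Rightarrow> real" where
  "oscillator u = (\<lambda>(x, y). - laplacian u (x, y) + (x\<^sup>2 + y\<^sup>2) * u (x, y))"

text \<open>
  By elliptic regularity every eigenfunction in \<open>L\<^sup>2\<close> of the self-adjoint operator has a smooth
  representative, so eigenspaces consist of genuine functions satisfying the equation pointwise.
\<close>
definition eigenspace :: "real \<Rightarrow> (real \<times> real \<Rightarrow> real) set" where
  "eigenspace \<mu> = {u. C2 u \<and> integrable lborel (\<lambda>p. (u p)\<^sup>2) \<and>
                      oscillator u = (\<lambda>p. \<mu> * u p)}"

interpretation fun_space: vector_space "\<lambda>(c::real) (u :: real \<times> real \<Rightarrow> real) p. c * u p"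
  by unfold_locales (auto simp: fun_eq_iff algebra_simps)

text \<open>
  Families are indexed by \<open>i \<ge> 1\<close>; the values at \<open>i = 0\<close> are irrelevant. For each real \<open>\<mu>\<close>, the
  members with eigenvalue \<open>\<mu>\<close> form, as an indexed family, a linear basis of the eigenspace:
  hence each eigenvalue is listed as often as its multiplicity, and none is omitted. No
  orthogonality or normalisation is imposed.
\<close>
definition ordered_eigenbasis :: "(nat \<Rightarrow> real \<times> real \<Rightarrow> real) \<Rightarrow> (nat \<Rightarrow> real) \<Rightarrow> bool" where
  "ordered_eigenbasis f ev \<longleftrightarrow>
     mono_on {1..} ev \<and>
     (\<forall>\<mu>. let I = {i. 1 \<le> i \<and> ev i = \<mu>} in
        inj_on f I \<and>
        fun_space.independent (f ` I) \<and>
        fun_space.span (f ` I) = eigenspace \<mu>)"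

definition nodal_domains :: "(real \<times> real \<Rightarrow> real) \<Rightarrow> (real \<times> real) set set" where
  "nodal_domains f = components (UNIV - f -` {0})"

definition beta0 :: "(real \<times> real \<Rightarrow> real) \<Rightarrow> enat" where
  "beta0 f = (if finite (nodal_domains f) then enat (card (nodal_domains f)) else \<infinity>)"

end

theory Submission
  imports Defs
    "HOL-Probability.Levy"
    "Jordan_Normal_Form.Char_Poly"
    "HOL-Computational_Algebra.Fundamental_Theorem_Algebra"
begin

text \<open>
  Let \<open>2(k+1)\<close> be the eigenvalue of \<open>f n\<close>. All eigenfunctions up to that level are a
  polynomial of degree at most \<open>k\<close> times the positive factor \<open>exp (- (x\<^sup>2 + y\<^sup>2) / 2)\<close>, so
  the nodal domains of the linear combination are the components of the complement of a plane
  algebraic curve of degree at most \<open>k\<close>. The \<open>1 + 2 + \<dots> + k\<close> eigenfunctions of the lower levels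
  come before \<open>f n\<close>, hence \<open>n \<ge> 1 + k (k + 1) / 2\<close>; and this is exactly the largest number of
  components that the complement of a curve of degree \<open>k\<close> can have (\<open>k\<close> lines in general position
  attain it). The proof therefore has a geometric half and a spectral half.

  Geometric half (\<open>card_components_poly_fun\<close>). After a shear the polynomial is monic in \<open>y\<close>
  (\<open>shear_monic\<close>), and the plane is swept by a vertical line. A component either reaches
  \<open>x = -\<infinity>\<close>, and there are at most \<open>k + 1\<close> of those because the line minus at most \<open>k\<close> roots has at
  most \<open>k + 1\<close> intervals, or it is born at some abscissa \<open>x\<^sub>0\<close>. Let \<open>\<nu>(x)\<close> count the distinct real
  roots and the conjugate pairs of distinct nonreal roots of the polynomial over \<open>x\<close>. Intervals of
  the line at \<open>x\<^sub>0\<close> continue into components that are not new, and where two of them merge a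
  pair of nonreal roots appears; so the number of births at \<open>x\<^sub>0\<close> is at most the jump
  of \<open>\<nu>\<close> from \<open>x\<^sub>0\<close> to its right (\<open>new_components\<close>). The same holds for deaths, with the left side.

  The jumps are paid for by a determinant. By Hermite, \<open>\<nu>(x)\<close> is the number of positive squares of
  the form \<open>q \<mapsto> \<Sum> m\<^sub>i q(y\<^sub>i)\<^sup>2\<close> over the roots \<open>y\<^sub>i\<close> of multiplicity \<open>m\<^sub>i\<close>. Its matrix \<open>S(x)\<close> consists of power
  sums, hence is polynomial in \<open>x\<close>, and if \<open>d \<le> k\<close> is the generic number of distinct
  roots, the determinant of its \<open>d \<times> d\<close> section has degree at most \<open>d (d - 1)\<close>. For small \<open>\<epsilon> > 0\<close> the matrix
  \<open>S - \<epsilon> I\<close> still has \<open>\<nu>\<close> positive squares at generic points, and no more than \<open>\<nu>\<close> at the exceptional ones;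
  between two points its inertia changes by at most the number of zeros of the determinant, with
  multiplicity (\<open>inertia_jump\<close>). So births and deaths together are at most \<open>k (k - 1)\<close>
  (\<open>hermite_total\<close>), and twice the number of components is at most
  \<open>2 (k + 1) + k (k - 1) = 2 + k (k + 1)\<close>. Counting zeros with multiplicity in this way covers
  curves with arbitrary singularities and multiple components.

  Spectral half (\<open>eigenspace_hermite_combination\<close>). For an eigenfunction \<open>u\<close> with eigenvalue \<open>\<mu>\<close> let
  \<open>m\<^sub>a\<^sub>b\<close> be its integral against \<open>x\<^sup>a y\<^sup>b exp (- (x\<^sup>2 + y\<^sup>2) / 2)\<close>. Testing the equation against this
  function gives \<open>(2 (a + b + 1) - \<mu>) m\<^sub>a\<^sub>b = a (a - 1) m\<^sub>a\<^sub>-\<^sub>2\<^sub>,\<^sub>b + b (b - 1) m\<^sub>a\<^sub>,\<^sub>b\<^sub>-\<^sub>2\<close>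
  (\<open>moment_recurrence\<close>), so only the moments with \<open>2 (a + b + 1) = \<mu>\<close> are free, and all moments together
  determine \<open>u\<close> (\<open>zero_if_moments_zero\<close>). Thus \<open>\<mu> = 2 (j + 1)\<close>, and the
  eigenspace has dimension at most \<open>j + 1\<close>; the \<open>j + 1\<close> products of Hermite functions exhaust it.
\<close>

section \<open>Diagonalisation of symmetric matrices by congruence\<close>

unbundle no inner_syntax
unbundle no vec_syntax

lemma pivot_congruence:
  fixes A :: "real mat"
  assumes A: "A \<in> carrier_mat n n" and sym: "A\<^sup>T = A" and nz: "A \<noteq> 0\<^sub>m n n"
  shows "\<exists>E \<in> carrier_mat n n. det E \<noteq> 0 \<and> (E\<^sup>T * A * E) $$ (0,0) \<noteq> 0"
proof -
  obtain i j where ij: "i < n" "j < n" "A $$ (i,j) \<noteq> 0"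
    using nz A by (metis carrier_matD eq_matI index_zero_mat)
  have symij: "A $$ (j,i) = A $$ (i,j)" using sym ij A by (metis carrier_matD index_transpose_mat(1))
  have "\<exists>v \<in> carrier_vec n. v \<bullet> (A *\<^sub>v v) \<noteq> 0"
  proof (rule ccontr)
    assume "\<not> ?thesis"
    then have z: "v \<bullet> (A *\<^sub>v v) = 0" if "v \<in> carrier_vec n" for v using that by auto
    have ii: "A $$ (k,k) = 0" if "k < n" for k
    proof -
      have "unit_vec n k \<bullet> (A *\<^sub>v unit_vec n k) = A $$ (k,k)"
        using that A by (simp add: scalar_prod_left_unit)
      then show ?thesis using z[of "unit_vec n k"] by simp
    qed
    \<comment> \<open>polarisation: a form that vanishes on the unit vectors and on their sums is zero\<close>
    let ?v = "unit_vec n i + unit_vec n j :: real vec"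
    let ?i = "unit_vec n i :: real vec" and ?j = "unit_vec n j :: real vec"
    have Av: "A *\<^sub>v ?v = A *\<^sub>v ?i + A *\<^sub>v ?j"
      by (rule mult_add_distrib_mat_vec[OF A]) auto
    have c: "A *\<^sub>v ?i \<in> carrier_vec n" "A *\<^sub>v ?j \<in> carrier_vec n" using A by auto
    have "?v \<bullet> (A *\<^sub>v ?v) = (?i \<bullet> (A *\<^sub>v ?i) + ?i \<bullet> (A *\<^sub>v ?j)) + (?j \<bullet> (A *\<^sub>v ?i) + ?j \<bullet> (A *\<^sub>v ?j))"
      unfolding Av using c by (simp add: add_scalar_prod_distrib[of _ n] scalar_prod_add_distrib[of _ n])
    also have "\<dots> = (A $$ (i,i) + A $$ (i,j)) + (A $$ (j,i) + A $$ (j,j))"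
      using ij(1,2) A by (simp add: scalar_prod_left_unit)
    finally have "?v \<bullet> (A *\<^sub>v ?v) = A $$ (i,i) + A $$ (i,j) + A $$ (j,i) + A $$ (j,j)" by simp
    then show False using z[of ?v] ii ij symij by simp
  qed
  then obtain v where v: "v \<in> carrier_vec n" and vAv: "v \<bullet> (A *\<^sub>v v) \<noteq> 0" by auto
  have "v \<noteq> 0\<^sub>v n" 
  proof
    assume "v = 0\<^sub>v n"
    then have "v \<bullet> (A *\<^sub>v v) = 0" using A by (simp add: scalar_prod_def)
    then show False using vAv by simp
  qed
  then obtain l where l: "l < n" "v $ l \<noteq> 0" 
    using v by (metis carrier_vecD eq_vecI index_zero_vec(1) index_zero_vec(2))
  \<comment> \<open>\<open>v\<close> becomes the first column; \<open>v $ l \<noteq> 0\<close> makes up for the unit vector that it replaces\<close>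
  define E where "E = mat n n (\<lambda>(r,c). if c = 0 then v $ r else if c = l then (if r = 0 then 1 else 0) else if r = c then 1 else (0::real))"
  have Ec: "E \<in> carrier_mat n n" by (simp add: E_def)
  have col0: "col E 0 = v" using l v by (intro eq_vecI) (auto simp: E_def)
  have "det E \<noteq> 0"
  proof
    assume "det E = 0"
    then obtain w where w: "w \<in> carrier_vec n" "w \<noteq> 0\<^sub>v n" "E *\<^sub>v w = 0\<^sub>v n"
      using det_0_iff_vec_prod_zero[OF Ec] by auto
    have row: "(\<Sum>c<n. E $$ (r,c) * w $ c) = 0" if "r < n" for r
    proof -
      have "(E *\<^sub>v w) $ r = 0" using w that by simp
      moreover have "(E *\<^sub>v w) $ r = (\<Sum>c<n. E $$ (r,c) * w $ c)"
        using that Ec w(1) by (simp add: scalar_prod_def lessThan_atLeast0)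
      ultimately show ?thesis by simp
    qed
    have entry: "E $$ (r,c) * w $ c = (if c = 0 then v $ r * w $ 0 else 0) + 
       (if c = l then (if r = 0 \<and> l \<noteq> 0 then w $ l else 0) else 0) + (if c = r then (if r \<noteq> 0 \<and> r \<noteq> l then w $ r else 0) else 0)"
      if "r < n" "c < n" for r c
      using that by (auto simp: E_def)
    have eq: "v $ r * w $ 0 + (if r = 0 \<and> l \<noteq> 0 then w $ l else 0) + (if r \<noteq> 0 \<and> r \<noteq> l then w $ r else 0) = 0" if "r < n" for r
    proof -
      have "(\<Sum>c<n. E $$ (r,c) * w $ c) = (\<Sum>c<n. (if c = 0 then v $ r * w $ 0 else 0) + 
       (if c = l then (if r = 0 \<and> l \<noteq> 0 then w $ l else 0) else 0) + (if c = r then (if r \<noteq> 0 \<and> r \<noteq> l then w $ r else 0) else 0))"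
        using entry that by (intro sum.cong) auto
      also have "\<dots> = v $ r * w $ 0 + (if r = 0 \<and> l \<noteq> 0 then w $ l else 0) + (if r \<noteq> 0 \<and> r \<noteq> l then w $ r else 0)"
        using that l by (simp add: sum.distrib)
      finally show ?thesis using row[OF that] by simp
    qed
    have w0: "w $ 0 = 0" using eq[of l] l by (auto split: if_splits)
    have "w $ r = 0" if "r < n" for r
      using w0 eq[OF that] eq[of 0] that by (cases "r = l") (auto split: if_splits)
    then have "w = 0\<^sub>v n" using w by auto
    then show False using w by simp
  qed
  moreover have "(E\<^sup>T * A * E) $$ (0,0) = v \<bullet> (A *\<^sub>v v)"
  proof -
    have "(E\<^sup>T * A * E) = E\<^sup>T * (A * E)" using A Ec by simp
    moreover have "(E\<^sup>T * (A * E)) $$ (0,0) = col E 0 \<bullet> (A *\<^sub>v col E 0)"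
      using A Ec l by (simp add: col_mult2[of _ n n] mult_mat_vec_def)
    ultimately show ?thesis using col0 by simp
  qed
  ultimately show ?thesis using vAv Ec by auto
qed

text \<open>
  Lagrange's reduction: a vector on which the form does not vanish is split off, and the Schur
  complement is diagonalised by induction. Later only the signs of the diagonal entries and the
  number of zeros among them matter, and these are invariant under congruence.
\<close>
lemma symmetric_congruent_diagonal:
  fixes A :: "real mat"
  assumes "A \<in> carrier_mat n n" "A\<^sup>T = A"
  shows "\<exists>C \<in> carrier_mat n n. det C \<noteq> 0 \<and> (\<forall>i<n. \<forall>j<n. i \<noteq> j \<longrightarrow> (C\<^sup>T * A * C) $$ (i,j) = 0)"
  using assms
proof (induction n arbitrary: A)
  case 0
  then show ?case by (intro bexI[of _ "1\<^sub>m 0"]) auto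
next
  case (Suc n)
  show ?case
  proof (cases "A = 0\<^sub>m (Suc n) (Suc n)")
    case True
    then show ?thesis by (intro bexI[of _ "1\<^sub>m (Suc n)"]) auto
  next
    case False
    obtain E where E: "E \<in> carrier_mat (Suc n) (Suc n)" "det E \<noteq> 0" "(E\<^sup>T * A * E) $$ (0,0) \<noteq> 0"
      using pivot_congruence[OF Suc.prems False] by auto
    define A1 where "A1 = E\<^sup>T * A * E"
    have A1: "A1 \<in> carrier_mat (Suc n) (Suc n)" using E Suc.prems by (auto simp: A1_def)
    have A1sym: "A1\<^sup>T = A1" using E Suc.prems by (simp add: A1_def transpose_mult[of _ "Suc n" "Suc n" _ "Suc n"])
    define \<alpha> where "\<alpha> = A1 $$ (0,0)"
    have \<alpha>: "\<alpha> \<noteq> 0" using E by (simp add: \<alpha>_def A1_def)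
    define b where "b = mat 1 n (\<lambda>(i,j). A1 $$ (0, Suc j))"
    define B where "B = mat n n (\<lambda>(i,j). A1 $$ (Suc i, Suc j))"
    have b: "b \<in> carrier_mat 1 n" and B: "B \<in> carrier_mat n n" by (auto simp: b_def B_def)
    have A1s: "A1 $$ (j,i) = A1 $$ (i,j)" if "i < Suc n" "j < Suc n" for i j
      using that A1 A1sym by (metis carrier_matD index_transpose_mat(1))
    define a where "a = mat 1 1 (\<lambda>_. \<alpha>)"
    have a: "a \<in> carrier_mat 1 1" by (simp add: a_def)
    have A1b: "A1 = four_block_mat a b b\<^sup>T B"
      using A1 by (intro eq_matI) (auto simp: four_block_mat_def a_def b_def B_def \<alpha>_def Let_def A1s not_less less_Suc_eq_0_disj)
    define B' where "B' = B - (1/\<alpha>) \<cdot>\<^sub>m (b\<^sup>T * b)"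
    have B': "B' \<in> carrier_mat n n" using B b by (auto simp: B'_def)
    have Bsym: "B\<^sup>T = B" using B by (intro eq_matI) (auto simp: B_def A1s)
    have "B'\<^sup>T = B'"
      using B b Bsym by (intro eq_matI) (auto simp: B'_def A1s B_def b_def scalar_prod_def)
    then obtain C where C: "C \<in> carrier_mat n n" "det C \<noteq> 0"
       "\<forall>i<n. \<forall>j<n. i \<noteq> j \<longrightarrow> (C\<^sup>T * B' * C) $$ (i,j) = 0" using Suc.IH[OF B'] by auto
    define g where "g = (- 1/\<alpha>) \<cdot>\<^sub>m b"
    have g: "g \<in> carrier_mat 1 n" using b by (simp add: g_def)
    define T where "T = four_block_mat (1\<^sub>m 1) g (0\<^sub>m n 1) (1\<^sub>m n)"
    define K where "K = four_block_mat (1\<^sub>m 1) (0\<^sub>m 1 n) (0\<^sub>m n 1) C"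
    have T: "T \<in> carrier_mat (Suc n) (Suc n)" and K: "K \<in> carrier_mat (Suc n) (Suc n)"
      using g C by (auto simp: T_def K_def)
    have ag: "a * g + b = 0\<^sub>m 1 n"
      using a b \<alpha> by (intro eq_matI) (auto simp: a_def g_def scalar_prod_def)
    have ga: "g\<^sup>T * a + b\<^sup>T = 0\<^sub>m n 1"
      using a b \<alpha> by (intro eq_matI) (auto simp: a_def g_def scalar_prod_def)
    have bg: "b\<^sup>T * g + B = B'"
      using B b by (intro eq_matI) (auto simp: B'_def g_def scalar_prod_def)
    have TAT: "T\<^sup>T * (A1 * T) = four_block_mat a (0\<^sub>m 1 n) (0\<^sub>m n 1) B'"
    proof -
      have 1: "A1 * T = four_block_mat a (0\<^sub>m 1 n) b\<^sup>T B'"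
        unfolding A1b T_def
        using a b B g ag bg by (subst mult_four_block_mat[of _ 1 1 _ n _ n]) auto
      have 2: "T\<^sup>T = four_block_mat (1\<^sub>m 1) (0\<^sub>m 1 n) g\<^sup>T (1\<^sub>m n)"
        unfolding T_def using g by (subst transpose_four_block_mat[of _ 1 1 _ n _ n]) auto
      show ?thesis unfolding 1 2
        using a b B' g ga by (subst mult_four_block_mat[of _ 1 1 _ n _ n]) auto
    qed
    have KAK: "K\<^sup>T * (T\<^sup>T * (A1 * T) * K) = four_block_mat a (0\<^sub>m 1 n) (0\<^sub>m n 1) (C\<^sup>T * B' * C)"
    proof -
      have 1: "T\<^sup>T * (A1 * T) * K = four_block_mat a (0\<^sub>m 1 n) (0\<^sub>m n 1) (B' * C)"
        unfolding TAT K_def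
        using a B' C by (subst mult_four_block_mat[of _ 1 1 _ n _ n]) auto
      have 2: "K\<^sup>T = four_block_mat (1\<^sub>m 1) (0\<^sub>m 1 n) (0\<^sub>m n 1) C\<^sup>T"
        unfolding K_def using C by (subst transpose_four_block_mat[of _ 1 1 _ n _ n]) auto
      show ?thesis unfolding 1 2
        using a C B' by (subst mult_four_block_mat[of _ 1 1 _ n _ n]) auto
    qed
    let ?C = "E * (T * K)"
    have Cc: "?C \<in> carrier_mat (Suc n) (Suc n)" using E T K by auto
    have eq: "?C\<^sup>T * A * ?C = four_block_mat a (0\<^sub>m 1 n) (0\<^sub>m n 1) (C\<^sup>T * B' * C)"
    proof -
      have "?C\<^sup>T = K\<^sup>T * (T\<^sup>T * E\<^sup>T)"
        using E T K by (simp add: transpose_mult[of _ "Suc n" "Suc n" _ "Suc n"])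
      moreover have "K\<^sup>T * (T\<^sup>T * E\<^sup>T) * A * ?C = K\<^sup>T * (T\<^sup>T * (A1 * T) * K)"
      proof -
        let ?n = "Suc n"
        note c = E(1)[THEN transpose_carrier_mat[THEN iffD2]] T[THEN transpose_carrier_mat[THEN iffD2]] K[THEN transpose_carrier_mat[THEN iffD2]]
        note A' = Suc.prems(1) and TK = mult_carrier_mat[OF T K]
        have 0: "(T\<^sup>T * E\<^sup>T) * A = T\<^sup>T * (E\<^sup>T * A)"
          by (rule assoc_mult_mat[OF c(2) c(1) A'])
        have 1: "K\<^sup>T * (T\<^sup>T * E\<^sup>T) * A = K\<^sup>T * (T\<^sup>T * (E\<^sup>T * A))"
          unfolding 0[symmetric] by (rule assoc_mult_mat[OF c(3) mult_carrier_mat[OF c(2) c(1)] A'])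
        note EA = mult_carrier_mat[OF c(1) A'] and ETK = mult_carrier_mat[OF E(1) TK]
        note TEA = mult_carrier_mat[OF c(2) EA]
        have 2: "K\<^sup>T * (T\<^sup>T * (E\<^sup>T * A)) * (E * (T * K)) = K\<^sup>T * (T\<^sup>T * (E\<^sup>T * A) * (E * (T * K)))"
          by (rule assoc_mult_mat[OF c(3) TEA ETK])
        have 3: "T\<^sup>T * (E\<^sup>T * A) * (E * (T * K)) = T\<^sup>T * (E\<^sup>T * A * (E * (T * K)))"
          by (rule assoc_mult_mat[OF c(2) EA ETK])
        have 4: "E\<^sup>T * A * (E * (T * K)) = A1 * (T * K)"
          unfolding A1_def by (rule assoc_mult_mat[OF EA E(1) TK, symmetric])
        have 5: "A1 * (T * K) = A1 * T * K"
          by (rule assoc_mult_mat[OF A1 T K, symmetric])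
        have 6: "T\<^sup>T * (A1 * T * K) = T\<^sup>T * (A1 * T) * K"
          by (rule assoc_mult_mat[OF c(2) mult_carrier_mat[OF A1 T] K, symmetric])
        show ?thesis unfolding 1 2 3 4 5 6 ..
      qed
      ultimately have "?C\<^sup>T * A * ?C = K\<^sup>T * (T\<^sup>T * (A1 * T) * K)"
        by (simp only:)
      then show ?thesis by (simp only: KAK)
    qed
    have "det T = 1"
      unfolding T_def using g by (subst det_four_block_mat_lower_left_zero[of _ 1 _ n]) auto
    moreover have "det K = det C"
      unfolding K_def using C by (subst det_four_block_mat_lower_left_zero[of _ 1 _ n]) auto
    ultimately have "det ?C \<noteq> 0"
      unfolding det_mult[OF E(1) mult_carrier_mat[OF T K]] det_mult[OF T K] using E(2) C(2) by simp
    moreover have "(?C\<^sup>T * A * ?C) $$ (i,j) = 0" if "i < Suc n" "j < Suc n" "i \<noteq> j" for i j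
    proof -
      define D where "D = C\<^sup>T * B' * C"
      have D: "dim_row D = n" "dim_col D = n" using C(1) B' by (auto simp: D_def)
      have off: "D $$ (i,j) = 0" if "i < n" "j < n" "i \<noteq> j" for i j using C(3) that by (auto simp: D_def)
      show ?thesis
        unfolding eq D_def[symmetric] using that a D off[of "i - 1" "j - 1"]
        by (auto simp: four_block_mat_def Let_def not_less less_Suc_eq_0_disj)
    qed
    ultimately show ?thesis using Cc by blast
  qed
qed

section \<open>Inertia of polynomial families of quadratic forms\<close>

definition qform :: "nat \<Rightarrow> (nat \<Rightarrow> nat \<Rightarrow> real) \<Rightarrow> (nat \<Rightarrow> real) \<Rightarrow> real" where
  "qform d A v = (\<Sum>i<d. \<Sum>j<d. A i j * v i * v j)"

text \<open>
  The inertia of a form is measured by the number of linear equations that cut out a subspace on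
  which the form has a given sign. Two such subspaces meet nontrivially as soon as they are cut out by fewer
  equations than there are unknowns, so two such numbers can be compared by counting equations.
\<close>
definition sign_codim :: "(real \<Rightarrow> bool) \<Rightarrow> nat \<Rightarrow> (nat \<Rightarrow> nat \<Rightarrow> real) \<Rightarrow> nat \<Rightarrow> bool" where
  "sign_codim R d A c \<longleftrightarrow> (\<exists>L :: nat \<Rightarrow> nat \<Rightarrow> real. \<forall>v. (\<exists>i<d. v i \<noteq> 0) \<longrightarrow>
     (\<forall>m<c. (\<Sum>i<d. L m i * v i) = 0) \<longrightarrow> R (qform d A v))"

abbreviation "pos_codim \<equiv> sign_codim (\<lambda>r. 0 < r)"
abbreviation "nonpos_codim \<equiv> sign_codim (\<lambda>r. r \<le> 0)"
lemma underdetermined_system: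
  fixes L :: "nat \<Rightarrow> 'i \<Rightarrow> 'a::field"
  assumes "finite I" "m < card I"
  shows "\<exists>v. (\<exists>i\<in>I. v i \<noteq> 0) \<and> (\<forall>k<m. (\<Sum>i\<in>I. L k i * v i) = 0)"
  using assms
proof (induction m arbitrary: I L)
  case 0
  then obtain i where "i \<in> I" by fastforce
  then show ?case by (intro exI[of _ "\<lambda>_. 1"]) auto
next
  case (Suc m)
  show ?case
  proof (cases "\<forall>i\<in>I. L m i = 0")
    case True
    obtain v where v: "\<exists>i\<in>I. v i \<noteq> 0" "\<forall>k<m. (\<Sum>i\<in>I. L k i * v i) = 0"
      using Suc.IH[of I L] Suc.prems by auto
    have "(\<Sum>i\<in>I. L m i * v i) = 0" using True by simp
    with v show ?thesis by (intro exI[of _ v]) (auto simp: less_Suc_eq)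
  next
    case False
    then obtain j where j: "j \<in> I" "L m j \<noteq> 0" by auto
    define J where "J = I - {j}"
    have J: "finite J" "m < card J" "j \<notin> J" "I = insert j J" using j Suc.prems by (auto simp: J_def)
    obtain v where v: "\<exists>i\<in>J. v i \<noteq> 0" "\<forall>k<m. (\<Sum>i\<in>J. (L k i - L k j * L m i / L m j) * v i) = 0"
      using Suc.IH[OF J(1,2), of "\<lambda>k i. L k i - L k j * L m i / L m j"] by auto
    define w where "w = v(j := - (\<Sum>i\<in>J. L m i * v i) / L m j)"
    have sum_w: "(\<Sum>i\<in>I. L k i * w i) = (\<Sum>i\<in>J. (L k i - L k j * L m i / L m j) * v i)" for k
    proof -
      have "(\<Sum>i\<in>I. L k i * w i) = L k j * w j + (\<Sum>i\<in>J. L k i * v i)"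
        using J by (simp add: w_def) (intro sum.cong, auto)
      also have "\<dots> = (\<Sum>i\<in>J. (L k i - L k j * L m i / L m j) * v i)"
        by (simp add: w_def algebra_simps sum_subtractf sum_distrib_left sum_divide_distrib)
      finally show ?thesis .
    qed
    have "(\<Sum>i\<in>I. L k i * w i) = 0" if "k < Suc m" for k
      using that v(2) j unfolding sum_w by (cases "k = m") auto
    moreover have "\<exists>i\<in>I. w i \<noteq> 0" using v(1) J by (auto simp: w_def)
    ultimately show ?thesis by blast
  qed
qed

text \<open>
  This comparison is the only place where the two kinds of subspaces meet: a common nonzero vector
  would have to give the form both signs.
\<close>
lemma pos_nonpos_codim:
  assumes "pos_codim d A c" "nonpos_codim d A c'"
  shows "d \<le> c + c'"
proof (rule ccontr)
  assume less: "\<not> d \<le> c + c'"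
  obtain L where L: "\<And>v. \<lbrakk>\<exists>i<d. v i \<noteq> 0; \<forall>m<c. (\<Sum>i<d. L m i * v i) = 0\<rbrakk> \<Longrightarrow> 0 < qform d A v"
    using assms unfolding sign_codim_def by blast
  obtain L' where L': "\<And>v. \<lbrakk>\<exists>i<d. v i \<noteq> 0; \<forall>m<c'. (\<Sum>i<d. L' m i * v i) = 0\<rbrakk> \<Longrightarrow> qform d A v \<le> 0"
    using assms unfolding sign_codim_def by blast
  obtain v where v: "\<exists>i\<in>{..<d}. v i \<noteq> 0"
     "\<forall>k<c+c'. (\<Sum>i\<in>{..<d}. (if k < c then L k i else L' (k - c) i) * v i) = 0"
    using underdetermined_system[of "{..<d}" "c + c'" "\<lambda>k i. if k < c then L k i else L' (k - c) i"]
      less by auto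
  have "(\<Sum>i<d. L m i * v i) = 0" if "m < c" for m using v(2)[rule_format, of m] that by simp
  moreover have "(\<Sum>i<d. L' m i * v i) = 0" if "m < c'" for m using v(2)[rule_format, of "c + m"] that by simp
  ultimately show False using L[of v] L'[of v] v(1) by fastforce
qed

lemma sign_codim_mono: "sign_codim R d A c \<Longrightarrow> c \<le> c' \<Longrightarrow> sign_codim R d A c'"
  unfolding sign_codim_def by (elim exE, rule_tac x = L in exI) auto

lemma sign_codimI:
  assumes "finite I" "card I = c"
    and "\<And>v. \<lbrakk>\<exists>i<d. v i \<noteq> 0; \<And>m. m \<in> I \<Longrightarrow> (\<Sum>i<d. L m i * v i) = 0\<rbrakk> \<Longrightarrow> R (qform d A v)"
  shows "sign_codim R d A c"
proof -
  obtain h where h: "bij_betw h {0..<c} I" using ex_bij_betw_nat_finite assms by blast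
  show ?thesis unfolding sign_codim_def
  proof (intro exI[of _ "\<lambda>m. L (h m)"] allI impI)
    fix v :: "nat \<Rightarrow> real" assume v: "\<exists>i<d. v i \<noteq> 0" "\<forall>m<c. (\<Sum>i<d. L (h m) i * v i) = 0"
    have "(\<Sum>i<d. L m i * v i) = 0" if m: "m \<in> I" for m
    proof -
      have "m \<in> h ` {0..<c}" using m h by (simp add: bij_betw_def)
      then obtain k where "k < c" "m = h k" by auto
      then show ?thesis using v(2) by simp
    qed
    then show "R (qform d A v)" using assms(3) v(1) by blast
  qed
qed
lemma qform_near_diagonal:
  assumes "\<And>i j. i < d \<Longrightarrow> j < d \<Longrightarrow> \<bar>B i j - (if i = j then \<delta> i else 0)\<bar> \<le> \<eta>"
  shows "\<bar>qform d B w - (\<Sum>i<d. \<delta> i * (w i)\<^sup>2)\<bar> \<le> \<eta> * real d * (\<Sum>i<d. (w i)\<^sup>2)"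
proof -
  have diag: "(\<Sum>i<d. \<delta> i * (w i)\<^sup>2) = (\<Sum>i<d. \<Sum>j<d. (if i = j then \<delta> i else 0) * w i * w j)"
    by (intro sum.cong refl) (simp add: if_distrib [where f = "\<lambda>x. x * _"] power2_eq_square mult.assoc cong: if_cong)
  have "\<bar>qform d B w - (\<Sum>i<d. \<delta> i * (w i)\<^sup>2)\<bar> = \<bar>\<Sum>i<d. \<Sum>j<d. (B i j - (if i = j then \<delta> i else 0)) * w i * w j\<bar>"
    unfolding diag qform_def by (simp add: sum_subtractf left_diff_distrib)
  also have "\<dots> \<le> (\<Sum>i<d. \<Sum>j<d. \<eta> * (((w i)\<^sup>2 + (w j)\<^sup>2) / 2))"
  proof (intro order_trans[OF sum_abs] sum_mono)
    fix i j assume "i \<in> {..<d}" "j \<in> {..<d}"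
    then have e: "\<bar>B i j - (if i = j then \<delta> i else 0)\<bar> \<le> \<eta>" using assms by auto
    have "\<bar>w i * w j\<bar> \<le> ((w i)\<^sup>2 + (w j)\<^sup>2) / 2"
      using sum_squares_bound[of "\<bar>w i\<bar>" "\<bar>w j\<bar>"] by (simp add: abs_mult)
    have "\<bar>(B i j - (if i = j then \<delta> i else 0)) * w i * w j\<bar> = \<bar>B i j - (if i = j then \<delta> i else 0)\<bar> * \<bar>w i * w j\<bar>"
      by (simp only: abs_mult mult.assoc)
    also have "\<dots> \<le> \<eta> * (((w i)\<^sup>2 + (w j)\<^sup>2) / 2)"
      using e \<open>\<bar>w i * w j\<bar> \<le> _\<close> by (intro mult_mono) auto
    finally show "\<bar>(B i j - (if i = j then \<delta> i else 0)) * w i * w j\<bar> \<le> \<eta> * (((w i)\<^sup>2 + (w j)\<^sup>2) / 2)" .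
  qed
  also have "\<dots> = \<eta> * real d * (\<Sum>i<d. (w i)\<^sup>2)"
    by (simp add: sum_distrib_left[symmetric] sum_divide_distrib[symmetric] sum.distrib)
  finally show ?thesis .
qed

lemma sum_swap_pairs:
  fixes f :: "_ \<Rightarrow> _ \<Rightarrow> _ \<Rightarrow> _ \<Rightarrow> 'c::comm_monoid_add"
  shows "(\<Sum>a\<in>A. \<Sum>b\<in>A. \<Sum>i\<in>B. \<Sum>j\<in>B. f a b i j) = (\<Sum>i\<in>B. \<Sum>j\<in>B. \<Sum>a\<in>A. \<Sum>b\<in>A. f a b i j)"
proof -
  have "(\<Sum>a\<in>A. \<Sum>b\<in>A. \<Sum>i\<in>B. \<Sum>j\<in>B. f a b i j) = (\<Sum>a\<in>A. \<Sum>i\<in>B. \<Sum>b\<in>A. \<Sum>j\<in>B. f a b i j)"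
    by (rule sum.cong[OF refl], rule sum.swap)
  also have "\<dots> = (\<Sum>i\<in>B. \<Sum>a\<in>A. \<Sum>b\<in>A. \<Sum>j\<in>B. f a b i j)"
    by (rule sum.swap)
  also have "\<dots> = (\<Sum>i\<in>B. \<Sum>a\<in>A. \<Sum>j\<in>B. \<Sum>b\<in>A. f a b i j)"
    by (rule sum.cong[OF refl], rule sum.cong[OF refl], rule sum.swap)
  also have "\<dots> = (\<Sum>i\<in>B. \<Sum>j\<in>B. \<Sum>a\<in>A. \<Sum>b\<in>A. f a b i j)"
    by (rule sum.cong[OF refl], rule sum.swap)
  finally show ?thesis .
qed

lemma qform_congruence:
  assumes "\<And>a. a < d \<Longrightarrow> v a = (\<Sum>i<d. C a i * w i)"
  shows "qform d A v = qform d (\<lambda>i j. \<Sum>a<d. \<Sum>b<d. C a i * A a b * C b j) w"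
proof -
  have "qform d A v = (\<Sum>a<d. \<Sum>b<d. A a b * (\<Sum>i<d. C a i * w i) * (\<Sum>j<d. C b j * w j))"
    unfolding qform_def using assms by (intro sum.cong refl) auto
  also have "\<dots> = (\<Sum>a<d. \<Sum>b<d. \<Sum>i<d. \<Sum>j<d. C a i * A a b * C b j * w i * w j)"
    by (simp add: sum_distrib_left sum_distrib_right mult_ac)
  also have "\<dots> = (\<Sum>i<d. \<Sum>j<d. \<Sum>a<d. \<Sum>b<d. C a i * A a b * C b j * w i * w j)"
    by (rule sum_swap_pairs)
  also have "\<dots> = qform d (\<lambda>i j. \<Sum>a<d. \<Sum>b<d. C a i * A a b * C b j) w"
    by (simp add: qform_def sum_distrib_right)
  finally show ?thesis .
qed

text \<open>
  Every product in the Leibniz formula takes one entry from each row, so each row that is divisible by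
  \<open>q\<close> contributes a factor.
\<close>
lemma power_dvd_det:
  fixes M :: "'a::comm_ring_1 mat"
  assumes M: "M \<in> carrier_mat d d" and Z: "Z \<subseteq> {0..<d}"
    and dvd: "\<And>i j. i \<in> Z \<Longrightarrow> j < d \<Longrightarrow> q dvd M $$ (i,j)"
  shows "q ^ card Z dvd det M"
proof -
  have fZ: "finite Z" using Z finite_subset by blast
  have "q ^ card Z dvd (\<Prod>i=0..<d. M $$ (i, \<pi> i))" if "\<pi> permutes {0..<d}" for \<pi>
  proof -
    have "q ^ card Z = (\<Prod>i\<in>Z. q)" by simp
    also have "\<dots> dvd (\<Prod>i\<in>Z. M $$ (i, \<pi> i))"
    proof (rule prod_dvd_prod)
      fix i assume "i \<in> Z"
      then show "q dvd M $$ (i, \<pi> i)" using dvd permutes_in_image[OF that] Z by auto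
    qed
    also have "\<dots> dvd (\<Prod>i=0..<d. M $$ (i, \<pi> i))"
      using Z by (intro prod_dvd_prod_subset) auto
    finally show ?thesis .
  qed
  then show ?thesis unfolding det_def'[OF M] by (intro dvd_sum dvd_mult) auto
qed


text \<open>
  Diagonalise the matrix at \<open>z\<close> by a constant congruence. The strictly positive and the strictly
  negative directions keep their sign nearby, so the inertia can move by at most the number of
  zeros on the diagonal at \<open>z\<close>. Each of these zeros belongs to a row that vanishes at \<open>z\<close>, hence is
  divisible by \<open>X - z\<close>; so their number is at most the order of the determinant at \<open>z\<close>.
\<close>
lemma local_inertia:
  fixes P :: "real poly mat"
  assumes P: "P \<in> carrier_mat d d" and sym: "P\<^sup>T = P" and G: "det P \<noteq> 0"
  defines "A \<equiv> (\<lambda>x i j. poly (P $$ (i,j)) x)"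
  shows "\<exists>p\<le>d. nonpos_codim d (A z) p \<and>
    (\<exists>e>0. \<forall>x. \<bar>x - z\<bar> < e \<longrightarrow> pos_codim d (A x) (d - p) \<and> nonpos_codim d (A x) (p + order z (det P)))"
proof -
  define Pz where "Pz = map_mat (\<lambda>p. poly p z) P"
  have Pz: "Pz \<in> carrier_mat d d" "Pz\<^sup>T = Pz"
    using P sym by (auto simp: Pz_def map_mat_transpose)
  obtain C where C: "C \<in> carrier_mat d d" "det C \<noteq> 0"
    and diag: "\<And>i j. i < d \<Longrightarrow> j < d \<Longrightarrow> i \<noteq> j \<Longrightarrow> (C\<^sup>T * Pz * C) $$ (i,j) = 0"
    using symmetric_congruent_diagonal[OF Pz] by blast
  obtain D where D: "D \<in> carrier_mat d d" "C * D = 1\<^sub>m d"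
    using det_non_zero_imp_unit[OF C, of "()"] by (auto simp: Units_def ring_mat_def)
  define K where "K = map_mat (\<lambda>c. [:c:]) C"
  have K: "K \<in> carrier_mat d d" using C by (auto simp: K_def)
  define Q where "Q = K\<^sup>T * (P * K)"
  have Q: "Q \<in> carrier_mat d d" using K P by (auto simp: Q_def)
  define B where "B = (\<lambda>x i j. poly (Q $$ (i,j)) x)"
  have B_eq: "B x i j = (\<Sum>a<d. \<Sum>b<d. C $$ (a,i) * A x a b * C $$ (b,j))" if "i < d" "j < d" for x i j
    using that K P C by (simp add: B_def Q_def K_def A_def scalar_prod_def poly_sum lessThan_atLeast0 sum_distrib_left mult_ac)
  have Bz_eq: "B z i j = (C\<^sup>T * Pz * C) $$ (i,j)" if "i < d" "j < d" for i j
  proof -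
    have "(C\<^sup>T * Pz * C) = C\<^sup>T * (Pz * C)" using C Pz by simp
    then show ?thesis
      using that P C B_eq[OF that, of z] by (simp add: Pz_def A_def scalar_prod_def lessThan_atLeast0 sum_distrib_left mult.assoc)
  qed
  define \<delta> where "\<delta> = (\<lambda>i. B z i i)"
  have Bz: "B z i j = (if i = j then \<delta> i else 0)" if "i < d" "j < d" for i j
    using that diag Bz_eq by (auto simp: \<delta>_def)
  define Pos where "Pos = {i. i < d \<and> \<delta> i > 0}"
  define Neg where "Neg = {i. i < d \<and> \<delta> i < 0}"
  define Zer where "Zer = {i. i < d \<and> \<delta> i = 0}"
  have fin: "finite Pos" "finite Neg" "finite Zer" by (auto simp: Pos_def Neg_def Zer_def)
  have union: "{..<d} = (Pos \<union> Zer) \<union> Neg" by (auto simp: Pos_def Neg_def Zer_def)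
  have cards: "d = card Pos + card Zer + card Neg"
  proof -
    have "card {..<d} = card (Pos \<union> Zer) + card Neg"
      unfolding union using fin by (intro card_Un_disjoint) (auto simp: Pos_def Neg_def Zer_def)
    also have "card (Pos \<union> Zer) = card Pos + card Zer"
      using fin by (intro card_Un_disjoint) (auto simp: Pos_def Neg_def Zer_def)
    finally show ?thesis by simp
  qed
  \<comment> \<open>rows of the congruent matrix that vanish at \<open>z\<close> put factors \<open>X - z\<close> into the determinant\<close>
  have order: "card Zer \<le> order z (det P)"
  proof -
    have "[:- z, 1:] ^ card Zer dvd det Q"
    proof (rule power_dvd_det[OF Q])
      show "Zer \<subseteq> {0..<d}" by (auto simp: Zer_def)
      fix i j assume ij: "i \<in> Zer" "j < d"
      then have "B z i j = 0" using Bz[of i j] by (auto simp: Zer_def)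
      then show "[:- z, 1:] dvd Q $$ (i,j)" by (simp add: B_def poly_eq_0_iff_dvd)
    qed
    moreover have "det Q = Polynomial.smult ((det C)\<^sup>2) (det P)"
    proof -
      interpret h: comm_ring_hom "\<lambda>c::real. [:c:]" by unfold_locales auto
      have "det K = [:det C:]" by (simp add: K_def)
      moreover have "det Q = det K * (det P * det K)"
        unfolding Q_def using K P by (simp add: det_mult[of _ d] det_transpose[of _ d])
      ultimately show ?thesis by (simp add: power2_eq_square)
    qed
    ultimately have "[:- z, 1:] ^ card Zer dvd det P" using C by (simp add: dvd_smult_iff)
    then show ?thesis using G by (simp add: order_divides)
  qed
  define w where "w = (\<lambda>v i. \<Sum>j<d. D $$ (i,j) * v j)"
  have v_w: "v a = (\<Sum>i<d. C $$ (a,i) * w v i)" if "a < d" for v a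
  proof -
    have "(\<Sum>i<d. C $$ (a,i) * w v i) = (\<Sum>j<d. (\<Sum>i<d. C $$ (a,i) * D $$ (i,j)) * v j)"
      unfolding w_def sum_distrib_left sum_distrib_right by (subst sum.swap) (simp add: mult.assoc)
    also have "\<dots> = (\<Sum>j<d. (if j = a then 1 else 0) * v j)"
    proof (intro sum.cong refl)
      fix j assume j: "j \<in> {..<d}"
      have "(C * D) $$ (a,j) = (\<Sum>i<d. C $$ (a,i) * D $$ (i,j))"
        using j that C(1) D(1) by (simp add: scalar_prod_def lessThan_atLeast0)
      moreover have "(C * D) $$ (a,j) = (if j = a then 1 else 0)" using D(2) j that by auto
      ultimately have "(\<Sum>i<d. C $$ (a,i) * D $$ (i,j)) = (if j = a then 1 else 0)" by simp
      then show "(\<Sum>i<d. C $$ (a,i) * D $$ (i,j)) * v j = (if j = a then 1 else 0) * v j" by simp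
    qed
    also have "\<dots> = v a" using that by (simp add: if_distrib[where f = "\<lambda>x. x * _"] cong: if_cong)
    finally show ?thesis ..
  qed
  have form: "qform d (A x) v = qform d (B x) (w v)" for x v
  proof -
    have "qform d (A x) v = qform d (\<lambda>i j. \<Sum>a<d. \<Sum>b<d. C $$ (a,i) * A x a b * C $$ (b,j)) (w v)"
      by (rule qform_congruence) (rule v_w)
    also have "\<dots> = qform d (B x) (w v)" unfolding qform_def by (intro sum.cong refl) (simp add: B_eq)
    finally show ?thesis .
  qed
  have w_nz: "0 < (\<Sum>i<d. (w v i)\<^sup>2)" if "\<exists>i<d. v i \<noteq> 0" for v
  proof -
    have "\<exists>i<d. w v i \<noteq> 0"
    proof (rule ccontr)
      assume "\<not> ?thesis"
      then have "v a = 0" if "a < d" for a using v_w[OF that, of v] by simp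
      then show False using that by auto
    qed
    then obtain i where "i < d" "w v i \<noteq> 0" by auto
    then show ?thesis by (intro sum_pos2[of _ i]) auto
  qed
  obtain m where m: "m > 0" "\<And>i. i < d \<Longrightarrow> \<delta> i \<noteq> 0 \<Longrightarrow> m \<le> \<bar>\<delta> i\<bar>"
  proof
    let ?S = "insert 1 ((\<lambda>i. \<bar>\<delta> i\<bar>) ` {i. i < d \<and> \<delta> i \<noteq> 0})"
    have f: "finite ?S" by auto
    show "Min ?S > 0" using f by (subst Min_gr_iff) auto
    show "Min ?S \<le> \<bar>\<delta> i\<bar>" if "i < d" "\<delta> i \<noteq> 0" for i using f that by (intro Min_le) auto
  qed
  define \<eta> where "\<eta> = m / (real d + 1)"
  have \<eta>: "\<eta> > 0" "\<eta> * real d < m" using m by (auto simp: \<eta>_def field_simps)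
  have "eventually (\<lambda>x. \<forall>i\<in>{..<d}. \<forall>j\<in>{..<d}. \<bar>B x i j - B z i j\<bar> < \<eta>) (nhds z)"
  proof (intro eventually_ball_finite ballI finite_lessThan)
    fix i j
    have "((\<lambda>x. B x i j) \<longlongrightarrow> B z i j) (nhds z)"
      unfolding B_def by (intro tendsto_poly filterlim_ident)
    then show "eventually (\<lambda>x. \<bar>B x i j - B z i j\<bar> < \<eta>) (nhds z)"
      using \<eta>(1) by (simp add: tendsto_iff dist_real_def)
  qed
  then obtain e where e: "e > 0" "\<And>x i j. \<bar>x - z\<bar> < e \<Longrightarrow> i < d \<Longrightarrow> j < d \<Longrightarrow> \<bar>B x i j - B z i j\<bar> < \<eta>"
    unfolding eventually_nhds_metric dist_real_def by auto
  have near: "\<bar>qform d (B x) u - (\<Sum>i<d. \<delta> i * (u i)\<^sup>2)\<bar> \<le> \<eta> * real d * (\<Sum>i<d. (u i)\<^sup>2)" if "\<bar>x - z\<bar> < e" for x u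
  proof (rule qform_near_diagonal)
    fix i j assume "i < d" "j < d"
    then show "\<bar>B x i j - (if i = j then \<delta> i else 0)\<bar> \<le> \<eta>"
      using e(2)[OF that, of i j] Bz[of i j] by simp
  qed
  have at_z: "qform d (B z) u = (\<Sum>i<d. \<delta> i * (u i)\<^sup>2)" for u
    using qform_near_diagonal[of d "B z" \<delta> 0 u] Bz by simp
  have "nonpos_codim d (A z) (card Pos)"
  proof (rule sign_codimI[OF fin(1) refl, where L = "\<lambda>i j. D $$ (i,j)"])
    fix v :: "nat \<Rightarrow> real" assume "\<And>i. i \<in> Pos \<Longrightarrow> (\<Sum>j<d. D $$ (i,j) * v j) = 0"
    then have "w v i = 0" if "i < d" "\<delta> i > 0" for i using that by (auto simp: w_def Pos_def)
    then show "qform d (A z) v \<le> 0"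
      unfolding form at_z
    proof (intro sum_nonpos)
      fix i assume "i \<in> {..<d}"
      then show "\<delta> i * (w v i)\<^sup>2 \<le> 0"
        using \<open>\<And>i. i < d \<Longrightarrow> \<delta> i > 0 \<Longrightarrow> w v i = 0\<close>[of i]
        by (cases "\<delta> i > 0") (auto simp: mult_nonpos_nonneg)
    qed
  qed
  moreover have "pos_codim d (A x) (d - card Pos)" if x: "\<bar>x - z\<bar> < e" for x
  proof (rule sign_codimI[where I = "{..<d} - Pos" and L = "\<lambda>i j. D $$ (i,j)"])
    show "card ({..<d} - Pos) = d - card Pos"
      by (subst card_Diff_subset) (auto simp: Pos_def)
    fix v :: "nat \<Rightarrow> real" assume nz: "\<exists>i<d. v i \<noteq> 0" and "\<And>i. i \<in> {..<d} - Pos \<Longrightarrow> (\<Sum>j<d. D $$ (i,j) * v j) = 0"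
    then have w0: "w v i = 0" if "i < d" "\<not> \<delta> i > 0" for i using that by (auto simp: w_def Pos_def)
    have "m * (\<Sum>i<d. (w v i)\<^sup>2) \<le> (\<Sum>i<d. \<delta> i * (w v i)\<^sup>2)"
      unfolding sum_distrib_left
    proof (rule sum_mono)
      fix i assume "i \<in> {..<d}"
      then show "m * (w v i)\<^sup>2 \<le> \<delta> i * (w v i)\<^sup>2"
        using w0[of i] m(2)[of i] by (cases "\<delta> i > 0") (auto intro: mult_right_mono)
    qed
    moreover have "\<eta> * real d * (\<Sum>i<d. (w v i)\<^sup>2) < m * (\<Sum>i<d. (w v i)\<^sup>2)"
      using \<eta>(2) w_nz[OF nz] by (rule mult_strict_right_mono)
    ultimately show "0 < qform d (A x) v" using near[OF x, of "w v"] unfolding form by linarith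
  qed auto
  moreover have "nonpos_codim d (A x) (d - card Neg)" if x: "\<bar>x - z\<bar> < e" for x
  proof (rule sign_codimI[where I = "{..<d} - Neg" and L = "\<lambda>i j. D $$ (i,j)"])
    show "card ({..<d} - Neg) = d - card Neg"
      by (subst card_Diff_subset) (auto simp: Neg_def)
    fix v :: "nat \<Rightarrow> real" assume nz: "\<exists>i<d. v i \<noteq> 0" and "\<And>i. i \<in> {..<d} - Neg \<Longrightarrow> (\<Sum>j<d. D $$ (i,j) * v j) = 0"
    then have w0: "w v i = 0" if "i < d" "\<not> \<delta> i < 0" for i using that by (auto simp: w_def Neg_def)
    have "(\<Sum>i<d. \<delta> i * (w v i)\<^sup>2) \<le> - m * (\<Sum>i<d. (w v i)\<^sup>2)"
      unfolding sum_distrib_left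
    proof (rule sum_mono)
      fix i assume "i \<in> {..<d}"
      then show "\<delta> i * (w v i)\<^sup>2 \<le> - m * (w v i)\<^sup>2"
        using w0[of i] m(2)[of i] mult_right_mono[of m "- \<delta> i" "(w v i)\<^sup>2"]
        by (cases "\<delta> i < 0") auto
    qed
    moreover have "\<eta> * real d * (\<Sum>i<d. (w v i)\<^sup>2) < m * (\<Sum>i<d. (w v i)\<^sup>2)"
      using \<eta>(2) w_nz[OF nz] by (rule mult_strict_right_mono)
    ultimately show "qform d (A x) v \<le> 0" using near[OF x, of "w v"] unfolding form by linarith
  qed auto
  moreover have "d - card Neg \<le> card Pos + order z (det P)" using cards order by simp
  moreover have "card Pos \<le> d" using cards by simp
  ultimately show ?thesis using e(1) sign_codim_mono by blast
qed


text \<open>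
  A counting function that can change at \<open>z\<close> by at most \<open>m z\<close> changes on an interval by at most the sum
  of \<open>m\<close>. The exceptional clause for \<open>y = z\<close> says that the value at \<open>z\<close> itself is not larger than
  the neighbouring ones; it is what allows the half-open interval in the conclusion, and half-open
  intervals can be concatenated without counting an end point twice.
\<close>
lemma jump_bound:
  fixes \<nu> m :: "real \<Rightarrow> nat"
  assumes fin: "finite {z. m z \<noteq> 0}" and ab: "a \<le> b"
    and loc: "\<And>z. \<exists>e>0. \<forall>x y. \<bar>x - z\<bar> < e \<longrightarrow> \<bar>y - z\<bar> < e \<longrightarrow> \<nu> y \<le> \<nu> x + (if y = z then 0 else m z)"
  shows "\<nu> b \<le> \<nu> a + (\<Sum>z \<in> {z. m z \<noteq> 0 \<and> a \<le> z \<and> z < b}. m z)"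
proof -
  define S where "S = (\<lambda>a b. \<Sum>z \<in> {z. m z \<noteq> 0 \<and> a \<le> z \<and> z < b}. m z)"
  have fin: "finite {z. m z \<noteq> 0 \<and> a \<le> z \<and> z < b}" for a b
    using fin by (rule rev_finite_subset) auto
  have "\<nu> b \<le> \<nu> a + S a b"
  proof (rule Bolzano[OF ab, where P = "\<lambda>a b. \<nu> b \<le> \<nu> a + S a b"])
    fix a b c :: real assume *: "\<nu> b \<le> \<nu> a + S a b" "\<nu> c \<le> \<nu> b + S b c" "a \<le> b" "b \<le> c"
    have "S a c = S a b + S b c" unfolding S_def using *(3,4)
      by (subst sum.union_disjoint[OF fin fin, symmetric]) (auto intro!: sum.cong)
    then show "\<nu> c \<le> \<nu> a + S a c" using * by simp
  next
    fix z :: real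
    obtain e where e: "e > 0" "\<And>x y. \<bar>x - z\<bar> < e \<Longrightarrow> \<bar>y - z\<bar> < e \<Longrightarrow> \<nu> y \<le> \<nu> x + (if y = z then 0 else m z)"
      using loc[of z] by blast
    show "\<exists>e>0. \<forall>a b. a \<le> z \<and> z \<le> b \<and> b - a < e \<longrightarrow> \<nu> b \<le> \<nu> a + S a b"
    proof (intro exI[of _ e] conjI allI impI)
      fix a b assume ab: "a \<le> z \<and> z \<le> b \<and> b - a < e"
      have *: "\<nu> b \<le> \<nu> a + (if b = z then 0 else m z)" using ab by (intro e(2)) auto
      show "\<nu> b \<le> \<nu> a + S a b"
      proof (cases "b = z \<or> m z = 0")
        case True
        then show ?thesis using * by (auto split: if_splits)
      next
        case False
        then have "m z \<le> S a b" unfolding S_def using ab fin by (intro member_le_sum) auto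
        then show ?thesis using * False by simp
      qed
    qed (rule e)
  qed
  then show ?thesis unfolding S_def .
qed

lemma jump_bound_left:
  fixes \<nu> m :: "real \<Rightarrow> nat"
  assumes fin: "finite {z. m z \<noteq> 0}" and ab: "a \<le> b"
    and loc: "\<And>z. \<exists>e>0. \<forall>x y. \<bar>x - z\<bar> < e \<longrightarrow> \<bar>y - z\<bar> < e \<longrightarrow> \<nu> y \<le> \<nu> x + (if y = z then 0 else m z)"
  shows "\<nu> a \<le> \<nu> b + (\<Sum>z \<in> {z. m z \<noteq> 0 \<and> a < z \<and> z \<le> b}. m z)"
proof -
  have "\<nu> (- (- a)) \<le> \<nu> (- (- b)) + (\<Sum>z \<in> {z. m (- z) \<noteq> 0 \<and> - b \<le> z \<and> z < - a}. m (- z))"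
  proof (rule jump_bound)
    have "{z. m (- z) \<noteq> 0} = uminus ` {z. m z \<noteq> 0}" by (auto simp: image_iff) (metis minus_minus)
    then show "finite {z. m (- z) \<noteq> 0}" using fin by simp
    fix z
    obtain e where e: "e > 0" "\<And>x y. \<bar>x - - z\<bar> < e \<Longrightarrow> \<bar>y - - z\<bar> < e \<Longrightarrow> \<nu> y \<le> \<nu> x + (if y = - z then 0 else m (- z))"
      using loc[of "- z"] by blast
    have "\<nu> (- y) \<le> \<nu> (- x) + (if y = z then 0 else m (- z))" if "\<bar>x - z\<bar> < e" "\<bar>y - z\<bar> < e" for x y
      using e(2)[of "- x" "- y"] that by (simp add: abs_minus_commute)
    then show "\<exists>e>0. \<forall>x y. \<bar>x - z\<bar> < e \<longrightarrow> \<bar>y - z\<bar> < e \<longrightarrow> \<nu> (- y) \<le> \<nu> (- x) + (if y = z then 0 else m (- z))"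
      using e(1) by blast
  qed (use ab in auto)
  also have "(\<Sum>z \<in> {z. m (- z) \<noteq> 0 \<and> - b \<le> z \<and> z < - a}. m (- z)) = (\<Sum>z \<in> {z. m z \<noteq> 0 \<and> a < z \<and> z \<le> b}. m z)"
    by (rule sum.reindex_bij_witness[of _ uminus uminus]) auto
  finally show ?thesis by simp
qed

text \<open>
  The least codimension \<open>\<nu>\<close> of a subspace on which the form is nonpositive is the number of positive
  squares. It is lower semicontinuous and, by the local statement, moves at \<open>z\<close> by at most the order of the
  determinant.
\<close>
lemma inertia_jump:
  fixes P :: "real poly mat"
  assumes P: "P \<in> carrier_mat d d" and sym: "P\<^sup>T = P" and G: "det P \<noteq> 0" and ab: "a \<le> b"
  defines "A \<equiv> (\<lambda>x i j. poly (P $$ (i,j)) x)"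
  shows "\<lbrakk>nonpos_codim d (A a) p; \<And>q'. nonpos_codim d (A b) q' \<Longrightarrow> q \<le> q'\<rbrakk> \<Longrightarrow>
      q \<le> p + (\<Sum>z \<in> {z. order z (det P) \<noteq> 0 \<and> a \<le> z \<and> z < b}. order z (det P))"
    and "\<lbrakk>nonpos_codim d (A b) p; \<And>q'. nonpos_codim d (A a) q' \<Longrightarrow> q \<le> q'\<rbrakk> \<Longrightarrow>
      q \<le> p + (\<Sum>z \<in> {z. order z (det P) \<noteq> 0 \<and> a < z \<and> z \<le> b}. order z (det P))"
proof -
  define \<nu> where "\<nu> = (\<lambda>x. LEAST c. nonpos_codim d (A x) c)"
  have fin: "finite {z. order z (det P) \<noteq> 0}"
    using poly_roots_finite[OF G] G by (simp add: order_root)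
  have ex: "\<exists>c. nonpos_codim d (A x) c" for x using local_inertia[OF P sym G, of x] by (auto simp: A_def)
  have \<nu>: "nonpos_codim d (A x) (\<nu> x)" for x unfolding \<nu>_def using ex by (rule LeastI_ex)
  have \<nu>_le: "\<nu> x \<le> c" if "nonpos_codim d (A x) c" for x c unfolding \<nu>_def using that by (rule Least_le)
  have loc: "\<exists>e>0. \<forall>x y. \<bar>x - z\<bar> < e \<longrightarrow> \<bar>y - z\<bar> < e \<longrightarrow> \<nu> y \<le> \<nu> x + (if y = z then 0 else order z (det P))" for z
  proof -
    obtain k e where k: "k \<le> d" "nonpos_codim d (A z) k" and e: "e > 0"
      and near: "\<And>x. \<bar>x - z\<bar> < e \<Longrightarrow> pos_codim d (A x) (d - k)"
        "\<And>x. \<bar>x - z\<bar> < e \<Longrightarrow> nonpos_codim d (A x) (k + order z (det P))"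
      using local_inertia[OF P sym G, of z] unfolding A_def by blast
    have "k \<le> \<nu> x" if "\<bar>x - z\<bar> < e" for x
      using pos_nonpos_codim[OF near(1)[OF that] \<nu>[of x]] k(1) by linarith
    moreover have "\<nu> z \<le> k" using \<nu>_le k(2) .
    moreover have "\<nu> y \<le> k + order z (det P)" if "\<bar>y - z\<bar> < e" for y using \<nu>_le near(2)[OF that] .
    ultimately show ?thesis using e by (intro exI[of _ e]) (auto intro: order_trans, meson add_right_mono order_trans)
  qed
  show "q \<le> p + (\<Sum>z \<in> {z. order z (det P) \<noteq> 0 \<and> a \<le> z \<and> z < b}. order z (det P))"
    if "nonpos_codim d (A a) p" "\<And>q'. nonpos_codim d (A b) q' \<Longrightarrow> q \<le> q'"
    using jump_bound[OF fin ab loc] that(2)[OF \<nu>] \<nu>_le[OF that(1)] by linarith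
  show "q \<le> p + (\<Sum>z \<in> {z. order z (det P) \<noteq> 0 \<and> a < z \<and> z \<le> b}. order z (det P))"
    if "nonpos_codim d (A b) p" "\<And>q'. nonpos_codim d (A a) q' \<Longrightarrow> q \<le> q'"
    using jump_bound_left[OF fin ab loc] that(2)[OF \<nu>] \<nu>_le[OF that(1)] by linarith
qed

section \<open>Power sums of the roots of a monic family\<close>

lemma sum_mset_eq_sum_count:
  fixes f :: "'a \<Rightarrow> 'b::semiring_1"
  assumes "finite S" "set_mset M \<subseteq> S"
  shows "(\<Sum>w\<in>#M. f w) = (\<Sum>w\<in>S. of_nat (count M w) * f w)"
  using assms(2)
proof (induction M)
  case empty
  then show ?case by simp
next
  case (add x M)
  have "(\<Sum>w\<in>S. of_nat (count (add_mset x M) w) * f w) = (\<Sum>w\<in>S. of_nat (count M w) * f w + (if w = x then f x else 0))"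
    by (intro sum.cong refl) (auto simp: algebra_simps)
  also have "\<dots> = (\<Sum>w\<in>S. of_nat (count M w) * f w) + f x"
    using assms(1) add.prems by (simp add: sum.distrib)
  finally show ?case using add by (simp add: add.commute)
qed

text \<open>
  Newton's identities in the form of a logarithmic derivative: with \<open>E = \<Prod> (1 - w X)\<close>, each factor
  contributes \<open>w X / (1 - w X) = \<Sum>\<^sub>n\<^sub>>\<^sub>0 w\<^sup>n X\<^sup>n\<close> to \<open>- X E' / E\<close>.
\<close>
lemma newton_identity_fps:
  fixes M :: "'a::field_char_0 multiset"
  defines "E \<equiv> fps_of_poly (reflect_poly (\<Prod>w\<in>#M. [:- w, 1:]))"
  shows "E * (\<Sum>w\<in>#M. Abs_fps (\<lambda>n. if n = 0 then 0 else w ^ n)) = - (fps_X * fps_deriv E)"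
  unfolding E_def
proof (induction M)
  case empty
  then show ?case by simp
next
  case (add w M)
  define E where "E = fps_of_poly (reflect_poly (\<Prod>w\<in>#M. [:- w, 1:]))"
  define S where "S = (\<Sum>w\<in>#M. Abs_fps (\<lambda>n. if n = 0 then 0 else w ^ n))"
  have IH: "E * S = - (fps_X * fps_deriv E)" using add.IH by (simp add: E_def S_def)
  let ?Sw = "Abs_fps (\<lambda>n. if n = 0 then 0 else w ^ n)"
  let ?L = "1 - fps_const w * fps_X"
  have lin: "fps_of_poly (reflect_poly [:- w, 1:]) = ?L"
    by (rule fps_ext) (auto simp: reflect_poly_def coeff_pCons split: nat.splits)
  have geom: "?L * ?Sw = fps_const w * fps_X"
  proof (rule fps_ext)
    fix n show "fps_nth (?L * ?Sw) n = fps_nth (fps_const w * fps_X) n"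
      by (cases n; cases "n - 1") (auto simp: left_diff_distrib mult.assoc)
  qed
  have "?L * E * (?Sw + S) = E * (?L * ?Sw) + ?L * (E * S)" by (simp add: algebra_simps)
  also have "\<dots> = E * (fps_const w * fps_X) - ?L * (fps_X * fps_deriv E)"
    by (simp only: geom IH) simp
  also have "\<dots> = - (fps_X * fps_deriv (?L * E))"
    by (simp add: algebra_simps flip: fps_const_neg)
  finally show ?case
    unfolding E_def S_def
    by (simp add: reflect_poly_mult fps_of_poly_mult lin del: mult_pCons_left)
qed

lemma newton_identity:
  fixes M :: "'a::field_char_0 multiset" and n :: nat
  defines "c \<equiv> coeff (reflect_poly (\<Prod>w\<in>#M. [:- w, 1:]))"
  assumes "n > 0"
  shows "(\<Sum>w\<in>#M. w ^ n) = - (of_nat n * c n + (\<Sum>i=1..<n. c i * (\<Sum>w\<in>#M. w ^ (n - i))))"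
proof -
  define T where "T = (\<Sum>w\<in>#M. Abs_fps (\<lambda>n. if n = 0 then 0 else w ^ n))"
  have T: "fps_nth T k = (if k = 0 then 0 else (\<Sum>w\<in>#M. w ^ k))" for k
    unfolding T_def by (induction M) auto
  have c0: "c 0 = 1"
    unfolding c_def by (induction M) (auto simp: lead_coeff_mult simp del: mult_pCons_left)
  have "fps_nth (fps_of_poly (reflect_poly (\<Prod>w\<in>#M. [:- w, 1:])) * T) n = - (of_nat n * c n)"
    unfolding T_def newton_identity_fps using assms(2) by (cases n) (simp_all add: c_def)
  moreover have "fps_nth (fps_of_poly (reflect_poly (\<Prod>w\<in>#M. [:- w, 1:])) * T) n
     = (\<Sum>i=0..n. c i * fps_nth T (n - i))"
    by (simp add: fps_mult_nth c_def)
  moreover have "(\<Sum>i=0..n. c i * fps_nth T (n - i)) = (\<Sum>w\<in>#M. w ^ n) + (\<Sum>i=1..<n. c i * (\<Sum>w\<in>#M. w ^ (n - i)))"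
  proof -
    have "{0..n} = insert 0 (insert n {1..<n})" using assms(2) by auto
    then have "(\<Sum>i=0..n. c i * fps_nth T (n - i)) = c 0 * fps_nth T n + c n * fps_nth T 0 + (\<Sum>i=1..<n. c i * fps_nth T (n - i))"
      using assms(2) by (simp add: add.assoc)
    also have "(\<Sum>i=1..<n. c i * fps_nth T (n - i)) = (\<Sum>i=1..<n. c i * (\<Sum>w\<in>#M. w ^ (n - i)))"
      by (intro sum.cong refl) (auto simp: T)
    finally show ?thesis using assms(2) c0 by (simp add: T)
  qed
  ultimately show ?thesis by (simp add: algebra_simps eq_neg_iff_add_eq_0)
qed

text \<open>
  Polynomials in two variables of total degree at most \<open>e\<close> that are monic of degree \<open>e\<close> in \<open>y\<close>: \<open>A j\<close> is the
  coefficient of \<open>y\<^sup>j\<close>.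
\<close>
locale monic_family =
  fixes e :: nat and A :: "nat \<Rightarrow> real poly"
  assumes lead: "A e = 1" and deg: "j \<le> e \<Longrightarrow> degree (A j) \<le> e - j"
begin

definition fibre :: "real \<Rightarrow> real poly" where
  "fibre x = (\<Sum>j\<le>e. monom (poly (A j) x) j)"

definition cfibre :: "real \<Rightarrow> complex poly" where
  "cfibre x = map_poly complex_of_real (fibre x)"

definition roots :: "real \<Rightarrow> complex set" where
  "roots x = {w. poly (cfibre x) w = 0}"

text \<open>
  The roots in the closed upper half plane represent the real roots and the conjugate pairs of
  nonreal roots, without multiplicity. This is the number of positive squares of Hermite's form.
\<close>
definition nroots :: "real \<Rightarrow> nat" where
  "nroots x = card {w \<in> roots x. 0 \<le> Im w}"

lemma coeff_fibre: "coeff (fibre x) j = (if j \<le> e then poly (A j) x else 0)"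
  by (simp add: fibre_def coeff_sum)

lemma coeff_cfibre: "coeff (cfibre x) j = (if j \<le> e then complex_of_real (poly (A j) x) else 0)"
  by (simp add: cfibre_def coeff_map_poly coeff_fibre)

lemma degree_cfibre: "degree (cfibre x) = e"
proof (rule antisym)
  show "degree (cfibre x) \<le> e" by (rule degree_le) (auto simp: coeff_cfibre)
  show "e \<le> degree (cfibre x)" by (rule le_degree) (simp add: coeff_cfibre lead)
qed

lemma lead_cfibre: "lead_coeff (cfibre x) = 1"
  by (simp add: degree_cfibre coeff_cfibre lead)

lemma cfibre_nz: "cfibre x \<noteq> 0" using lead_cfibre[of x] by auto

lemma cfibre_decompose: "cfibre x = (\<Prod>w\<in>#proots (cfibre x). [:- w, 1:])"
  using complex_poly_decompose_multiset[of "cfibre x"] by (simp add: lead_cfibre)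

lemma finite_roots: "finite (roots x)"
  unfolding roots_def using poly_roots_finite[OF cfibre_nz] .

lemma card_roots_le: "card (roots x) \<le> e"
  unfolding roots_def using poly_roots_degree[OF cfibre_nz, of x] by (simp add: degree_cfibre)

lemma cnj_roots: "cnj w \<in> roots x \<longleftrightarrow> w \<in> roots x"
proof -
  have "poly (cfibre x) (cnj w) = cnj (poly (cfibre x) w)"
    by (simp add: poly_altdef coeff_cfibre degree_cfibre)
  then show ?thesis by (simp add: roots_def)
qed

text \<open>
  Newton's recursion, solved for the power sum. It makes the power sums of the roots over \<open>x\<close>
  polynomials in \<open>x\<close>; the degree bound of the coefficients is inherited.
\<close>
fun power_sum :: "nat \<Rightarrow> real poly" where
  "power_sum n = (if n = 0 then [:real e:] else
     - (of_nat n * (if n \<le> e then A (e - n) else 0) +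
       (\<Sum>i=1..<n. (if i \<le> e then A (e - i) else 0) * power_sum (n - i))))"

declare power_sum.simps [simp del]

lemma degree_power_sum: "degree (power_sum n) \<le> n"
proof (induction n rule: less_induct)
  case (less n)
  have dA: "degree (if i \<le> e then A (e - i) else 0) \<le> i" for i
    using deg[of "e - i"] by auto
  show ?case
  proof (cases "n = 0")
    case True
    then show ?thesis by (simp add: power_sum.simps)
  next
    case False
    have 1: "degree (of_nat n * (if n \<le> e then A (e - n) else 0)) \<le> n"
      using dA[of n] degree_mult_le[of "of_nat n" "if n \<le> e then A (e - n) else 0"] by simp
    have 2: "degree (\<Sum>i=1..<n. (if i \<le> e then A (e - i) else 0) * power_sum (n - i)) \<le> n"
    proof (rule degree_sum_le)
      fix i assume "i \<in> {1..<n}"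
      then have "degree (power_sum (n - i)) \<le> n - i" "i \<le> n" using less.IH[of "n - i"] by auto
      then show "degree ((if i \<le> e then A (e - i) else 0) * power_sum (n - i)) \<le> n"
        using dA[of i] degree_mult_le[of "if i \<le> e then A (e - i) else 0" "power_sum (n - i)"] by linarith
    qed simp
    show ?thesis
      using False by (subst power_sum.simps) (simp only: if_False degree_minus, intro degree_add_le 1 2)
  qed
qed

lemma power_sum_roots:
  "complex_of_real (poly (power_sum n) x) = (\<Sum>w\<in>#proots (cfibre x). w ^ n)"
proof (induction n rule: less_induct)
  case (less n)
  define c where "c = coeff (reflect_poly (\<Prod>w\<in>#proots (cfibre x). [:- w, 1:]))"
  have c: "c i = complex_of_real (poly (if i \<le> e then A (e - i) else 0) x)" for i
    unfolding c_def cfibre_decompose[symmetric] by (auto simp: coeff_reflect_poly degree_cfibre coeff_cfibre)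
  show ?case
  proof (cases "n = 0")
    case True
    have "size (proots (cfibre x)) = e" by (simp add: size_proots_complex degree_cfibre)
    then show ?thesis using True by (simp add: power_sum.simps)
  next
    case False
    have "complex_of_real (poly (power_sum n) x) = - (of_nat n * c n + (\<Sum>i=1..<n. c i * complex_of_real (poly (power_sum (n - i)) x)))"
      using False by (subst power_sum.simps) (simp add: c poly_sum)
    also have "\<dots> = - (of_nat n * c n + (\<Sum>i=1..<n. c i * (\<Sum>w\<in>#proots (cfibre x). w ^ (n - i))))"
      using less.IH by (intro arg_cong[where f = uminus] arg_cong2[where f = "(+)"] sum.cong refl) auto
    also have "\<dots> = (\<Sum>w\<in>#proots (cfibre x). w ^ n)"
      unfolding c_def using False by (intro newton_identity[symmetric]) auto
    finally show ?thesis .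
  qed
qed

lemma power_sum_order:
  "complex_of_real (poly (power_sum n) x) = (\<Sum>w\<in>roots x. of_nat (order w (cfibre x)) * w ^ n)"
proof -
  have "(\<Sum>w\<in>#proots (cfibre x). w ^ n) = (\<Sum>w\<in>set_mset (proots (cfibre x)). of_nat (count (proots (cfibre x)) w) * w ^ n)"
    by (rule sum_mset_eq_sum_count) auto
  then show ?thesis unfolding power_sum_roots
    using cfibre_nz by (simp add: roots_def)
qed

end

section \<open>Hermite's quadratic form\<close>

lemma poly_det_eq: "poly (det P) x = det (map_mat (\<lambda>p. poly p x) P)" for P :: "'a::comm_ring_1 poly mat"
  by (rule comm_ring_hom.hom_det[symmetric]) (unfold_locales, auto)

context monic_family
begin

text \<open>
  For \<open>\<epsilon> = 0\<close> this is the matrix of \<open>q \<mapsto> \<Sum> m\<^sub>i q(y\<^sub>i)\<^sup>2\<close> on polynomials \<open>q\<close> of degree less than \<open>d\<close>. The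
  shift by \<open>\<epsilon>\<close> makes the form negative on the kernel that it has at exceptional \<open>x\<close>, and for suitable \<open>\<epsilon>\<close> it
  moves the zeros of the determinant away from these points.
\<close>
definition hermite_mat :: "nat \<Rightarrow> real \<Rightarrow> real poly mat" where
  "hermite_mat d \<epsilon> = mat d d (\<lambda>(i,j). power_sum (i + j) - (if i = j then [:\<epsilon>:] else 0))"

lemma hermite_mat_carrier [simp]: "hermite_mat d \<epsilon> \<in> carrier_mat d d"
  by (simp add: hermite_mat_def)

lemma hermite_mat_sym: "(hermite_mat d \<epsilon>)\<^sup>T = hermite_mat d \<epsilon>"
  by (rule eq_matI) (auto simp: hermite_mat_def add.commute)

text \<open>
  The entry at \<open>(i, j)\<close> has degree at most \<open>i + j\<close>, and both indices run through all of \<open>0, \<dots>, d - 1\<close> in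
  each product of the Leibniz formula.
\<close>
lemma degree_det_hermite: "degree (det (hermite_mat d \<epsilon>)) \<le> d * (d - 1)"
proof -
  have entry: "degree (hermite_mat d \<epsilon> $$ (i,j)) \<le> i + j" if "i < d" "j < d" for i j
    using that degree_power_sum[of "i + j"] by (auto simp: hermite_mat_def intro!: degree_diff_le)
  have "degree (\<Prod>i=0..<d. hermite_mat d \<epsilon> $$ (i, \<pi> i)) \<le> d * (d - 1)" if \<pi>: "\<pi> permutes {0..<d}" for \<pi>
  proof -
    have "degree (\<Prod>i=0..<d. hermite_mat d \<epsilon> $$ (i, \<pi> i)) \<le> (\<Sum>i=0..<d. degree (hermite_mat d \<epsilon> $$ (i, \<pi> i)))"
      using degree_prod_sum_le[of "{0..<d}" "\<lambda>i. hermite_mat d \<epsilon> $$ (i, \<pi> i)"] by (simp add: o_def)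
    also have "\<dots> \<le> (\<Sum>i=0..<d. i + \<pi> i)"
      using permutes_in_image[OF \<pi>] by (intro sum_mono entry) auto
    also have "\<dots> = (\<Sum>i=0..<d. i) + (\<Sum>i=0..<d. \<pi> i)" by (rule sum.distrib)
    also have "(\<Sum>i=0..<d. \<pi> i) = (\<Sum>i=0..<d. i)"
      using sum.permute[OF \<pi>, of "\<lambda>i. i"] by (simp add: o_def)
    also have "(\<Sum>i=0..<d. i) + (\<Sum>i=0..<d. i) = d * (d - 1)"
    proof (cases d)
      case (Suc m)
      have "2 * (\<Sum>i=0..m. i) = m * Suc m" using gauss_sum_nat[of m] by simp
      then show ?thesis using Suc by (simp add: atLeastLessThanSuc_atLeastAtMost mult.commute)
    qed simp
    finally show ?thesis .
  qed
  then have "degree (signof \<pi> * (\<Prod>i=0..<d. hermite_mat d \<epsilon> $$ (i, \<pi> i))) \<le> d * (d - 1)" if "\<pi> permutes {0..<d}" for \<pi>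
    using that by (cases "sign \<pi> = 1") (auto simp: sign_def)
  then show ?thesis unfolding det_def'[OF hermite_mat_carrier]
    by (intro degree_sum_le) (auto simp: finite_permutations)
qed

lemma hermite_form:
  "complex_of_real (qform d (\<lambda>i j. poly (power_sum (i + j)) x) v) =
     (\<Sum>w\<in>roots x. of_nat (order w (cfibre x)) * (\<Sum>i<d. of_real (v i) * w ^ i)\<^sup>2)"
proof -
  have "complex_of_real (qform d (\<lambda>i j. poly (power_sum (i + j)) x) v) =
    (\<Sum>i<d. \<Sum>j<d. \<Sum>w\<in>roots x. of_nat (order w (cfibre x)) * ((of_real (v i) * w ^ i) * (of_real (v j) * w ^ j)))"
    unfolding qform_def by (simp add: power_sum_order sum_distrib_left sum_distrib_right power_add mult_ac)
  also have "\<dots> = (\<Sum>w\<in>roots x. \<Sum>i<d. \<Sum>j<d. of_nat (order w (cfibre x)) * ((of_real (v i) * w ^ i) * (of_real (v j) * w ^ j)))"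
    by (subst sum.swap, rule sum.cong[OF refl], subst sum.swap, rule refl)
  also have "\<dots> = (\<Sum>w\<in>roots x. of_nat (order w (cfibre x)) * (\<Sum>i<d. of_real (v i) * w ^ i)\<^sup>2)"
    unfolding power2_eq_square sum_product by (simp only: sum_distrib_left)
  finally show ?thesis .
qed

lemma hermite_form_Re:
  "qform d (\<lambda>i j. poly (power_sum (i + j)) x) v =
     (\<Sum>w\<in>roots x. real (order w (cfibre x)) * Re ((\<Sum>i<d. of_real (v i) * w ^ i)\<^sup>2))"
proof -
  have "qform d (\<lambda>i j. poly (power_sum (i + j)) x) v = Re (complex_of_real (qform d (\<lambda>i j. poly (power_sum (i + j)) x) v))"
    by simp
  then show ?thesis unfolding hermite_form by simp
qed

text \<open>
  One real equation \<open>Re (q w) = 0\<close> for each root in the closed upper half plane makes \<open>q\<close> purely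
  imaginary at all roots, since real polynomials commute with conjugation; then every summand of the
  form is minus a square.
\<close>
lemma hermite_nonpos:
  assumes "\<epsilon> \<ge> 0"
  shows "nonpos_codim d (\<lambda>i j. poly (hermite_mat d \<epsilon> $$ (i,j)) x) (nroots x)"
proof (rule sign_codimI[where I = "{w \<in> roots x. 0 \<le> Im w}" and L = "\<lambda>w i. Re (w ^ i)"])
  show "finite {w \<in> roots x. 0 \<le> Im w}" using finite_roots by simp
  show "card {w \<in> roots x. 0 \<le> Im w} = nroots x" by (simp add: nroots_def)
  fix v :: "nat \<Rightarrow> real"
  assume L: "\<And>w. w \<in> {w \<in> roots x. 0 \<le> Im w} \<Longrightarrow> (\<Sum>i<d. Re (w ^ i) * v i) = 0"
  define q where "q = (\<lambda>w. \<Sum>i<d. complex_of_real (v i) * w ^ i)"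
  have Re_q: "Re (q w) = (\<Sum>i<d. Re (w ^ i) * v i)" for w by (simp add: q_def mult.commute)
  have q_cnj: "q (cnj w) = cnj (q w)" for w by (simp add: q_def)
  have Re0: "Re (q w) = 0" if "w \<in> roots x" for w
  proof (cases "0 \<le> Im w")
    case True
    then show ?thesis using L[of w] that by (simp add: Re_q)
  next
    case False
    then have "Re (q (cnj w)) = 0" unfolding Re_q using that by (intro L) (simp add: cnj_roots)
    then show ?thesis by (simp add: q_cnj)
  qed
  have form: "qform d (\<lambda>i j. poly (power_sum (i + j)) x) v = (\<Sum>w\<in>roots x. real (order w (cfibre x)) * Re ((q w)\<^sup>2))"
    unfolding hermite_form_Re q_def ..
  have "qform d (\<lambda>i j. poly (power_sum (i + j)) x) v \<le> 0"
    unfolding form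
    by (intro sum_nonpos mult_nonneg_nonpos) (simp_all add: Re0 power2_eq_square)
  moreover have "qform d (\<lambda>i j. poly (hermite_mat d \<epsilon> $$ (i,j)) x) v =
     qform d (\<lambda>i j. poly (power_sum (i + j)) x) v - \<epsilon> * (\<Sum>i<d. (v i)\<^sup>2)"
  proof -
    have "qform d (\<lambda>i j. poly (hermite_mat d \<epsilon> $$ (i,j)) x) v =
       (\<Sum>i<d. \<Sum>j<d. poly (power_sum (i + j)) x * v i * v j - (if i = j then \<epsilon> * (v i)\<^sup>2 else 0))"
      unfolding qform_def by (intro sum.cong refl) (auto simp: hermite_mat_def algebra_simps power2_eq_square)
    then show ?thesis by (simp add: sum_subtractf qform_def sum_distrib_left)
  qed
  moreover have "0 \<le> \<epsilon> * (\<Sum>i<d. (v i)\<^sup>2)" using assms by (intro mult_nonneg_nonneg sum_nonneg) auto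
  ultimately show "qform d (\<lambda>i j. poly (hermite_mat d \<epsilon> $$ (i,j)) x) v \<le> 0" by linarith
qed

lemma card_roots_split: "card {w \<in> roots x. 0 < Im w} = card (roots x) - nroots x"
proof -
  have "bij_betw cnj {w \<in> roots x. 0 < Im w} (roots x - {w \<in> roots x. 0 \<le> Im w})"
    by (rule bij_betwI[where g = cnj]) (auto simp: cnj_roots)
  then have "card {w \<in> roots x. 0 < Im w} = card (roots x - {w \<in> roots x. 0 \<le> Im w})"
    by (rule bij_betw_same_card)
  also have "\<dots> = card (roots x) - nroots x"
    unfolding nroots_def using finite_roots by (intro card_Diff_subset) auto
  finally show ?thesis .
qed

lemma coeffs_zero_if_many_roots:
  fixes c :: "nat \<Rightarrow> complex"
  assumes "card (roots x) \<ge> d" and "\<And>w. w \<in> roots x \<Longrightarrow> (\<Sum>i<d. c i * w ^ i) = 0"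
  shows "\<forall>i<d. c i = 0"
proof (rule ccontr)
  assume nz: "\<not> ?thesis"
  define p where "p = (\<Sum>i<d. monom (c i) i)"
  have coeff: "coeff p i = (if i < d then c i else 0)" for i
    by (simp add: p_def coeff_sum)
  have "p \<noteq> 0" using nz coeff by (metis coeff_0)
  have "d > 0" using nz by auto
  have "degree p \<le> d - 1" by (rule degree_le) (auto simp: coeff)
  moreover have "roots x \<subseteq> {w. poly p w = 0}"
    using assms(2) by (auto simp: p_def poly_sum poly_monom)
  then have "card (roots x) \<le> card {w. poly p w = 0}"
    using poly_roots_finite[OF \<open>p \<noteq> 0\<close>] by (intro card_mono)
  moreover have "card {w. poly p w = 0} \<le> degree p" using poly_roots_degree[OF \<open>p \<noteq> 0\<close>] .
  ultimately show False using assms(1) \<open>d > 0\<close> by linarith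
qed

lemma order_pos: "w \<in> roots x \<Longrightarrow> 0 < order w (cfibre x)"
  using cfibre_nz by (auto simp: roots_def order_root)

text \<open>
  The complementary choice: one equation \<open>Im (q w) = 0\<close> for each root in the open upper half plane
  makes \<open>q\<close> real at all roots. The form is then a sum of squares, and it vanishes only if
  \<open>q\<close> has all the \<open>d\<close> roots, which its degree does not permit.
\<close>
lemma hermite_pos:
  assumes "card (roots x) = d"
  shows "pos_codim d (\<lambda>i j. poly (power_sum (i + j)) x) (d - nroots x)"
proof (rule sign_codimI[where I = "{w \<in> roots x. 0 < Im w}" and L = "\<lambda>w i. Im (w ^ i)"])
  show "finite {w \<in> roots x. 0 < Im w}" using finite_roots by simp
  show "card {w \<in> roots x. 0 < Im w} = d - nroots x" using card_roots_split assms by simp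
  fix v :: "nat \<Rightarrow> real"
  assume nz: "\<exists>i<d. v i \<noteq> 0" and L: "\<And>w. w \<in> {w \<in> roots x. 0 < Im w} \<Longrightarrow> (\<Sum>i<d. Im (w ^ i) * v i) = 0"
  define q where "q = (\<lambda>w. \<Sum>i<d. complex_of_real (v i) * w ^ i)"
  have Im_q: "Im (q w) = (\<Sum>i<d. Im (w ^ i) * v i)" for w by (simp add: q_def mult.commute)
  have q_cnj: "q (cnj w) = cnj (q w)" for w by (simp add: q_def)
  have Im0: "Im (q w) = 0" if "w \<in> roots x" for w
  proof (cases "0 < Im w")
    case True
    then show ?thesis using L[of w] that by (simp add: Im_q)
  next
    case False
    show ?thesis
    proof (cases "Im w = 0")
      case True
      then have "w = complex_of_real (Re w)" by (simp add: complex_eq_iff)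
      then have "cnj w = w" by (simp add: complex_eq_iff)
      then have "cnj (q w) = q w" using q_cnj[of w] by simp
      then show ?thesis by (simp add: complex_eq_iff)
    next
      case False
      then have "Im (q (cnj w)) = 0" unfolding Im_q
        using that \<open>\<not> 0 < Im w\<close> by (intro L) (simp add: cnj_roots)
      then show ?thesis by (simp add: q_cnj)
    qed
  qed
  have "\<exists>w\<in>roots x. q w \<noteq> 0"
    using coeffs_zero_if_many_roots[of d x "\<lambda>i. complex_of_real (v i)"] assms nz by (auto simp: q_def)
  then obtain w where w: "w \<in> roots x" "q w \<noteq> 0" by auto
  then have "Re (q w) \<noteq> 0" using Im0 by (auto simp: complex_eq_iff)
  then have "0 < (\<Sum>w\<in>roots x. real (order w (cfibre x)) * Re ((q w)\<^sup>2))"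
    using w(1) Im0 order_pos finite_roots by (intro sum_pos2[of _ w]) (auto simp: power2_eq_square zero_less_mult_iff linorder_neq_iff)
  then show "0 < qform d (\<lambda>i j. poly (power_sum (i + j)) x) v"
    unfolding hermite_form_Re q_def .
qed

lemma hermite_kernel:
  "map_mat (\<lambda>p. complex_of_real (poly p x)) (hermite_mat d 0) *\<^sub>v vec d c =
     vec d (\<lambda>i. \<Sum>w\<in>roots x. of_nat (order w (cfibre x)) * (\<Sum>j<d. c j * w ^ j) * w ^ i)"
proof (rule eq_vecI)
  fix i assume "i < dim_vec (vec d (\<lambda>i. \<Sum>w\<in>roots x. of_nat (order w (cfibre x)) * (\<Sum>j<d. c j * w ^ j) * w ^ i))"
  then have i: "i < d" by simp
  have "(map_mat (\<lambda>p. complex_of_real (poly p x)) (hermite_mat d 0) *\<^sub>v vec d c) $ i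
     = (\<Sum>j<d. complex_of_real (poly (power_sum (i + j)) x) * c j)"
    using i by (auto simp: scalar_prod_def lessThan_atLeast0 hermite_mat_def intro!: sum.cong)
  also have "\<dots> = (\<Sum>w\<in>roots x. \<Sum>j<d. of_nat (order w (cfibre x)) * w ^ (i + j) * c j)"
    unfolding power_sum_order sum_distrib_right by (rule sum.swap)
  also have "\<dots> = (\<Sum>w\<in>roots x. of_nat (order w (cfibre x)) * (\<Sum>j<d. c j * w ^ j) * w ^ i)"
    by (simp add: sum_distrib_left sum_distrib_right power_add mult_ac)
  finally show "(map_mat (\<lambda>p. complex_of_real (poly p x)) (hermite_mat d 0) *\<^sub>v vec d c) $ i =
     vec d (\<lambda>i. \<Sum>w\<in>roots x. of_nat (order w (cfibre x)) * (\<Sum>j<d. c j * w ^ j) * w ^ i) $ i" using i by simp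
qed (simp add: hermite_mat_def)

lemma hermite_det_eq_0_iff:
  "poly (det (hermite_mat d 0)) x = 0 \<longleftrightarrow>
    (\<exists>c. (\<exists>i<d. c i \<noteq> 0) \<and> (\<forall>i<d. (\<Sum>w\<in>roots x. of_nat (order w (cfibre x)) * (\<Sum>j<d. c j * w ^ j) * w ^ i) = 0))"
proof -
  let ?H = "map_mat (\<lambda>p. complex_of_real (poly p x)) (hermite_mat d 0)"
  interpret h: comm_ring_hom "\<lambda>p. complex_of_real (poly p x)" by unfold_locales auto
  have H: "?H \<in> carrier_mat d d" by simp
  have "det ?H = complex_of_real (poly (det (hermite_mat d 0)) x)"
    by (rule comm_ring_hom.hom_det[OF h.comm_ring_hom_axioms])
  then have "poly (det (hermite_mat d 0)) x = 0 \<longleftrightarrow> det ?H = 0" by simp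
  also have "\<dots> \<longleftrightarrow> (\<exists>v\<in>carrier_vec d. v \<noteq> 0\<^sub>v d \<and> ?H *\<^sub>v v = 0\<^sub>v d)"
    using det_0_iff_vec_prod_zero[OF H] by blast
  also have "\<dots> \<longleftrightarrow> (\<exists>c. vec d c \<noteq> 0\<^sub>v d \<and> ?H *\<^sub>v vec d c = 0\<^sub>v d)"
  proof
    assume "\<exists>v\<in>carrier_vec d. v \<noteq> 0\<^sub>v d \<and> ?H *\<^sub>v v = 0\<^sub>v d"
    then obtain v where v: "v \<in> carrier_vec d" "v \<noteq> 0\<^sub>v d" "?H *\<^sub>v v = 0\<^sub>v d" by auto
    have "vec d (\<lambda>i. v $ i) = v" using v(1) by auto
    then show "\<exists>c. vec d c \<noteq> 0\<^sub>v d \<and> ?H *\<^sub>v vec d c = 0\<^sub>v d" using v by metis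
  qed auto
  also have "\<dots> \<longleftrightarrow> (\<exists>c. (\<exists>i<d. c i \<noteq> 0) \<and> (\<forall>i<d. (\<Sum>w\<in>roots x. of_nat (order w (cfibre x)) * (\<Sum>j<d. c j * w ^ j) * w ^ i) = 0))"
    unfolding hermite_kernel by (simp add: vec_eq_iff)
  finally show ?thesis .
qed

lemma hermite_det_nz:
  assumes "card (roots x) = d"
  shows "poly (det (hermite_mat d 0)) x \<noteq> 0"
proof
  assume "poly (det (hermite_mat d 0)) x = 0"
  then obtain c where c: "\<exists>i<d. c i \<noteq> 0"
    "\<And>i. i < d \<Longrightarrow> (\<Sum>w\<in>roots x. of_nat (order w (cfibre x)) * (\<Sum>j<d. c j * w ^ j) * w ^ i) = 0"
    unfolding hermite_det_eq_0_iff by blast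
  define p where "p = (\<lambda>w. \<Sum>j<d. c j * w ^ j)"
  have "p w = 0" if w: "w \<in> roots x" for w
  proof -
    \<comment> \<open>pair with the polynomial that vanishes at all the other roots\<close>
    define g where "g = (\<Prod>u\<in>roots x - {w}. [:- u, 1:])"
    have "degree g = card (roots x - {w})"
      unfolding g_def by (subst degree_prod_eq_sum_degree) auto
    then have dg: "degree g < d" using w finite_roots assms by (metis card_Diff1_less)
    have "0 = (\<Sum>i<d. coeff g i * (\<Sum>u\<in>roots x. of_nat (order u (cfibre x)) * p u * u ^ i))"
      using c(2) by (simp add: p_def)
    also have "\<dots> = (\<Sum>u\<in>roots x. of_nat (order u (cfibre x)) * p u * (\<Sum>i<d. coeff g i * u ^ i))"
      unfolding sum_distrib_left by (subst sum.swap) (simp add: mult_ac)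
    also have "\<dots> = (\<Sum>u\<in>roots x. of_nat (order u (cfibre x)) * p u * poly g u)"
    proof (intro sum.cong refl)
      fix u
      have "poly g u = (\<Sum>i<d. coeff g i * u ^ i)"
        unfolding poly_altdef using dg by (intro sum.mono_neutral_left) (auto simp: coeff_eq_0)
      then show "of_nat (order u (cfibre x)) * p u * (\<Sum>i<d. coeff g i * u ^ i) = of_nat (order u (cfibre x)) * p u * poly g u" by simp
    qed
    also have "\<dots> = (\<Sum>u\<in>{w}. of_nat (order u (cfibre x)) * p u * poly g u)"
      using w finite_roots by (intro sum.mono_neutral_right) (auto simp: g_def poly_prod)
    finally have "of_nat (order w (cfibre x)) * p w * poly g w = 0" by simp
    moreover have "poly g w \<noteq> 0" using finite_roots by (auto simp: g_def poly_prod)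
    ultimately show ?thesis using order_pos[OF w] by simp
  qed
  then have "\<forall>i<d. c i = 0" using coeffs_zero_if_many_roots[of d x c] assms by (simp add: p_def)
  then show False using c(1) by blast
qed

text \<open>
  The polynomial that vanishes at all roots has degree less than \<open>d\<close>, and it lies in the kernel.
\<close>
lemma hermite_det_0:
  assumes "card (roots x) < d"
  shows "poly (det (hermite_mat d 0)) x = 0"
proof -
  define g where "g = (\<Prod>u\<in>roots x. [:- u, 1:])"
  have "g \<noteq> 0" using finite_roots by (simp add: g_def)
  have "degree g = card (roots x)" unfolding g_def by (subst degree_prod_eq_sum_degree) auto
  then have dg: "degree g < d" using assms by simp
  have eval: "poly g u = (\<Sum>i<d. coeff g i * u ^ i)" for u
    unfolding poly_altdef using dg by (intro sum.mono_neutral_left) (auto simp: coeff_eq_0)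
  have "poly g u = 0" if "u \<in> roots x" for u
    using that finite_roots by (auto simp: g_def poly_prod)
  then have "(\<Sum>j<d. coeff g j * u ^ j) = 0" if "u \<in> roots x" for u
    using that by (simp only: eval)
  moreover have "\<exists>i<d. coeff g i \<noteq> 0" using \<open>g \<noteq> 0\<close> dg by (metis leading_coeff_neq_0)
  ultimately show ?thesis unfolding hermite_det_eq_0_iff by (intro exI[of _ "coeff g"]) simp
qed

lemma finite_exceptional_fibres:
  assumes "card (roots t) = d" and "\<And>x. card (roots x) \<le> d"
  shows "finite {x. card (roots x) \<noteq> d}"
proof (rule finite_subset)
  show "{x. card (roots x) \<noteq> d} \<subseteq> {x. poly (det (hermite_mat d 0)) x = 0}"
    using hermite_det_0 assms(2) by (auto simp: order_less_le)
  show "finite {x. poly (det (hermite_mat d 0)) x = 0}"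
    using hermite_det_nz[OF assms(1)] by (intro poly_roots_finite) auto
qed

text \<open>
  For fixed \<open>y\<close> the matrix is polynomial in \<open>\<epsilon>\<close> as well, and its determinant is up to the sign of the
  variable a characteristic polynomial, hence nonzero. So the results on polynomial families apply in the
  variable \<open>\<epsilon>\<close> too.
\<close>
lemma hermite_mat_eq_char_poly:
  fixes d :: nat
  defines "N \<equiv> \<lambda>y. char_poly_matrix (- mat d d (\<lambda>(i,j). poly (power_sum (i + j)) y))"
  shows "i < d \<Longrightarrow> j < d \<Longrightarrow> poly (hermite_mat d \<epsilon> $$ (i,j)) y = poly (N y $$ (i,j)) (- \<epsilon>)"
    and "poly (det (hermite_mat d \<epsilon>)) y = poly (det (N y)) (- \<epsilon>)"
    and "N y \<in> carrier_mat d d" and "(N y)\<^sup>T = N y" and "det (N y) \<noteq> 0"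
proof -
  show entry: "poly (hermite_mat d \<epsilon> $$ (i,j)) y = poly (N y $$ (i,j)) (- \<epsilon>)" if "i < d" "j < d" for i j
    using that by (auto simp: N_def hermite_mat_def char_poly_matrix_def)
  show car: "N y \<in> carrier_mat d d" by (simp add: N_def)
  show "poly (det (hermite_mat d \<epsilon>)) y = poly (det (N y)) (- \<epsilon>)"
    unfolding poly_det_eq using entry car
    by (intro arg_cong[where f = det] eq_matI) (auto simp: hermite_mat_def)
  show "(N y)\<^sup>T = N y"
    by (rule eq_matI) (auto simp: N_def char_poly_matrix_def add.commute)
  have "char_poly (- mat d d (\<lambda>(i,j). poly (power_sum (i + j)) y)) \<noteq> 0"
    using degree_monic_char_poly[of "- mat d d (\<lambda>(i,j). poly (power_sum (i + j)) y)" d] by auto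
  then show "det (N y) \<noteq> 0" by (simp add: N_def char_poly_def)
qed

lemma eventually_hermite_det_nz:
  "eventually (\<lambda>\<epsilon>. poly (det (hermite_mat d \<epsilon>)) y \<noteq> 0) (at_right 0)"
proof -
  define D where "D = det (char_poly_matrix (- mat d d (\<lambda>(i,j). poly (power_sum (i + j)) y)))"
  have "finite {z. poly D z = 0}"
    using hermite_mat_eq_char_poly(5)[of d y] by (intro poly_roots_finite) (simp add: D_def)
  then have "eventually (\<lambda>\<epsilon>. \<forall>z\<in>{z. poly D z = 0}. \<epsilon> \<noteq> - z) (at_right 0)"
    by (intro eventually_ball_finite ballI eventually_neq_at_within)
  then show ?thesis
    by eventually_elim (auto simp: hermite_mat_eq_char_poly(2) D_def[symmetric])
qed

text \<open>
  At a point with \<open>d\<close> distinct roots a small shift does not destroy positive squares. Instead of a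
  compactness argument this uses the local constancy of inertia, read in the variable \<open>\<epsilon>\<close> at \<open>0\<close>.
\<close>
lemma eventually_hermite_inertia:
  assumes "card (roots t) = d"
  shows "eventually (\<lambda>\<epsilon>. \<forall>q. nonpos_codim d (\<lambda>i j. poly (hermite_mat d \<epsilon> $$ (i,j)) t) q \<longrightarrow> nroots t \<le> q) (at_right 0)"
proof -
  define N where "N = char_poly_matrix (- mat d d (\<lambda>(i,j). poly (power_sum (i + j)) t))"
  note N = hermite_mat_eq_char_poly[where d = d and y = t, folded N_def]
  obtain p e where p: "p \<le> d" "nonpos_codim d (\<lambda>i j. poly (N $$ (i,j)) 0) p" "e > 0"
    "\<And>x. \<bar>x - 0\<bar> < e \<Longrightarrow> pos_codim d (\<lambda>i j. poly (N $$ (i,j)) x) (d - p)"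
    using local_inertia[OF N(3,4,5), of 0] by blast
  have cong: "qform d (\<lambda>i j. poly (hermite_mat d \<epsilon> $$ (i,j)) t) = qform d (\<lambda>i j. poly (N $$ (i,j)) (- \<epsilon>))" for \<epsilon>
    unfolding qform_def by (intro ext sum.cong refl) (simp add: N(1))
  have 0: "qform d (\<lambda>i j. poly (power_sum (i + j)) t) = qform d (\<lambda>i j. poly (N $$ (i,j)) 0)"
  proof -
    have "poly (power_sum (i + j)) t = poly (N $$ (i,j)) 0" if "i < d" "j < d" for i j
      using N(1)[OF that, of 0] that by (simp add: hermite_mat_def split: if_splits)
    then show ?thesis unfolding qform_def by (intro ext sum.cong refl) simp
  qed
  have "pos_codim d (\<lambda>i j. poly (N $$ (i,j)) 0) (d - nroots t)"
    using hermite_pos[OF assms] by (simp add: sign_codim_def 0)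
  then have "d \<le> (d - nroots t) + p" using pos_nonpos_codim p(2) by blast
  moreover have "nroots t \<le> d" unfolding nroots_def using assms finite_roots by (metis (lifting) card_mono mem_Collect_eq subsetI)
  ultimately have np: "nroots t \<le> p" by linarith
  have "eventually (\<lambda>\<epsilon>::real. 0 < \<epsilon> \<and> \<epsilon> < e) (at_right 0)"
    using p(3) by (intro eventually_conj eventually_at_right_less eventually_at_rightI[of 0 e]) auto
  then show ?thesis
  proof eventually_elim
    case (elim \<epsilon>)
    show ?case
    proof (intro allI impI)
      fix q assume "nonpos_codim d (\<lambda>i j. poly (hermite_mat d \<epsilon> $$ (i,j)) t) q"
      then have "nonpos_codim d (\<lambda>i j. poly (N $$ (i,j)) (- \<epsilon>)) q" by (simp add: sign_codim_def cong)
      then have "d \<le> (d - p) + q" using pos_nonpos_codim[OF p(4)[of "- \<epsilon>"]] elim by simp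
      then show "nroots t \<le> q" using np p(1) by linarith
    qed
  qed
qed

text \<open>
  The jumps of \<open>nroots\<close> on both sides of the points of \<open>X\<close> are bounded by the number of zeros of one
  polynomial, the determinant of the shifted matrix. As \<open>\<epsilon>\<close> is chosen such that no point of \<open>X\<close> is a
  zero, the half-open intervals on the two sides of such a point count different zeros.
\<close>
lemma hermite_total:
  assumes X: "finite X"
    and lr: "\<And>\<alpha>. \<alpha> \<in> X \<Longrightarrow> l \<alpha> < \<alpha>" "\<And>\<alpha>. \<alpha> \<in> X \<Longrightarrow> \<alpha> < r \<alpha>"
    and disj: "\<And>\<alpha> \<beta>. \<alpha> \<in> X \<Longrightarrow> \<beta> \<in> X \<Longrightarrow> \<alpha> < \<beta> \<Longrightarrow> r \<alpha> \<le> l \<beta>"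
    and card: "\<And>\<alpha>. \<alpha> \<in> X \<Longrightarrow> card (roots (l \<alpha>)) = d" "\<And>\<alpha>. \<alpha> \<in> X \<Longrightarrow> card (roots (r \<alpha>)) = d"
  shows "(\<Sum>\<alpha>\<in>X. nroots (l \<alpha>) + nroots (r \<alpha>)) \<le> (\<Sum>\<alpha>\<in>X. 2 * nroots \<alpha>) + d * (d - 1)"
proof (cases "X = {}")
  case False
  have "eventually (\<lambda>\<epsilon>::real. 0 < \<epsilon> \<and> (\<forall>\<alpha>\<in>X. poly (det (hermite_mat d \<epsilon>)) \<alpha> \<noteq> 0) \<and>
     (\<forall>\<alpha>\<in>X. \<forall>q. nonpos_codim d (\<lambda>i j. poly (hermite_mat d \<epsilon> $$ (i,j)) (l \<alpha>)) q \<longrightarrow> nroots (l \<alpha>) \<le> q) \<and>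
     (\<forall>\<alpha>\<in>X. \<forall>q. nonpos_codim d (\<lambda>i j. poly (hermite_mat d \<epsilon> $$ (i,j)) (r \<alpha>)) q \<longrightarrow> nroots (r \<alpha>) \<le> q)) (at_right 0)"
    using X card by (intro eventually_conj eventually_at_right_less eventually_ball_finite ballI
       eventually_hermite_det_nz eventually_hermite_inertia) auto
  then obtain \<epsilon> :: real where \<epsilon>: "0 < \<epsilon>" "\<And>\<alpha>. \<alpha> \<in> X \<Longrightarrow> poly (det (hermite_mat d \<epsilon>)) \<alpha> \<noteq> 0"
    "\<And>\<alpha> q. \<alpha> \<in> X \<Longrightarrow> nonpos_codim d (\<lambda>i j. poly (hermite_mat d \<epsilon> $$ (i,j)) (l \<alpha>)) q \<Longrightarrow> nroots (l \<alpha>) \<le> q"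
    "\<And>\<alpha> q. \<alpha> \<in> X \<Longrightarrow> nonpos_codim d (\<lambda>i j. poly (hermite_mat d \<epsilon> $$ (i,j)) (r \<alpha>)) q \<Longrightarrow> nroots (r \<alpha>) \<le> q"
    using eventually_happens'[OF trivial_limit_at_right_real] by blast
  define G where "G = det (hermite_mat d \<epsilon>)"
  have G: "G \<noteq> 0" using \<epsilon>(2) False by (auto simp: G_def)
  define Zl where "Zl = (\<lambda>\<alpha>. {z. order z G \<noteq> 0 \<and> l \<alpha> < z \<and> z \<le> \<alpha>})"
  define Zr where "Zr = (\<lambda>\<alpha>. {z. order z G \<noteq> 0 \<and> \<alpha> \<le> z \<and> z < r \<alpha>})"
  define R where "R = {z. order z G \<noteq> 0}"
  have finR: "finite R" using poly_roots_finite[OF G] G by (simp add: order_root R_def)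
  have sub: "Zl \<alpha> \<subseteq> R" "Zr \<alpha> \<subseteq> R" for \<alpha> by (auto simp: Zl_def Zr_def R_def)
  have fin: "finite (Zl \<alpha> \<union> Zr \<alpha>)" for \<alpha> using sub[of \<alpha>] finR by (meson Un_least finite_subset)
  have notin: "order \<alpha> G = 0" if "\<alpha> \<in> X" for \<alpha>
    using \<epsilon>(2)[OF that] by (simp add: G_def order_0I)
  note jump = inertia_jump[OF hermite_mat_carrier hermite_mat_sym, of d \<epsilon>, folded G_def, OF G]
  have "nroots (l \<alpha>) + nroots (r \<alpha>) \<le> 2 * nroots \<alpha> + (\<Sum>z \<in> Zl \<alpha> \<union> Zr \<alpha>. order z G)" if \<alpha>: "\<alpha> \<in> X" for \<alpha>
  proof -
    have np: "nonpos_codim d (\<lambda>i j. poly (hermite_mat d \<epsilon> $$ (i,j)) \<alpha>) (nroots \<alpha>)"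
      using hermite_nonpos \<epsilon>(1) by simp
    have "nroots (l \<alpha>) \<le> nroots \<alpha> + (\<Sum>z \<in> Zl \<alpha>. order z G)"
      unfolding Zl_def using lr(1)[OF \<alpha>] np \<epsilon>(3)[OF \<alpha>] by (intro jump(2)) auto
    moreover have "nroots (r \<alpha>) \<le> nroots \<alpha> + (\<Sum>z \<in> Zr \<alpha>. order z G)"
      unfolding Zr_def using lr(2)[OF \<alpha>] np \<epsilon>(4)[OF \<alpha>] by (intro jump(1)) auto
    moreover have "(\<Sum>z \<in> Zl \<alpha> \<union> Zr \<alpha>. order z G) = (\<Sum>z \<in> Zl \<alpha>. order z G) + (\<Sum>z \<in> Zr \<alpha>. order z G)"
    proof (rule sum.union_disjoint)
      show "Zl \<alpha> \<inter> Zr \<alpha> = {}" using notin[OF \<alpha>] by (auto simp: Zl_def Zr_def)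
    qed (use fin in auto)
    ultimately show ?thesis by linarith
  qed
  then have "(\<Sum>\<alpha>\<in>X. nroots (l \<alpha>) + nroots (r \<alpha>)) \<le> (\<Sum>\<alpha>\<in>X. 2 * nroots \<alpha> + (\<Sum>z \<in> Zl \<alpha> \<union> Zr \<alpha>. order z G))"
    by (rule sum_mono)
  also have "\<dots> = (\<Sum>\<alpha>\<in>X. 2 * nroots \<alpha>) + (\<Sum>\<alpha>\<in>X. \<Sum>z \<in> Zl \<alpha> \<union> Zr \<alpha>. order z G)" by (rule sum.distrib)
  also have "(\<Sum>\<alpha>\<in>X. \<Sum>z \<in> Zl \<alpha> \<union> Zr \<alpha>. order z G) = (\<Sum>z \<in> (\<Union>\<alpha>\<in>X. Zl \<alpha> \<union> Zr \<alpha>). order z G)"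
  proof (rule sum.UNION_disjoint[symmetric, OF X])
    have "(Zl \<alpha> \<union> Zr \<alpha>) \<inter> (Zl \<beta> \<union> Zr \<beta>) = {}" if "\<alpha> \<in> X" "\<beta> \<in> X" "\<alpha> < \<beta>" for \<alpha> \<beta>
      using disj[OF that] that lr unfolding Zl_def Zr_def by force
    then show "\<forall>\<alpha>\<in>X. \<forall>\<beta>\<in>X. \<alpha> \<noteq> \<beta> \<longrightarrow> (Zl \<alpha> \<union> Zr \<alpha>) \<inter> (Zl \<beta> \<union> Zr \<beta>) = {}"
      by (metis inf_commute linorder_neqE_linordered_idom)
  qed (use fin in auto)
  also have "\<dots> \<le> (\<Sum>z \<in> R. order z G)" using finR sub by (intro sum_mono2) auto
  also have "\<dots> \<le> degree G"
  proof -
    have "R = {z. poly G z = 0}" using G by (auto simp: R_def order_root)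
    then show ?thesis using sum_order_le_degree[OF G] by simp
  qed
  also have "\<dots> \<le> d * (d - 1)" unfolding G_def by (rule degree_det_hermite)
  finally show ?thesis by simp
qed simp

end

section \<open>Sweeping the complement of a curve\<close>

lemma card_le_separators:
  fixes T R :: "real set"
  assumes fin: "finite T" "finite R" and sep: "\<And>u v. u \<in> T \<Longrightarrow> v \<in> T \<Longrightarrow> u < v \<Longrightarrow> \<exists>\<rho>\<in>R. u < \<rho> \<and> \<rho> < v"
  shows "card T \<le> card R + 1"
proof (cases "T = {}")
  case False
  define f where "f = (\<lambda>u. Min {\<rho>\<in>R. u < \<rho>})"
  have m: "Max T \<in> T" using False fin by simp
  have f: "f u \<in> R \<and> u < f u \<and> (\<forall>v\<in>T. u < v \<longrightarrow> f u < v)" if u: "u \<in> T - {Max T}" for u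
  proof -
    have "u < Max T" using u fin by (metis Diff_iff Max_ge insertCI order_le_less)
    then have ne: "{\<rho>\<in>R. u < \<rho>} \<noteq> {}" using sep[of u "Max T"] u m by auto
    have "f u \<in> {\<rho>\<in>R. u < \<rho>}" unfolding f_def using fin ne by (intro Min_in) auto
    moreover have "f u < v" if v: "v \<in> T" "u < v" for v
    proof -
      obtain \<rho> where "\<rho> \<in> R" "u < \<rho>" "\<rho> < v" using sep[of u v] u v by auto
      then have "f u \<le> \<rho>" unfolding f_def using fin by (intro Min_le) auto
      then show ?thesis using \<open>\<rho> < v\<close> by simp
    qed
    ultimately show ?thesis by auto
  qed
  have "inj_on f (T - {Max T})"
  proof (rule linorder_inj_onI)
    fix u v assume uv: "u < v" "u \<in> T - {Max T}" "v \<in> T - {Max T}"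
    then have "f u < v" "v < f v" using f by auto
    then show "f u \<noteq> f v" by simp
  qed auto
  then have "card (T - {Max T}) \<le> card R" using f fin by (intro card_inj_on_le[of f]) auto
  then show ?thesis using m fin by (simp add: card_Diff_singleton)
qed simp

lemma finite_set_gap:
  fixes S :: "'a::metric_space set"
  assumes "finite S"
  shows "\<exists>m>0. \<forall>x\<in>S. \<forall>y\<in>S. x \<noteq> y \<longrightarrow> m \<le> dist x y"
proof -
  define D where "D = (\<lambda>p. dist (fst p) (snd p)) ` (S \<times> S - Id)"
  have f: "finite (insert 1 D)" using assms by (simp add: D_def)
  then have "Min (insert 1 D) > 0" by (subst Min_gr_iff) (auto simp: D_def)
  moreover have "Min (insert 1 D) \<le> dist x y" if "x \<in> S" "y \<in> S" "x \<noteq> y" for x y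
    using that by (intro Min_le f) (force simp: D_def image_iff)
  ultimately show ?thesis by blast
qed

context monic_family
begin

definition region :: "(real \<times> real) set" where
  "region = {(x,y). poly (fibre x) y \<noteq> 0}"

definition real_roots :: "real \<Rightarrow> real set" where
  "real_roots x = {y. poly (fibre x) y = 0}"

lemma poly_cfibre_of_real: "poly (cfibre x) (of_real y) = of_real (poly (fibre x) y)"
  by (simp add: cfibre_def)

lemma real_roots_iff: "y \<in> real_roots x \<longleftrightarrow> complex_of_real y \<in> roots x"
  by (simp add: real_roots_def roots_def poly_cfibre_of_real)

lemma finite_real_roots: "finite (real_roots x)"
proof (rule finite_imageD)
  show "finite (complex_of_real ` real_roots x)"
    by (rule finite_subset[OF _ finite_roots[of x]]) (auto simp: real_roots_iff)
qed (simp add: inj_on_def)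

lemma card_real_roots_le: "card (real_roots x) \<le> e"
proof -
  have "card (real_roots x) = card (complex_of_real ` real_roots x)"
    by (simp add: card_image inj_on_def)
  also have "\<dots> \<le> card (roots x)" using finite_roots by (intro card_mono) (auto simp: real_roots_iff)
  finally show ?thesis using card_roots_le[of x] by simp
qed

lemma nroots_eq: "nroots x = card (real_roots x) + card {w \<in> roots x. 0 < Im w}"
proof -
  have "{w \<in> roots x. 0 \<le> Im w} = complex_of_real ` real_roots x \<union> {w \<in> roots x. 0 < Im w}"
  proof (intro equalityI subsetI)
    fix w assume w: "w \<in> {w \<in> roots x. 0 \<le> Im w}"
    show "w \<in> complex_of_real ` real_roots x \<union> {w \<in> roots x. 0 < Im w}"
    proof (cases "Im w = 0")
      case True
      then have "w = complex_of_real (Re w)" by (simp add: complex_eq_iff)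
      then have "Re w \<in> real_roots x" "w = complex_of_real (Re w)" using w by (auto simp: real_roots_iff)
      then show ?thesis by blast
    qed (use w in auto)
  qed (auto simp: real_roots_iff)
  moreover have "card (complex_of_real ` real_roots x \<union> {w \<in> roots x. 0 < Im w})
     = card (complex_of_real ` real_roots x) + card {w \<in> roots x. 0 < Im w}"
    using finite_real_roots finite_roots by (intro card_Un_disjoint) auto
  ultimately show ?thesis unfolding nroots_def by (simp add: card_image inj_on_def)
qed

lemma fibre_value: "poly (fibre x) y = (\<Sum>j\<le>e. poly (A j) x * y ^ j)"
  by (simp add: fibre_def poly_sum poly_monom)

lemma continuous_fibre: "continuous_on UNIV (\<lambda>(x,y). poly (fibre x) y)"
  unfolding fibre_value case_prod_beta by (intro continuous_intros)

lemma open_region: "open region"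
proof -
  have "region = (\<lambda>(x,y). poly (fibre x) y) -` (- {0})" by (auto simp: region_def)
  then show ?thesis using open_vimage[OF _ continuous_fibre, of "- {0}"] by (simp add: open_Compl)
qed

text \<open>
  The value of a monic polynomial at \<open>w\<close> is the product of the distances from \<open>w\<close> to the roots, so a
  small value forces a root nearby.
\<close>
lemma roots_near:
  assumes w: "w \<in> roots \<alpha>" and \<eta>: "\<eta> > 0"
  shows "eventually (\<lambda>t. \<exists>u\<in>roots t. dist u w < \<eta>) (nhds \<alpha>)"
proof -
  have bound: "\<eta> ^ size M \<le> norm (poly (\<Prod>u\<in>#M. [:- u, 1:]) w)" if "\<forall>u\<in>#M. \<eta> \<le> dist u w" for M
    using that
  proof (induction M)
    case (add u M)
    have "\<eta> * \<eta> ^ size M \<le> norm (w - u) * norm (poly (\<Prod>u\<in>#M. [:- u, 1:]) w)"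
      using add \<eta> by (intro mult_mono) (auto simp: dist_norm norm_minus_commute)
    also have "\<dots> = norm (poly (\<Prod>u\<in>#add_mset u M. [:- u, 1:]) w)"
      by (simp add: norm_mult[symmetric] algebra_simps)
    finally show ?case by simp
  qed simp
  have "((\<lambda>t. poly (cfibre t) w) \<longlongrightarrow> poly (cfibre \<alpha>) w) (nhds \<alpha>)"
    unfolding poly_altdef degree_cfibre coeff_cfibre by (auto intro!: tendsto_intros filterlim_ident)
  then have "((\<lambda>t. poly (cfibre t) w) \<longlongrightarrow> 0) (nhds \<alpha>)" using w by (simp add: roots_def)
  then have "eventually (\<lambda>t. norm (poly (cfibre t) w) < \<eta> ^ e) (nhds \<alpha>)"
    using \<eta> by (simp add: tendsto_iff)
  then show ?thesis
  proof eventually_elim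
    case (elim t)
    show ?case
    proof (rule ccontr)
      assume "\<not> ?thesis"
      then have "\<forall>u\<in>#proots (cfibre t). \<eta> \<le> dist u w"
        using cfibre_nz by (auto simp: roots_def not_less)
      then have "\<eta> ^ size (proots (cfibre t)) \<le> norm (poly (\<Prod>u\<in>#proots (cfibre t). [:- u, 1:]) w)" by (rule bound)
      then have "\<eta> ^ e \<le> norm (poly (cfibre t) w)"
        unfolding cfibre_decompose[symmetric] by (simp add: size_proots_complex degree_cfibre)
      then show False using elim by simp
    qed
  qed
qed

lemma vertical_segment_component:
  assumes "U \<in> components region" "(t,u) \<in> U" "(t,v) \<in> region" "\<And>\<rho>. \<rho> \<in> real_roots t \<Longrightarrow> min u v < \<rho> \<Longrightarrow> \<rho> < max u v \<Longrightarrow> False"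
  shows "(t,v) \<in> U"
proof -
  let ?C = "{t} \<times> {min u v..max u v}"
  have "(t,u) \<in> region" using assms(1,2) in_components_subset by blast
  then have ends: "u \<notin> real_roots t" "v \<notin> real_roots t" using assms(3) by (auto simp: region_def real_roots_def)
  have "z \<notin> real_roots t" if "min u v \<le> z" "z \<le> max u v" for z
    using ends assms(4)[of z] that by (cases "z = u \<or> z = v") (auto simp: min_def max_def split: if_splits)
  then have "?C \<subseteq> region" by (auto simp: region_def real_roots_def)
  moreover have "connected ?C" by (intro connected_Times) auto
  moreover have "U \<inter> ?C \<noteq> {}" using assms(2) by auto
  ultimately have "?C \<subseteq> U" using components_maximal[OF assms(1)] by blast
  then show ?thesis by auto
qed
text \<open>
  Points of a vertical line that lie in different components are separated by a root, and a line with
  \<open>r\<close> roots has room for \<open>r + 1\<close> pairwise separated points. The set \<open>Q\<close> takes up some of the room with points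
  outside the components of \<open>F\<close>.
\<close>
lemma components_through_line:
  assumes fin: "finite F" and F: "F \<subseteq> components region" and y: "\<And>U. U \<in> F \<Longrightarrow> (t, y U) \<in> U"
    and Q: "finite Q" "\<And>q. q \<in> Q \<Longrightarrow> (t,q) \<in> region \<and> (\<forall>U\<in>F. (t,q) \<notin> U)"
    and sep: "\<And>u v. u \<in> Q \<Longrightarrow> v \<in> Q \<Longrightarrow> u < v \<Longrightarrow> \<exists>\<rho>\<in>real_roots t. u < \<rho> \<and> \<rho> < v"
  shows "card F + card Q \<le> card (real_roots t) + 1"
proof -
  have inreg: "(t, y U) \<in> region" if "U \<in> F" for U using y[OF that] F that in_components_subset by blast
  have same: "U = V" if "U \<in> F" "V \<in> F" "(t, z) \<in> U" "(t, z) \<in> V" for U V z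
    using that F components_nonoverlap[of U region V] by blast
  have inj: "inj_on y F"
    by (rule inj_onI) (metis same y)
  have disj: "y ` F \<inter> Q = {}" using Q(2) y by fastforce
  have "card (y ` F \<union> Q) \<le> card (real_roots t) + 1"
  proof (rule card_le_separators)
    fix u v assume uv: "u \<in> y ` F \<union> Q" "v \<in> y ` F \<union> Q" "u < v"
    show "\<exists>\<rho>\<in>real_roots t. u < \<rho> \<and> \<rho> < v"
    proof (rule ccontr)
      assume no: "\<not> ?thesis"
      show False
      proof (cases "u \<in> y ` F")
        case True
        then obtain U where U: "U \<in> F" "u = y U" by auto
        have "(t,v) \<in> region" using uv(2) Q(2) inreg by auto
        then have v: "(t,v) \<in> U" using vertical_segment_component[of U t u v] U F y no uv(3) by (auto simp: min_def max_def)
        then obtain V where "V \<in> F" "v = y V" using uv(2) Q(2) U by blast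
        then show False using same[OF U(1) _ v] y U uv(3) by auto
      next
        case False
        then have uQ: "u \<in> Q" using uv by auto
        then have "v \<notin> Q" using sep no uv by blast
        then obtain V where V: "V \<in> F" "v = y V" using uv by auto
        then have "(t,u) \<in> V" using vertical_segment_component[of V t v u] F y no uv(3) Q(2)[OF uQ] by (auto simp: min_def max_def)
        then show False using Q(2)[OF uQ] V by blast
      qed
    qed
  qed (use fin Q finite_real_roots in auto)
  moreover have "card (y ` F \<union> Q) = card F + card Q"
    using card_Un_disjoint[of "y ` F" Q] fin Q disj inj by (simp add: card_image)
  ultimately show ?thesis by simp
qed

text \<open>
  Let components of \<open>F\<close> accumulate at the line over \<open>\<alpha>\<close> without meeting it. Put a point just above each
  real root over \<open>\<alpha>\<close> and one below all of them. Moved horizontally from \<open>\<alpha>\<close> to \<open>t\<close>, these points stay in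
  components that meet the line over \<open>\<alpha>\<close>, hence not in those of \<open>F\<close>. Of them, keep the ones whose real root has
  survived as a real root over \<open>t\<close>: they are still separated, and they use up that many intervals of
  the line over \<open>t\<close>. Each real root that has not survived has turned into a pair of nonreal roots, which is
  new because the nonreal pairs over \<open>\<alpha>\<close> have their own continuations. The account of roots
  and pairs over \<open>t\<close> therefore exceeds that over \<open>\<alpha>\<close> by at least the number of components in \<open>F\<close>.
  
  The filter is arbitrary because the argument serves births (from the right) and deaths
  (from the left) alike.
\<close>
lemma new_components:
  assumes fin: "finite F" and F: "F \<subseteq> components region"
    and avoid: "\<And>U y. U \<in> F \<Longrightarrow> (\<alpha>, y) \<notin> U"
    and near: "\<And>U. U \<in> F \<Longrightarrow> eventually (\<lambda>t. \<exists>y. (t,y) \<in> U) (at \<alpha> within S)"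
  shows "eventually (\<lambda>t. card F + nroots \<alpha> \<le> nroots t) (at \<alpha> within S)"
proof -
  obtain \<eta> where \<eta>: "\<eta> > 0" "\<And>w w'. w \<in> roots \<alpha> \<Longrightarrow> w' \<in> roots \<alpha> \<Longrightarrow> w \<noteq> w' \<Longrightarrow> 4 * \<eta> < dist w w'"
  proof -
    obtain m where "m > 0" "\<And>w w'. w \<in> roots \<alpha> \<Longrightarrow> w' \<in> roots \<alpha> \<Longrightarrow> w \<noteq> w' \<Longrightarrow> m \<le> dist w w'"
      using finite_set_gap[OF finite_roots[of \<alpha>]] by blast
    then have "4 * (m / 5) < dist w w'" if "w \<in> roots \<alpha>" "w' \<in> roots \<alpha>" "w \<noteq> w'" for w w'
      using that by fastforce
    then show ?thesis using that[of "m / 5"] \<open>m > 0\<close> by simp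
  qed
  have real_sep: "4 * \<eta> < \<bar>\<rho> - \<rho>'\<bar>" if "\<rho> \<in> real_roots \<alpha>" "\<rho>' \<in> real_roots \<alpha>" "\<rho> \<noteq> \<rho>'" for \<rho> \<rho>'
    using \<eta>(2)[of "of_real \<rho>" "of_real \<rho>'"] that
    by (simp add: real_roots_iff dist_norm flip: of_real_diff)
  define q0 where "q0 = (if real_roots \<alpha> = {} then 0 else Min (real_roots \<alpha>) - \<eta>)"
  have q0: "q0 \<le> \<rho> - \<eta>" if "\<rho> \<in> real_roots \<alpha>" for \<rho>
    using that finite_real_roots[of \<alpha>] by (auto simp: q0_def)
  have q0_notin: "q0 \<notin> real_roots \<alpha>" using q0[of q0] \<eta>(1) by auto
  define Q where "Q = insert q0 ((\<lambda>\<rho>. \<rho> + \<eta>) ` real_roots \<alpha>)"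
  have finQ: "finite Q" using finite_real_roots by (simp add: Q_def)
  have Q_notin: "q \<notin> real_roots \<alpha>" if "q \<in> Q" for q
    using that q0_notin real_sep \<eta>(1) unfolding Q_def by force
  have ev1: "eventually (\<lambda>t. \<forall>q\<in>Q. \<forall>x\<in>closed_segment \<alpha> t. poly (fibre x) q \<noteq> 0) (at \<alpha> within S)"
  proof (intro eventually_ball_finite finQ ballI)
    fix q assume "q \<in> Q"
    then have nz: "poly (fibre \<alpha>) q \<noteq> 0" using Q_notin by (auto simp: real_roots_def)
    have "((\<lambda>x. poly (fibre x) q) \<longlongrightarrow> poly (fibre \<alpha>) q) (nhds \<alpha>)"
      unfolding fibre_value by (auto intro!: tendsto_intros filterlim_ident)
    then have "eventually (\<lambda>x. poly (fibre x) q \<noteq> 0) (nhds \<alpha>)"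
      using nz by (rule tendsto_imp_eventually_ne)
    then obtain \<delta> where \<delta>: "\<delta> > 0" "\<And>x. dist x \<alpha> < \<delta> \<Longrightarrow> poly (fibre x) q \<noteq> 0"
      unfolding eventually_nhds_metric by auto
    show "eventually (\<lambda>t. \<forall>x\<in>closed_segment \<alpha> t. poly (fibre x) q \<noteq> 0) (at \<alpha> within S)"
      unfolding eventually_at
    proof (intro exI[of _ \<delta>] conjI ballI impI)
      fix t x assume "t \<noteq> \<alpha> \<and> dist t \<alpha> < \<delta>" "x \<in> closed_segment \<alpha> t"
      then have "dist x \<alpha> < \<delta>" by (auto simp: closed_segment_eq_real_ivl dist_real_def split: if_splits)
      then show "poly (fibre x) q \<noteq> 0" by (rule \<delta>(2))
    qed (rule \<delta>(1))
  qed
  have ev2: "eventually (\<lambda>t. \<forall>w\<in>roots \<alpha>. \<exists>u\<in>roots t. dist u w < \<eta>) (at \<alpha> within S)"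
  proof (intro eventually_ball_finite ballI finite_roots)
    fix w assume "w \<in> roots \<alpha>"
    from roots_near[OF this \<eta>(1)] show "eventually (\<lambda>t. \<exists>u\<in>roots t. dist u w < \<eta>) (at \<alpha> within S)"
      unfolding eventually_at_filter by (rule eventually_mono) simp
  qed
  have ev3: "eventually (\<lambda>t. \<forall>U\<in>F. \<exists>y. (t,y) \<in> U) (at \<alpha> within S)"
    using near fin by (intro eventually_ball_finite ballI)
  show ?thesis
    using ev1 ev2 ev3
  proof eventually_elim
    case (elim t)
    obtain y where y: "\<And>U. U \<in> F \<Longrightarrow> (t, y U) \<in> U" using elim(3) by metis
    define R' where "R' = {\<rho> \<in> real_roots \<alpha>. \<exists>z\<in>real_roots t. \<bar>z - \<rho>\<bar> < \<eta>}"
    define Q' where "Q' = insert q0 ((\<lambda>\<rho>. \<rho> + \<eta>) ` R')"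
    have R': "R' \<subseteq> real_roots \<alpha>" "finite R'" using finite_real_roots by (auto simp: R'_def)
    have Q'Q: "Q' \<subseteq> Q" using R' by (auto simp: Q'_def Q_def)
    have "card F + card Q' \<le> card (real_roots t) + 1"
    proof (rule components_through_line[OF fin F y])
      show "finite Q'" using R' by (simp add: Q'_def)
      fix q assume q: "q \<in> Q'"
      let ?C = "closed_segment \<alpha> t \<times> {q}"
      have C: "?C \<subseteq> region" using elim(1) q Q'Q by (auto simp: region_def)
      have conn: "connected ?C" by (intro connected_Times) auto
      show "(t,q) \<in> region \<and> (\<forall>U\<in>F. (t,q) \<notin> U)"
      proof (intro conjI ballI notI)
        show "(t,q) \<in> region" using C by auto
        fix U assume "U \<in> F" "(t,q) \<in> U"
        then have "?C \<subseteq> U" using components_maximal[of U region ?C] C conn F by auto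
        then show False using avoid[OF \<open>U \<in> F\<close>, of q] by auto
      qed
    next
      fix u v assume uv: "u \<in> Q'" "v \<in> Q'" "u < v"
      have "q0 < v" if "v \<in> (\<lambda>\<rho>. \<rho> + \<eta>) ` R'" for v using that R' q0 \<eta>(1) by force
      then have "q0 \<le> u" using uv(1) by (fastforce simp: Q'_def)
      then have "v \<noteq> q0" using uv(3) by simp
      then obtain \<rho> where \<rho>: "\<rho> \<in> R'" "v = \<rho> + \<eta>" using uv by (auto simp: Q'_def)
      obtain z where z: "z \<in> real_roots t" "\<bar>z - \<rho>\<bar> < \<eta>" using \<rho> by (auto simp: R'_def)
      have "u \<le> \<rho> - \<eta>"
      proof (cases "u = q0")
        case True
        then show ?thesis using q0 \<rho> R' by auto
      next
        case False
        then obtain \<rho>' where \<rho>': "\<rho>' \<in> R'" "u = \<rho>' + \<eta>" using uv by (auto simp: Q'_def)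
        then have "4 * \<eta> < \<bar>\<rho> - \<rho>'\<bar>" using real_sep[of \<rho> \<rho>'] \<rho> R' uv(3) by auto
        then show ?thesis using \<rho> \<rho>' uv(3) \<eta>(1) by auto
      qed
      then show "\<exists>\<rho>\<in>real_roots t. u < \<rho> \<and> \<rho> < v" using z \<rho>(2) by (intro bexI[of _ z]) auto
    qed
    moreover have "card Q' = 1 + card R'"
    proof -
      have "q0 \<notin> (\<lambda>\<rho>. \<rho> + \<eta>) ` R'" using q0 R' \<eta>(1) by fastforce
      then show ?thesis using R' by (simp add: Q'_def card_image inj_on_def)
    qed
    moreover have "card (real_roots \<alpha> - R') + card {w \<in> roots \<alpha>. 0 < Im w} \<le> card {w \<in> roots t. 0 < Im w}"
    proof -
      define W where "W = complex_of_real ` (real_roots \<alpha> - R') \<union> {w \<in> roots \<alpha>. 0 < Im w}"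
      have Wsub: "W \<subseteq> roots \<alpha>" by (auto simp: W_def real_roots_iff)
      have "\<exists>u. u \<in> roots t \<and> 0 < Im u \<and> dist u w < \<eta>" if w: "w \<in> W" for w
      proof -
        obtain u where u: "u \<in> roots t" "dist u w < \<eta>" using elim(2) w Wsub by blast
        show ?thesis
        proof (cases "0 < Im w")
          case True
          have "cnj w \<noteq> w" using True by (simp add: complex_eq_iff)
          then have "4 * \<eta> < dist w (cnj w)" using \<eta>(2)[of w "cnj w"] w Wsub cnj_roots by auto
          also have "dist w (cnj w) = 2 * Im w" using True by (simp add: dist_norm complex_diff_cnj norm_mult)
          finally have "\<eta> < Im w" using \<eta>(1) by simp
          moreover have "\<bar>Im u - Im w\<bar> < \<eta>" using abs_Im_le_cmod[of "u - w"] u(2) by (simp add: dist_norm)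
          ultimately have "0 < Im u" by linarith
          then show ?thesis using u by auto
        next
          case False
          then obtain \<rho> where \<rho>: "\<rho> \<in> real_roots \<alpha> - R'" "w = of_real \<rho>" using w by (auto simp: W_def)
          have "Im u \<noteq> 0"
          proof
            assume "Im u = 0"
            then have u': "u = of_real (Re u)" by (simp add: complex_eq_iff)
            then have "Re u \<in> real_roots t" using u(1) by (simp add: real_roots_iff)
            moreover have "\<bar>Re u - \<rho>\<bar> < \<eta>" using abs_Re_le_cmod[of "u - w"] u(2) \<rho>(2) by (simp add: dist_norm)
            ultimately show False using \<rho> by (auto simp: R'_def)
          qed
          moreover have "dist (cnj u) w = dist u w"
            using \<rho>(2) by (metis complex_cnj_complex_of_real complex_cnj_diff complex_mod_cnj dist_norm)
          ultimately show ?thesis using u cnj_roots[of u]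
            by (cases "0 < Im u") (blast, auto intro!: exI[of _ "cnj u"])
        qed
      qed
      then obtain h where h: "\<And>w. w \<in> W \<Longrightarrow> h w \<in> roots t \<and> 0 < Im (h w) \<and> dist (h w) w < \<eta>" by metis
      have "inj_on h W"
      proof (rule inj_onI, rule ccontr)
        fix w w' assume ww: "w \<in> W" "w' \<in> W" "h w = h w'" "w \<noteq> w'"
        have "dist w w' < 2 * \<eta>" using dist_triangle3[of w w' "h w"] h[OF ww(1)] h[OF ww(2)] ww(3) by auto
        then show False using \<eta> ww Wsub by fastforce
      qed
      then have "card W \<le> card {w \<in> roots t. 0 < Im w}"
        using h finite_roots by (intro card_inj_on_le[of h]) auto
      moreover have "card W = card (complex_of_real ` (real_roots \<alpha> - R')) + card {w \<in> roots \<alpha>. 0 < Im w}"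
        unfolding W_def using finite_real_roots finite_roots by (intro card_Un_disjoint) auto
      ultimately show ?thesis by (simp add: card_image inj_on_def)
    qed
    moreover have "card (real_roots \<alpha>) = card R' + card (real_roots \<alpha> - R')"
      using R' finite_real_roots[of \<alpha>] by (simp add: card_Diff_subset card_mono)
    ultimately show ?case unfolding nroots_eq by linarith
  qed
qed

lemma components_reaching_infinity:
  assumes fin: "finite F" and F: "F \<subseteq> components region" and t: "\<And>U. U \<in> F \<Longrightarrow> \<exists>y. (t,y) \<in> U"
  shows "card F \<le> e + 1"
proof -
  obtain y where "\<And>U. U \<in> F \<Longrightarrow> (t, y U) \<in> U" using t by metis
  from components_through_line[OF fin F this, where Q = "{}"] show ?thesis
    using card_real_roots_le[of t] by simp
qed

text \<open>
  Every component has a left end, where it is born or which is at infinity, and likewise a right end.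
  Adding the two counts makes both one-sided jumps at each abscissa available at once, which is
  what the determinant bounds.
\<close>
theorem card_components_finite:
  assumes fin: "finite F" and F: "F \<subseteq> components region"
  shows "2 * card F \<le> 2 * (e + 1) + e * (e - 1)"
proof -
  define pr where "pr = (\<lambda>U :: (real \<times> real) set. fst ` U)"
  have pr_U: "open (pr U) \<and> is_interval (pr U) \<and> pr U \<noteq> {}" if "U \<in> F" for U
  proof -
    have U: "U \<in> components region" using that F by auto
    have "open U" using open_components[OF open_region U] .
    then have "open (pr U)" unfolding pr_def by (rule open_image_fst)
    moreover have "connected (pr U)" unfolding pr_def
      by (rule connected_continuous_image) (auto intro: continuous_intros in_components_connected[OF U])
    moreover have "pr U \<noteq> {}" using in_components_nonempty[OF U] by (simp add: pr_def)
    ultimately show ?thesis by (simp add: is_interval_connected_1)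
  qed
  have mem: "t \<in> pr U \<longleftrightarrow> (\<exists>y. (t,y) \<in> U)" for t U by (force simp: pr_def)
  have interval: "t \<in> pr U" if "U \<in> F" "s \<in> pr U" "s' \<in> pr U" "s \<le> t" "t \<le> s'" for U s s' t
    using pr_U[OF that(1)] that unfolding is_interval_1 by blast
  define L where "L = {U\<in>F. \<not> bdd_below (pr U)}"
  define R where "R = {U\<in>F. \<not> bdd_above (pr U)}"
  define FL where "FL = (\<lambda>\<alpha>. {U\<in>F. bdd_below (pr U) \<and> Inf (pr U) = \<alpha>})"
  define FR where "FR = (\<lambda>\<alpha>. {U\<in>F. bdd_above (pr U) \<and> Sup (pr U) = \<alpha>})"
  have finL: "finite L" "finite R" "finite (FL \<alpha>)" "finite (FR \<alpha>)" for \<alpha>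
    using fin by (auto simp: L_def R_def FL_def FR_def)
  have cardL: "card L \<le> e + 1"
  proof -
    have "\<exists>s. \<forall>U\<in>L. \<forall>t\<le>s. t \<in> pr U" using finL(1)
    proof -
      have "eventually (\<lambda>t. t \<in> pr U) at_bot" if U: "U \<in> L" for U
      proof -
        have "U \<in> F" using U by (simp add: L_def)
        then have "pr U \<noteq> {}" using pr_U by simp
        then obtain s' where s': "s' \<in> pr U" by auto
        have "t \<in> pr U" if "t \<le> s'" for t
        proof -
          obtain s where "s \<in> pr U" "s < t" using U unfolding L_def bdd_below_def by (auto simp: not_le)
          then show ?thesis using interval[of U s s' t] s' that U by (auto simp: L_def)
        qed
        then show ?thesis unfolding eventually_at_bot_linorder by auto
      qed
      then have "eventually (\<lambda>t. \<forall>U\<in>L. t \<in> pr U) at_bot" using finL(1) by (intro eventually_ball_finite) auto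
      then show ?thesis unfolding eventually_at_bot_linorder by blast
    qed
    then obtain s where "\<And>U. U \<in> L \<Longrightarrow> s \<in> pr U" by auto
    then show ?thesis using finL(1) F by (intro components_reaching_infinity[of L s]) (auto simp: mem L_def)
  qed
  have cardR: "card R \<le> e + 1"
  proof -
    have "eventually (\<lambda>t. t \<in> pr U) at_top" if U: "U \<in> R" for U
    proof -
      have "U \<in> F" using U by (simp add: R_def)
        then have "pr U \<noteq> {}" using pr_U by simp
        then obtain s' where s': "s' \<in> pr U" by auto
      have "t \<in> pr U" if "s' \<le> t" for t
      proof -
        obtain s where "s \<in> pr U" "t < s" using U unfolding R_def bdd_above_def by (auto simp: not_le)
        then show ?thesis using interval[of U s' s t] s' that U by (auto simp: R_def)
      qed
      then show ?thesis unfolding eventually_at_top_linorder by auto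
    qed
    then have "eventually (\<lambda>t. \<forall>U\<in>R. t \<in> pr U) at_top" using finL(2) by (intro eventually_ball_finite) auto
    then obtain s where "\<And>U. U \<in> R \<Longrightarrow> s \<in> pr U" unfolding eventually_at_top_linorder by blast
    then show ?thesis using finL(2) F by (intro components_reaching_infinity[of R s]) (auto simp: mem R_def)
  qed
  have newL: "eventually (\<lambda>t. card (FL \<alpha>) + nroots \<alpha> \<le> nroots t) (at_right \<alpha>)" for \<alpha>
  proof (rule new_components)
    fix U assume "U \<in> FL \<alpha>"
    then have U: "U \<in> F" "bdd_below (pr U)" "Inf (pr U) = \<alpha>" by (auto simp: FL_def)
    have notin: "\<alpha> \<notin> pr U"
    proof
      assume "\<alpha> \<in> pr U"
      then obtain \<delta> where "\<delta> > 0" "ball \<alpha> \<delta> \<subseteq> pr U" using pr_U[OF U(1)] open_contains_ball by blast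
      then have "\<alpha> - \<delta>/2 \<in> pr U" by (auto simp: dist_real_def)
      then have "\<alpha> \<le> \<alpha> - \<delta>/2" using cInf_lower[OF _ U(2)] U(3) by blast
      then show False using \<open>\<delta> > 0\<close> by simp
    qed
    show "(\<alpha>, y) \<notin> U" for y using notin mem by blast
    obtain s' where s': "s' \<in> pr U" using pr_U U by auto
    have "\<alpha> < s'" using cInf_lower[OF s' U(2)] U(3) notin s' by (cases "s' = \<alpha>") auto
    moreover have "t \<in> pr U" if "\<alpha> < t" "t < s'" for t
    proof -
      obtain s where "s \<in> pr U" "s < t" using cInf_lessD[of "pr U" t] pr_U[OF U(1)] U(3) \<open>\<alpha> < t\<close> by auto
      then show ?thesis using interval[OF U(1), of s s' t] s' that by auto
    qed
    ultimately show "eventually (\<lambda>t. \<exists>y. (t,y) \<in> U) (at_right \<alpha>)"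
      unfolding mem[symmetric] by (intro eventually_at_rightI[of \<alpha> s']) auto
  qed (use finL F in \<open>auto simp: FL_def\<close>)
  have newR: "eventually (\<lambda>t. card (FR \<alpha>) + nroots \<alpha> \<le> nroots t) (at_left \<alpha>)" for \<alpha>
  proof (rule new_components)
    fix U assume "U \<in> FR \<alpha>"
    then have U: "U \<in> F" "bdd_above (pr U)" "Sup (pr U) = \<alpha>" by (auto simp: FR_def)
    have notin: "\<alpha> \<notin> pr U"
    proof
      assume "\<alpha> \<in> pr U"
      then obtain \<delta> where "\<delta> > 0" "ball \<alpha> \<delta> \<subseteq> pr U" using pr_U[OF U(1)] open_contains_ball by blast
      then have "\<alpha> + \<delta>/2 \<in> pr U" by (auto simp: dist_real_def)
      then have "\<alpha> + \<delta>/2 \<le> \<alpha>" using cSup_upper[OF _ U(2)] U(3) by blast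
      then show False using \<open>\<delta> > 0\<close> by simp
    qed
    show "(\<alpha>, y) \<notin> U" for y using notin mem by blast
    obtain s' where s': "s' \<in> pr U" using pr_U U by auto
    have "s' < \<alpha>" using cSup_upper[OF s' U(2)] U(3) notin s' by (cases "s' = \<alpha>") auto
    moreover have "t \<in> pr U" if "t < \<alpha>" "s' < t" for t
    proof -
      obtain s where "s \<in> pr U" "t < s" using less_cSupD[of "pr U" t] pr_U[OF U(1)] U(3) \<open>t < \<alpha>\<close> by auto
      then show ?thesis using interval[OF U(1), of s' s t] s' that by auto
    qed
    ultimately show "eventually (\<lambda>t. \<exists>y. (t,y) \<in> U) (at_left \<alpha>)"
      unfolding mem[symmetric] by (intro eventually_at_leftI[of s' \<alpha>]) auto
  qed (use finL F in \<open>auto simp: FR_def\<close>)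
  \<comment> \<open>for unbounded projections \<open>Inf\<close> and \<open>Sup\<close> are default values, which may enlarge \<open>X\<close>\<close>
  define X where "X = (\<lambda>U. Inf (pr U)) ` F \<union> (\<lambda>U. Sup (pr U)) ` F"
  have finX: "finite X" using fin by (simp add: X_def)
  obtain t0 where t0: "\<And>x. card (roots x) \<le> card (roots t0)"
    using ex_has_greatest_nat[of "\<lambda>_. True" 0 "\<lambda>x. card (roots x)" "Suc e"] card_roots_le by (auto simp: less_Suc_eq_le)
  define d where "d = card (roots t0)"
  have "d \<le> e" using card_roots_le by (simp add: d_def)
  have fin_exc: "finite {x. card (roots x) \<noteq> d}"
    using finite_exceptional_fibres[of t0 d] t0 by (simp add: d_def)
  have generic: "eventually (\<lambda>t. card (roots t) = d) (at \<alpha> within S)" for \<alpha> S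
  proof -
    have "eventually (\<lambda>t. \<forall>x\<in>{x. card (roots x) \<noteq> d}. t \<noteq> x) (at \<alpha> within S)"
      using fin_exc by (intro eventually_ball_finite ballI eventually_neq_at_within)
    then show ?thesis by eventually_elim auto
  qed
  obtain \<delta> where \<delta>: "\<delta> > 0" "\<And>\<alpha> \<beta>. \<alpha> \<in> X \<Longrightarrow> \<beta> \<in> X \<Longrightarrow> \<alpha> < \<beta> \<Longrightarrow> 2 * \<delta> \<le> \<beta> - \<alpha>"
  proof -
    obtain m where m: "m > 0" "\<And>\<alpha> \<beta>. \<alpha> \<in> X \<Longrightarrow> \<beta> \<in> X \<Longrightarrow> \<alpha> \<noteq> \<beta> \<Longrightarrow> m \<le> dist \<alpha> \<beta>"
      using finite_set_gap[OF finX] by blast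
    have "2 * (m / 2) \<le> \<beta> - \<alpha>" if "\<alpha> \<in> X" "\<beta> \<in> X" "\<alpha> < \<beta>" for \<alpha> \<beta>
      using m(2)[of \<alpha> \<beta>] that by (simp add: dist_real_def)
    then show ?thesis using that[of "m / 2"] m(1) by simp
  qed
  have "\<exists>r. \<alpha> < r \<and> r < \<alpha> + \<delta> \<and> card (roots r) = d \<and> card (FL \<alpha>) + nroots \<alpha> \<le> nroots r" for \<alpha>
  proof -
    have "eventually (\<lambda>r. \<alpha> < r \<and> r < \<alpha> + \<delta> \<and> card (roots r) = d \<and> card (FL \<alpha>) + nroots \<alpha> \<le> nroots r) (at_right \<alpha>)"
      using \<delta>(1) by (intro eventually_conj generic newL eventually_at_right_less eventually_at_rightI[of \<alpha> "\<alpha> + \<delta>"]) auto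
    then show ?thesis using eventually_happens'[OF trivial_limit_at_right_real] by blast
  qed
  then obtain r where r: "\<And>\<alpha>. \<alpha> < r \<alpha>" "\<And>\<alpha>. r \<alpha> < \<alpha> + \<delta>" "\<And>\<alpha>. card (roots (r \<alpha>)) = d"
     "\<And>\<alpha>. card (FL \<alpha>) + nroots \<alpha> \<le> nroots (r \<alpha>)" by metis
  have "\<exists>l. l < \<alpha> \<and> \<alpha> - \<delta> < l \<and> card (roots l) = d \<and> card (FR \<alpha>) + nroots \<alpha> \<le> nroots l" for \<alpha>
  proof -
    have "eventually (\<lambda>l. l < \<alpha> \<and> \<alpha> - \<delta> < l \<and> card (roots l) = d \<and> card (FR \<alpha>) + nroots \<alpha> \<le> nroots l) (at_left \<alpha>)"
      using \<delta>(1) by (intro eventually_conj generic newR eventually_at_leftI[of "\<alpha> - \<delta>" \<alpha>]) auto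
    then show ?thesis using eventually_happens'[OF trivial_limit_at_left_real] by blast
  qed
  then obtain l where l: "\<And>\<alpha>. l \<alpha> < \<alpha>" "\<And>\<alpha>. \<alpha> - \<delta> < l \<alpha>" "\<And>\<alpha>. card (roots (l \<alpha>)) = d"
     "\<And>\<alpha>. card (FR \<alpha>) + nroots \<alpha> \<le> nroots (l \<alpha>)" by metis
  have "(\<Sum>\<alpha>\<in>X. nroots (l \<alpha>) + nroots (r \<alpha>)) \<le> (\<Sum>\<alpha>\<in>X. 2 * nroots \<alpha>) + d * (d - 1)"
  proof (rule hermite_total[OF finX l(1) r(1) _ l(3) r(3)])
    fix \<alpha> \<beta> assume "\<alpha> \<in> X" "\<beta> \<in> X" "\<alpha> < \<beta>"
    then show "r \<alpha> \<le> l \<beta>" using \<delta>(2)[of \<alpha> \<beta>] r(2)[of \<alpha>] l(2)[of \<beta>] by simp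
  qed
  moreover have "(\<Sum>\<alpha>\<in>X. (card (FL \<alpha>) + card (FR \<alpha>)) + 2 * nroots \<alpha>) \<le> (\<Sum>\<alpha>\<in>X. nroots (l \<alpha>) + nroots (r \<alpha>))"
  proof (rule sum_mono)
    fix \<alpha> show "(card (FL \<alpha>) + card (FR \<alpha>)) + 2 * nroots \<alpha> \<le> nroots (l \<alpha>) + nroots (r \<alpha>)"
      using r(4)[of \<alpha>] l(4)[of \<alpha>] by simp
  qed
  ultimately have "(\<Sum>\<alpha>\<in>X. card (FL \<alpha>)) + (\<Sum>\<alpha>\<in>X. card (FR \<alpha>)) \<le> d * (d - 1)"
    by (simp add: sum.distrib)
  also have "\<dots> \<le> e * (e - 1)" using \<open>d \<le> e\<close> by (intro mult_mono) auto
  finally have sums: "(\<Sum>\<alpha>\<in>X. card (FL \<alpha>)) + (\<Sum>\<alpha>\<in>X. card (FR \<alpha>)) \<le> e * (e - 1)" .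
  have "card F \<le> card L + (\<Sum>\<alpha>\<in>X. card (FL \<alpha>))"
  proof -
    have "F \<subseteq> L \<union> (\<Union>\<alpha>\<in>X. FL \<alpha>)" by (auto simp: L_def FL_def X_def)
    then have "card F \<le> card (L \<union> (\<Union>\<alpha>\<in>X. FL \<alpha>))" using finL finX by (intro card_mono) auto
    also have "\<dots> \<le> card L + card (\<Union>\<alpha>\<in>X. FL \<alpha>)" by (rule card_Un_le)
    also have "card (\<Union>\<alpha>\<in>X. FL \<alpha>) \<le> (\<Sum>\<alpha>\<in>X. card (FL \<alpha>))" by (rule card_UN_le[OF finX])
    finally show ?thesis by simp
  qed
  moreover have "card F \<le> card R + (\<Sum>\<alpha>\<in>X. card (FR \<alpha>))"
  proof -
    have "F \<subseteq> R \<union> (\<Union>\<alpha>\<in>X. FR \<alpha>)" by (auto simp: R_def FR_def X_def)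
    then have "card F \<le> card (R \<union> (\<Union>\<alpha>\<in>X. FR \<alpha>))" using finL finX by (intro card_mono) auto
    also have "\<dots> \<le> card R + card (\<Union>\<alpha>\<in>X. FR \<alpha>)" by (rule card_Un_le)
    also have "card (\<Union>\<alpha>\<in>X. FR \<alpha>) \<le> (\<Sum>\<alpha>\<in>X. card (FR \<alpha>))" by (rule card_UN_le[OF finX])
    finally show ?thesis by simp
  qed
  moreover have "2 * n \<le> 2 * m + k" if "n \<le> p + a" "n \<le> q + b" "p \<le> m" "q \<le> m" "a + b \<le> k" for n m k p q a b :: nat
    using that by linarith
  ultimately show ?thesis using cardL cardR sums by blast
qed

end

section \<open>Components of the complement of a plane curve\<close>

definition poly_fun :: "nat \<Rightarrow> (nat \<Rightarrow> nat \<Rightarrow> real) \<Rightarrow> real \<times> real \<Rightarrow> real" where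
  "poly_fun k c = (\<lambda>(x,y). \<Sum>i\<le>k. \<Sum>j\<le>k - i. c i j * x ^ i * y ^ j)"

lemma components_homeomorphic_image:
  fixes f :: "'a::topological_space \<Rightarrow> 'b::topological_space"
  assumes f: "continuous_on UNIV f" and g: "continuous_on UNIV g"
    and fg: "\<And>x. g (f x) = x" "\<And>y. f (g y) = y" and C: "C \<in> components S"
  shows "f ` C \<in> components (f ` S)"
  unfolding in_components_maximal
proof (intro conjI allI impI)
  show "f ` C \<noteq> {}" using in_components_nonempty[OF C] by simp
  show "f ` C \<subseteq> f ` S" using in_components_subset[OF C] by blast
  show "connected (f ` C)"
    by (rule connected_continuous_image[OF continuous_on_subset[OF f] in_components_connected[OF C]]) simp
  fix D assume D: "D \<noteq> {} \<and> f ` C \<subseteq> D \<and> D \<subseteq> f ` S \<and> connected D"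
  have "connected (g ` D)" by (rule connected_continuous_image[OF continuous_on_subset[OF g]]) (use D in auto)
  moreover have "g ` D \<subseteq> S" using D fg by force
  moreover have "C \<subseteq> g ` D"
  proof
    fix x assume "x \<in> C"
    then have "f x \<in> D" using D by blast
    then show "x \<in> g ` D" using fg(1)[of x] by (metis imageI)
  qed
  ultimately have "g ` D = C" using C D unfolding in_components_maximal by auto
  then have "f ` C = f ` g ` D" by simp
  also have "\<dots> = D" by (simp add: image_image fg(2))
  finally show "D = f ` C" ..
qed

text \<open>
  The coefficient of \<open>y\<^sup>e\<close> after the substitution \<open>x + s y\<close> for \<open>x\<close> is the top homogeneous part evaluated at
  \<open>(s, 1)\<close>, a nonzero polynomial in \<open>s\<close>.
\<close>
lemma shear_monic:
  assumes top: "\<exists>i\<le>e. c i (e - i) \<noteq> 0"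
  shows "\<exists>s h A. h \<noteq> 0 \<and> monic_family e A \<and>
    (\<forall>x y. poly_fun e c (x + s * y, y) = h * (\<Sum>m\<le>e. poly (A m) x * y ^ m))"
proof -
  define H where "H = (\<Sum>i\<le>e. monom (c i (e - i)) i)"
  have "coeff H i = c i (e - i)" if "i \<le> e" for i using that by (simp add: H_def coeff_sum)
  then have "H \<noteq> 0" using top by (metis coeff_0)
  then obtain s where s: "poly H s \<noteq> 0" using poly_all_0_iff_0 by blast
  define h where "h = poly H s"
  define K where "K = (SIGMA i:{..e}. SIGMA j:{..e - i}. {..i})"
  define cf where "cf = (\<lambda>(i,j,l). c i j * of_nat (i choose l) * s ^ l)"
  define A where "A = (\<lambda>m. Polynomial.smult (1 / h) (\<Sum>p\<in>{p\<in>K. snd (snd p) + fst (snd p) = m}. monom (cf p) (fst p - snd (snd p))))"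
  have finK: "finite K" unfolding K_def by (intro finite_SigmaI) auto
  have Ke: "{p\<in>K. snd (snd p) + fst (snd p) = e} = (\<lambda>i. (i, e - i, i)) ` {..e}"
    by (auto simp: K_def image_iff)
  have lead: "A e = 1"
  proof -
    have "(\<Sum>p\<in>{p\<in>K. snd (snd p) + fst (snd p) = e}. monom (cf p) (fst p - snd (snd p))) = (\<Sum>i\<le>e. monom (c i (e - i) * s ^ i) 0)"
      unfolding Ke by (subst sum.reindex) (auto simp: inj_on_def cf_def)
    also have "\<dots> = [:h:]" by (simp add: h_def H_def poly_sum poly_monom monom_0 sum_to_poly flip: sum_to_poly)
    finally show ?thesis using s by (simp add: A_def h_def one_pCons)
  qed
  have "monic_family e A"
  proof
    show "degree (A j) \<le> e - j" if "j \<le> e" for j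
      unfolding A_def
      by (intro order_trans[OF degree_smult_le] degree_sum_le finite_subset[OF _ finK] order_trans[OF degree_monom_le])
         (auto simp: K_def)
  qed (rule lead)
  moreover have "poly_fun e c (x + s * y, y) = h * (\<Sum>m\<le>e. poly (A m) x * y ^ m)" for x y
  proof -
    define t where "t = (\<lambda>p. cf p * x ^ (fst p - snd (snd p)) * y ^ (snd (snd p) + fst (snd p)))"
    have "poly_fun e c (x + s * y, y) = (\<Sum>i\<le>e. \<Sum>j\<le>e - i. \<Sum>l\<le>i. t (i,j,l))"
      unfolding poly_fun_def prod.case
    proof (intro sum.cong refl)
      fix i j
      have "(x + s * y) ^ i = (\<Sum>l\<le>i. of_nat (i choose l) * (s * y) ^ l * x ^ (i - l))"
        by (subst add.commute) (rule binomial_ring)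
      then show "c i j * (x + s * y) ^ i * y ^ j = (\<Sum>l\<le>i. t (i,j,l))"
        by (simp add: t_def cf_def sum_distrib_left sum_distrib_right power_mult_distrib power_add mult_ac)
    qed
    also have "\<dots> = (\<Sum>p\<in>K. t p)"
    proof -
      have "(\<Sum>i\<le>e. \<Sum>j\<le>e - i. \<Sum>l\<le>i. t (i,j,l)) = (\<Sum>i\<le>e. \<Sum>q\<in>{..e - i} \<times> {..i}. t (i,q))"
        by (simp add: sum.cartesian_product case_prod_unfold)
      then show ?thesis unfolding K_def by (simp add: sum.Sigma case_prod_unfold)
    qed
    also have "\<dots> = (\<Sum>m\<le>e. \<Sum>p\<in>{p\<in>K. snd (snd p) + fst (snd p) = m}. t p)"
      by (rule sum.group[symmetric]) (use finK in \<open>auto simp: K_def\<close>)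
    also have "\<dots> = (\<Sum>m\<le>e. h * (poly (A m) x * y ^ m))"
      using s by (intro sum.cong refl) (auto simp: A_def h_def t_def poly_sum poly_monom sum_distrib_right intro!: sum.cong)
    finally show ?thesis by (simp add: sum_distrib_left)
  qed
  moreover have "h \<noteq> 0" using s by (simp add: h_def)
  ultimately show ?thesis by blast
qed

text \<open>
  If the polynomial vanishes identically there are no components at all; otherwise \<open>e\<close> below is its exact
  total degree, which the shear needs.
\<close>
theorem card_components_poly_fun:
  assumes fin: "finite F" and F: "F \<subseteq> components {p. poly_fun k c p \<noteq> 0}"
  shows "2 * card F \<le> 2 + k * (k + 1)"
proof (cases "\<exists>i j. i + j \<le> k \<and> c i j \<noteq> 0")
  case False
  then have "poly_fun k c p = 0" for p by (auto simp: poly_fun_def intro!: sum.neutral split: prod.splits)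
  then have "F = {}" using F by simp
  then show ?thesis by simp
next
  case True
  define I where "I = {n. n \<le> k \<and> (\<exists>i\<le>n. c i (n - i) \<noteq> 0)}"
  have "I \<noteq> {}" using True unfolding I_def
    by (metis (mono_tags, lifting) add_diff_cancel_left' empty_iff le_add1 mem_Collect_eq)
  define e where "e = Max I"
  have fI: "finite I" by (simp add: I_def)
  have e: "e \<in> I" using \<open>I \<noteq> {}\<close> fI by (simp add: e_def)
  have top: "n \<le> e" if "n \<in> I" for n using that fI by (simp add: e_def)
  have "e \<le> k" using e by (simp add: I_def)
  have f_eq: "poly_fun k c = poly_fun e c"
  proof
    fix p :: "real \<times> real" obtain x y where p: "p = (x,y)" by force
    have z: "c i j = 0" if "i + j \<le> k" "e < i + j" for i j
    proof (rule ccontr)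
      assume "c i j \<noteq> 0"
      then have "i + j \<in> I" using that by (auto simp: I_def intro!: exI[of _ i])
      then show False using top that by fastforce
    qed
    have inner: "(\<Sum>j\<le>k - i. c i j * x ^ i * y ^ j) = (if i \<le> e then \<Sum>j\<le>e - i. c i j * x ^ i * y ^ j else 0)" if "i \<le> k" for i
    proof (cases "i \<le> e")
      case True
      have "(\<Sum>j\<le>k - i. c i j * x ^ i * y ^ j) = (\<Sum>j\<le>e - i. c i j * x ^ i * y ^ j)"
      proof (rule sum.mono_neutral_right)
        show "\<forall>j\<in>{..k - i} - {..e - i}. c i j * x ^ i * y ^ j = 0"
        proof
          fix j assume "j \<in> {..k - i} - {..e - i}"
          then have "c i j = 0" using that by (intro z) auto
          then show "c i j * x ^ i * y ^ j = 0" by simp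
        qed
      qed (use \<open>e \<le> k\<close> in auto)
      then show ?thesis using True by simp
    next
      case False
      have "c i j = 0" if "j \<le> k - i" for j using that False \<open>i \<le> k\<close> by (intro z) auto
      then show ?thesis using False by simp
    qed
    have "poly_fun k c p = (\<Sum>i\<le>k. if i \<le> e then \<Sum>j\<le>e - i. c i j * x ^ i * y ^ j else 0)"
      unfolding poly_fun_def p prod.case by (intro sum.cong refl inner) auto
    also have "\<dots> = (\<Sum>i\<le>e. if i \<le> e then \<Sum>j\<le>e - i. c i j * x ^ i * y ^ j else 0)"
      using \<open>e \<le> k\<close> by (intro sum.mono_neutral_right) auto
    finally show "poly_fun k c p = poly_fun e c p" by (simp add: poly_fun_def p)
  qed
  have "\<exists>i\<le>e. c i (e - i) \<noteq> 0" using e by (simp add: I_def)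
  then obtain s h A where h: "h \<noteq> 0" and mf: "monic_family e A"
    and sh: "\<And>x y. poly_fun e c (x + s * y, y) = h * (\<Sum>m\<le>e. poly (A m) x * y ^ m)"
    using shear_monic by blast
  interpret monic_family e A by (rule mf)
  define \<psi> :: "real \<times> real \<Rightarrow> real \<times> real" where "\<psi> = (\<lambda>p. (fst p - s * snd p, snd p))"
  define \<phi> :: "real \<times> real \<Rightarrow> real \<times> real" where "\<phi> = (\<lambda>p. (fst p + s * snd p, snd p))"
  have inv: "\<phi> (\<psi> p) = p" "\<psi> (\<phi> p) = p" for p by (auto simp: \<phi>_def \<psi>_def)
  have cont: "continuous_on UNIV \<psi>" "continuous_on UNIV \<phi>"
    unfolding \<phi>_def \<psi>_def by (intro continuous_intros)+
  have reg: "\<psi> ` {p. poly_fun k c p \<noteq> 0} = region"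
  proof -
    have "poly_fun k c (\<phi> p) \<noteq> 0 \<longleftrightarrow> p \<in> region" for p
      unfolding f_eq using h sh[of "fst p" "snd p"] by (auto simp: \<phi>_def region_def fibre_value split: prod.splits)
    moreover have "p \<in> \<psi> ` {p. poly_fun k c p \<noteq> 0} \<longleftrightarrow> poly_fun k c (\<phi> p) \<noteq> 0" for p
    proof
      assume "poly_fun k c (\<phi> p) \<noteq> 0"
      then have "\<phi> p \<in> {p. poly_fun k c p \<noteq> 0}" by simp
      then have "\<psi> (\<phi> p) \<in> \<psi> ` {p. poly_fun k c p \<noteq> 0}" by (rule imageI)
      then show "p \<in> \<psi> ` {p. poly_fun k c p \<noteq> 0}" by (simp only: inv)
    qed (auto simp: inv)
    ultimately show ?thesis by blast
  qed
  have "(`) \<psi> ` F \<subseteq> components region"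
    using components_homeomorphic_image[OF cont, of _ "{p. poly_fun k c p \<noteq> 0}"] inv F reg by auto
  then have "2 * card ((`) \<psi> ` F) \<le> 2 * (e + 1) + e * (e - 1)"
    using fin by (intro card_components_finite) auto
  moreover have "card ((`) \<psi> ` F) = card F"
    by (intro card_image inj_on_image inj_on_inverseI[of _ \<phi>]) (simp add: inv)
  moreover have "2 * (e + 1) + e * (e - 1) = 2 + e * (e + 1)" by (cases e) auto
  moreover have "e * (e + 1) \<le> k * (k + 1)" using \<open>e \<le> k\<close> by (intro mult_mono) auto
  ultimately show ?thesis by linarith
qed

section \<open>Polynomials times Gaussians, and Green's identity\<close>

lemma Basis_real2: "(Basis :: (real \<times> real) set) = {(1,0),(0,1)}"
  by (auto simp: Basis_prod_def)

definition gauss_poly :: "real poly \<Rightarrow> real \<Rightarrow> real" where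
  "gauss_poly p x = poly p x * exp (- x\<^sup>2 / 2)"

definition gauss_deriv :: "real poly \<Rightarrow> real poly" where
  "gauss_deriv p = pderiv p - [:0, 1:] * p"

lemma gauss_poly_deriv: "(gauss_poly p has_real_derivative gauss_poly (gauss_deriv p) x) (at x)"
  unfolding gauss_poly_def [abs_def] gauss_deriv_def
  by (auto intro!: derivative_eq_intros simp: algebra_simps)

lemma continuous_gauss_poly: "continuous_on S (gauss_poly p)"
  unfolding gauss_poly_def by (auto intro!: continuous_intros)

definition gauss_prod :: "real poly \<Rightarrow> real poly \<Rightarrow> real \<times> real \<Rightarrow> real" where
  "gauss_prod p q z = gauss_poly p (fst z) * gauss_poly q (snd z)"

lemma has_derivative_gauss_prod:
  "(gauss_prod p q has_derivative (\<lambda>h. fst h * gauss_prod (gauss_deriv p) q z + snd h * gauss_prod p (gauss_deriv q) z)) (at z)"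
proof -
  have p: "((\<lambda>z. gauss_poly p (fst z)) has_derivative (\<lambda>h. gauss_poly (gauss_deriv p) (fst z) * fst h)) (at z)"
    using has_derivative_compose[OF has_derivative_fst[OF has_derivative_ident], of "gauss_poly p" "(*) (gauss_poly (gauss_deriv p) (fst z))" z UNIV]
      gauss_poly_deriv[of p "fst z"] by (simp add: has_field_derivative_def)
  have q: "((\<lambda>z. gauss_poly q (snd z)) has_derivative (\<lambda>h. gauss_poly (gauss_deriv q) (snd z) * snd h)) (at z)"
    using has_derivative_compose[OF has_derivative_snd[OF has_derivative_ident], of "gauss_poly q" "(*) (gauss_poly (gauss_deriv q) (snd z))" z UNIV]
      gauss_poly_deriv[of q "snd z"] by (simp add: has_field_derivative_def)
  show ?thesis
    unfolding gauss_prod_def [abs_def]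
    by (rule has_derivative_eq_rhs[OF has_derivative_mult[OF p q]]) (auto simp: algebra_simps)
qed

lemma continuous_gauss_prod: "continuous_on S (gauss_prod p q)"
  by (rule continuous_at_imp_continuous_on) (auto intro: has_derivative_continuous has_derivative_gauss_prod)

lemma partial_derivI: "(u has_derivative D) (at z) \<Longrightarrow> partial_deriv u b z = D b"
  unfolding partial_deriv_def by (metis frechet_derivative_at)

lemma partial_gauss_prod:
  "partial_deriv (gauss_prod p q) (1,0) = gauss_prod (gauss_deriv p) q"
  "partial_deriv (gauss_prod p q) (0,1) = gauss_prod p (gauss_deriv q)"
  by (auto simp: fun_eq_iff partial_derivI[OF has_derivative_gauss_prod])

lemma C1_gauss_prod: "C1 (gauss_prod p q)"
  unfolding C1_def Basis_real2 using has_derivative_gauss_prod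
  by (auto simp: partial_gauss_prod continuous_gauss_prod differentiable_on_def intro!: differentiableI)

lemma C2_gauss_prod: "C2 (gauss_prod p q)"
  unfolding C2_def Basis_real2 by (auto simp: partial_gauss_prod C1_gauss_prod)

lemma partial_x:
  assumes "C1 u"
  shows "((\<lambda>x. u (x, y)) has_real_derivative partial_deriv u (1,0) (x, y)) (at x)"
proof -
  let ?D = "frechet_derivative u (at (x,y))"
  have D: "(u has_derivative ?D) (at (x,y))"
    using assms unfolding C1_def differentiable_on_def by (simp add: frechet_derivative_works)
  have "((\<lambda>x. u (x, y)) has_derivative (\<lambda>h. ?D (h, 0))) (at x)"
    by (rule has_derivative_compose[where f = "\<lambda>x. (x, y)" and g = u]) (auto intro!: derivative_eq_intros D)
  moreover have "?D (h, 0) = partial_deriv u (1,0) (x,y) * h" for h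
    using linear_scale[OF has_derivative_linear[OF D], of h "(1,0)"] by (simp add: partial_deriv_def)
  ultimately show ?thesis by (simp add: has_field_derivative_def)
qed

lemma partial_y:
  assumes "C1 u"
  shows "((\<lambda>y. u (x, y)) has_real_derivative partial_deriv u (0,1) (x, y)) (at y)"
proof -
  let ?D = "frechet_derivative u (at (x,y))"
  have D: "(u has_derivative ?D) (at (x,y))"
    using assms unfolding C1_def differentiable_on_def by (simp add: frechet_derivative_works)
  have "((\<lambda>y. u (x, y)) has_derivative (\<lambda>h. ?D (0, h))) (at y)"
    by (rule has_derivative_compose[where f = "\<lambda>y. (x, y)" and g = u]) (auto intro!: derivative_eq_intros D)
  moreover have "?D (0, h) = partial_deriv u (0,1) (x,y) * h" for h
    using linear_scale[OF has_derivative_linear[OF D], of h "(0,1)"] by (simp add: partial_deriv_def)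
  ultimately show ?thesis by (simp add: has_field_derivative_def)
qed

lemma C1_continuous: "C1 u \<Longrightarrow> continuous_on S u"
  unfolding C1_def using differentiable_imp_continuous_on continuous_on_subset by blast

text \<open>
  No boundary term survives because the test function and its derivative vanish at both ends.
\<close>
lemma green_interval:
  fixes v v' v'' \<phi> \<phi>' \<phi>'' :: "real \<Rightarrow> real"
  assumes "a \<le> b"
    and "\<And>x. (v has_real_derivative v' x) (at x)" "\<And>x. (v' has_real_derivative v'' x) (at x)"
    and "\<And>x. (\<phi> has_real_derivative \<phi>' x) (at x)" "\<And>x. (\<phi>' has_real_derivative \<phi>'' x) (at x)"
    and "\<phi> a = 0" "\<phi> b = 0" "\<phi>' a = 0" "\<phi>' b = 0"
  shows "((\<lambda>x. v'' x * \<phi> x - v x * \<phi>'' x) has_integral 0) {a..b}"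
proof -
  have "((\<lambda>x. v'' x * \<phi> x - v x * \<phi>'' x) has_integral (v' b * \<phi> b - v b * \<phi>' b) - (v' a * \<phi> a - v a * \<phi>' a)) {a..b}"
  proof (rule fundamental_theorem_of_calculus[OF assms(1)])
    fix x
    have "((\<lambda>x. v' x * \<phi> x - v x * \<phi>' x) has_real_derivative v'' x * \<phi> x - v x * \<phi>'' x) (at x)"
      by (rule derivative_eq_intros assms(2-5) refl)+ simp
    then show "((\<lambda>x. v' x * \<phi> x - v x * \<phi>' x) has_vector_derivative v'' x * \<phi> x - v x * \<phi>'' x) (at x within {a..b})"
      by (simp add: has_real_derivative_iff_has_vector_derivative has_vector_derivative_at_within)
  qed
  then show ?thesis using assms by simp
qed

lemma green_box:
  fixes \<phi> \<phi>' \<phi>'' \<chi> \<chi>' \<chi>'' :: "real \<Rightarrow> real"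
  assumes u: "C2 u" and R: "R \<ge> 0"
    and \<phi>: "\<And>x. (\<phi> has_real_derivative \<phi>' x) (at x)" "\<And>x. (\<phi>' has_real_derivative \<phi>'' x) (at x)" "continuous_on UNIV \<phi>''"
    and \<phi>0: "\<phi> (-R) = 0" "\<phi> R = 0" "\<phi>' (-R) = 0" "\<phi>' R = 0"
    and \<chi>: "\<And>x. (\<chi> has_real_derivative \<chi>' x) (at x)" "\<And>x. (\<chi>' has_real_derivative \<chi>'' x) (at x)" "continuous_on UNIV \<chi>''"
    and \<chi>0: "\<chi> (-R) = 0" "\<chi> R = 0" "\<chi>' (-R) = 0" "\<chi>' R = 0"
  shows "integral (cbox (-R,-R) (R,R)) (\<lambda>z. laplacian u z * (\<phi> (fst z) * \<chi> (snd z)) - u z * (\<phi>'' (fst z) * \<chi> (snd z) + \<phi> (fst z) * \<chi>'' (snd z))) = 0"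
proof -
  let ?ux = "partial_deriv u (1,0)" and ?uy = "partial_deriv u (0,1)"
  let ?uxx = "partial_deriv ?ux (1,0)" and ?uyy = "partial_deriv ?uy (0,1)"
  have C1: "C1 u" "C1 ?ux" "C1 ?uy" using u by (auto simp: C2_def Basis_real2)
  have cu: "continuous_on UNIV u" "continuous_on UNIV ?uxx" "continuous_on UNIV ?uyy"
    using C1_continuous[OF C1(1)] C1(2,3) unfolding C1_def Basis_real2 by blast+
  have c\<phi>: "continuous_on UNIV \<phi>" "continuous_on UNIV \<chi>"
    by (auto intro!: continuous_at_imp_continuous_on DERIV_isCont[OF \<phi>(1)] DERIV_isCont[OF \<chi>(1)])
  have comp: "continuous_on UNIV (\<lambda>z::real\<times>real. f (fst z))" "continuous_on UNIV (\<lambda>z::real\<times>real. f (snd z))"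
    if "continuous_on UNIV f" for f :: "real \<Rightarrow> real"
    using continuous_on_compose2[OF that continuous_on_fst[OF continuous_on_id]] continuous_on_compose2[OF that continuous_on_snd[OF continuous_on_id]] by auto
  note cs = comp[OF c\<phi>(1)] comp[OF c\<phi>(2)] comp[OF \<phi>(3)] comp[OF \<chi>(3)] cu
  define F1 where "F1 = (\<lambda>z. (?uxx z * \<phi> (fst z) - u z * \<phi>'' (fst z)) * \<chi> (snd z))"
  define F2 where "F2 = (\<lambda>z. (?uyy z * \<chi> (snd z) - u z * \<chi>'' (snd z)) * \<phi> (fst z))"
  have cF: "continuous_on UNIV F1" "continuous_on UNIV F2"
    unfolding F1_def F2_def by (intro continuous_intros cs)+
  have cF': "continuous_on (cbox (-R,-R) (R,R)) F1" "continuous_on (cbox (-R,-R) (R,R)) F2"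
    using cF continuous_on_subset by blast+
  have "integral (cbox (-R,-R) (R,R)) F1 = 0"
  proof -
    have "integral (cbox (-R,-R) (R,R)) F1 = integral (cbox (-R) R) (\<lambda>x. integral (cbox (-R) R) (\<lambda>y. F1 (x, y)))"
      by (rule integral_prod_continuous[OF cF'(1)])
    also have "\<dots> = integral (cbox (-R) R) (\<lambda>y. integral (cbox (-R) R) (\<lambda>x. F1 (x, y)))"
      using cF'(1) by (intro integral_swap_continuous) (simp add: case_prod_unfold)
    also have "\<dots> = 0"
    proof -
      have "integral (cbox (-R) R) (\<lambda>x. F1 (x, y)) = 0" for y
      proof -
        have "((\<lambda>x. ?uxx (x,y) * \<phi> x - u (x,y) * \<phi>'' x) has_integral 0) {-R..R}"
          by (rule green_interval[where v' = "\<lambda>x. ?ux (x,y)" and \<phi>' = \<phi>']) (use R \<phi> \<phi>0 partial_x C1 in auto)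
        from has_integral_mult_left[OF this, of "\<chi> y"] show ?thesis
          by (simp add: F1_def integral_unique del: integral_mult_left)
      qed
      then show ?thesis by simp
    qed
    finally show ?thesis .
  qed
  moreover have "integral (cbox (-R,-R) (R,R)) F2 = 0"
  proof -
    have "integral (cbox (-R,-R) (R,R)) F2 = integral (cbox (-R) R) (\<lambda>x. integral (cbox (-R) R) (\<lambda>y. F2 (x, y)))"
      by (rule integral_prod_continuous[OF cF'(2)])
    also have "\<dots> = 0"
    proof -
      have "integral (cbox (-R) R) (\<lambda>y. F2 (x, y)) = 0" for x
      proof -
        have "((\<lambda>y. ?uyy (x,y) * \<chi> y - u (x,y) * \<chi>'' y) has_integral 0) {-R..R}"
          by (rule green_interval[where v' = "\<lambda>y. ?uy (x,y)" and \<phi>' = \<chi>']) (use R \<chi> \<chi>0 partial_y C1 in auto)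
        from has_integral_mult_left[OF this, of "\<phi> x"] show ?thesis
          by (simp add: F2_def integral_unique del: integral_mult_left)
      qed
      then show ?thesis by simp
    qed
    finally show ?thesis .
  qed
  moreover have "(\<lambda>z. laplacian u z * (\<phi> (fst z) * \<chi> (snd z)) - u z * (\<phi>'' (fst z) * \<chi> (snd z) + \<phi> (fst z) * \<chi>'' (snd z))) = (\<lambda>z. F1 z + F2 z)"
    by (auto simp: fun_eq_iff F1_def F2_def laplacian_def Basis_real2 algebra_simps)
  ultimately show ?thesis
    using integral_add[OF integrable_continuous[OF cF'(1)] integrable_continuous[OF cF'(2)]] by simp
qed

section \<open>Moments\<close>

lemma poly_le_exp:
  fixes p :: "real poly"
  assumes "s > 0"
  shows "\<exists>C\<ge>0. \<forall>x. \<bar>poly p x\<bar> \<le> C * exp (s * \<bar>x\<bar>)"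
  using assms
proof (induction p arbitrary: s)
  case 0
  then show ?case by auto
next
  case (pCons a p)
  obtain C where C: "C \<ge> 0" "\<And>x. \<bar>poly p x\<bar> \<le> C * exp (s/2 * \<bar>x\<bar>)"
    using pCons.IH[of "s/2"] pCons.prems by auto
  have "\<bar>poly (pCons a p) x\<bar> \<le> (\<bar>a\<bar> + 2/s * C) * exp (s * \<bar>x\<bar>)" for x
  proof -
    have "s/2 * \<bar>x\<bar> \<le> exp (s/2 * \<bar>x\<bar>)"
      using exp_ge_add_one_self[of "s/2 * \<bar>x\<bar>"] by linarith
    then have x: "\<bar>x\<bar> \<le> 2/s * exp (s/2 * \<bar>x\<bar>)" using pCons.prems by (simp add: field_simps)
    have "\<bar>x * poly p x\<bar> \<le> (2/s * exp (s/2 * \<bar>x\<bar>)) * (C * exp (s/2 * \<bar>x\<bar>))"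
      unfolding abs_mult using x C pCons.prems by (intro mult_mono) auto
    also have "\<dots> = 2/s * C * exp (s * \<bar>x\<bar>)" by (simp add: mult_exp_exp)
    finally have 1: "\<bar>x * poly p x\<bar> \<le> 2/s * C * exp (s * \<bar>x\<bar>)" .
    have "\<bar>a\<bar> * 1 \<le> \<bar>a\<bar> * exp (s * \<bar>x\<bar>)" using pCons.prems by (intro mult_left_mono) auto
    then show ?thesis using 1 abs_triangle_ineq[of a "x * poly p x"] by (simp add: algebra_simps)
  qed
  moreover have "\<bar>a\<bar> + 2/s * C \<ge> 0" using C pCons.prems by simp
  ultimately show ?case by blast
qed

lemma gauss_poly_exp_bound:
  "\<exists>C\<ge>0. \<forall>x. \<bar>gauss_poly p x\<bar> * exp (c * \<bar>x\<bar>) \<le> C * exp (- x\<^sup>2 / 4)"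
proof -
  obtain C where C: "C \<ge> 0" "\<And>x. \<bar>poly p x\<bar> \<le> C * exp (1 * \<bar>x\<bar>)" using poly_le_exp[of 1 p] by auto
  have "\<bar>gauss_poly p x\<bar> * exp (c * \<bar>x\<bar>) \<le> (C * exp ((c + 1)\<^sup>2)) * exp (- x\<^sup>2 / 4)" for x
  proof -
    have "0 \<le> (\<bar>x\<bar> / 2 - (c + 1))\<^sup>2" by simp
    then have "(c + 1) * \<bar>x\<bar> - x\<^sup>2 / 2 \<le> (c + 1)\<^sup>2 - x\<^sup>2 / 4"
      by (simp add: power2_diff power_divide) (simp add: algebra_simps)
    then have *: "exp ((c + 1) * \<bar>x\<bar> - x\<^sup>2 / 2) \<le> exp ((c + 1)\<^sup>2 - x\<^sup>2 / 4)" by simp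
    have "\<bar>gauss_poly p x\<bar> * exp (c * \<bar>x\<bar>) = \<bar>poly p x\<bar> * exp (c * \<bar>x\<bar> - x\<^sup>2 / 2)"
      by (simp add: gauss_poly_def abs_mult mult_exp_exp algebra_simps)
    also have "\<dots> \<le> (C * exp (1 * \<bar>x\<bar>)) * exp (c * \<bar>x\<bar> - x\<^sup>2 / 2)"
      using C by (intro mult_right_mono) auto
    also have "\<dots> = C * exp ((c + 1) * \<bar>x\<bar> - x\<^sup>2 / 2)" by (simp add: mult_exp_exp algebra_simps)
    also have "\<dots> \<le> C * exp ((c + 1)\<^sup>2 - x\<^sup>2 / 4)" using * C by (intro mult_left_mono) auto
    also have "\<dots> = (C * exp ((c + 1)\<^sup>2)) * exp (- x\<^sup>2 / 4)" by (simp add: mult_exp_exp)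
    finally show ?thesis .
  qed
  moreover have "C * exp ((c + 1)\<^sup>2) \<ge> 0" using C by simp
  ultimately show ?thesis by blast
qed

text \<open>
  A Gaussian of twice the variance dominates every polynomial times the original Gaussian, even with
  an exponential factor thrown in; being square integrable, it makes the product with any square
  integrable function integrable.
\<close>
definition wide_gauss :: "real \<times> real \<Rightarrow> real" where
  "wide_gauss z = exp (- (fst z)\<^sup>2 / 4) * exp (- (snd z)\<^sup>2 / 4)"

lemma gauss_prod_exp_bound:
  "\<exists>C\<ge>0. \<forall>z. \<bar>gauss_prod p q z\<bar> * exp (c * \<bar>fst z\<bar> + d * \<bar>snd z\<bar>) \<le> C * wide_gauss z"
proof -
  obtain C D where C: "C \<ge> 0" "\<And>x. \<bar>gauss_poly p x\<bar> * exp (c * \<bar>x\<bar>) \<le> C * exp (- x\<^sup>2 / 4)"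
    and D: "D \<ge> 0" "\<And>x. \<bar>gauss_poly q x\<bar> * exp (d * \<bar>x\<bar>) \<le> D * exp (- x\<^sup>2 / 4)"
    using gauss_poly_exp_bound[of p c] gauss_poly_exp_bound[of q d] by auto
  have "\<bar>gauss_prod p q z\<bar> * exp (c * \<bar>fst z\<bar> + d * \<bar>snd z\<bar>) \<le> (C * D) * wide_gauss z" for z
  proof -
    have "\<bar>gauss_prod p q z\<bar> * exp (c * \<bar>fst z\<bar> + d * \<bar>snd z\<bar>) =
      (\<bar>gauss_poly p (fst z)\<bar> * exp (c * \<bar>fst z\<bar>)) * (\<bar>gauss_poly q (snd z)\<bar> * exp (d * \<bar>snd z\<bar>))"
      by (simp add: gauss_prod_def abs_mult exp_add)
    also have "\<dots> \<le> (C * exp (- (fst z)\<^sup>2 / 4)) * (D * exp (- (snd z)\<^sup>2 / 4))"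
      by (rule mult_mono[OF C(2) D(2)]) (use C(1) in auto)
    finally show ?thesis by (simp add: wide_gauss_def mult_ac)
  qed
  then show ?thesis using C D by (intro exI[of _ "C * D"]) auto
qed

lemma gauss_prod_bound: "\<exists>C\<ge>0. \<forall>z. \<bar>gauss_prod p q z\<bar> \<le> C * wide_gauss z"
  using gauss_prod_exp_bound[of p q 0 0] by simp

lemma integrable_exp_sq: "integrable lborel (\<lambda>x::real. exp (- x\<^sup>2 / 2))"
proof -
  have "integrable lborel (\<lambda>x. sqrt (2 * pi) * (std_normal_density x * x ^ 0))"
    by (intro integrable_mult_right integrable_std_normal_moment)
  then show ?thesis by (simp add: std_normal_density_def)
qed

lemma integrable_wide_gauss_sq: "integrable lborel (\<lambda>z. (wide_gauss z)\<^sup>2)"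
proof -
  have "integrable (lborel \<Otimes>\<^sub>M lborel) (\<lambda>z::real\<times>real. exp (- (fst z)\<^sup>2 / 2) * exp (- (snd z)\<^sup>2 / 2))"
  proof (rule lborel_pair.Fubini_integrable)
    show "integrable lborel (\<lambda>x::real. \<integral>y. norm (exp (- (fst (x,y))\<^sup>2 / 2) * exp (- (snd (x,y::real))\<^sup>2 / 2)) \<partial>lborel)"
      using integrable_exp_sq by simp
    show "AE x in lborel. integrable lborel (\<lambda>y::real. exp (- (fst (x::real,y))\<^sup>2 / 2) * exp (- (snd (x,y))\<^sup>2 / 2))"
      using integrable_exp_sq by simp
  qed measurable
  moreover have "(\<lambda>z. (wide_gauss z)\<^sup>2) = (\<lambda>z. exp (- (fst z)\<^sup>2 / 2) * exp (- (snd z)\<^sup>2 / 2))"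
    by (auto simp: fun_eq_iff wide_gauss_def power_mult_distrib exp_double[symmetric])
  ultimately show ?thesis by (simp add: lborel_prod)
qed

lemma integrable_dominated:
  fixes u g :: "real \<times> real \<Rightarrow> real"
  assumes u: "continuous_on UNIV u" "integrable lborel (\<lambda>z. (u z)\<^sup>2)" and g: "g \<in> borel_measurable borel"
    and bound: "\<And>z. \<bar>g z\<bar> \<le> C * (\<bar>u z\<bar> * wide_gauss z)" and "C \<ge> 0"
  shows "integrable lborel g"
proof (rule Bochner_Integration.integrable_bound)
  show "integrable lborel (\<lambda>z. C * ((u z)\<^sup>2 + (wide_gauss z)\<^sup>2))"
    using u integrable_wide_gauss_sq by (intro integrable_mult_right Bochner_Integration.integrable_add)
  show "g \<in> borel_measurable lborel" using g by simp
  have "\<bar>u z\<bar> * wide_gauss z \<le> (u z)\<^sup>2 + (wide_gauss z)\<^sup>2" for z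
  proof -
    have "0 \<le> \<bar>u z\<bar> * wide_gauss z" by (simp add: wide_gauss_def)
    moreover have "2 * (\<bar>u z\<bar> * wide_gauss z) \<le> (u z)\<^sup>2 + (wide_gauss z)\<^sup>2"
      using sum_squares_bound[of "\<bar>u z\<bar>" "wide_gauss z"] by (simp add: mult.assoc)
    ultimately show ?thesis by linarith
  qed
  then show "AE z in lborel. norm (g z) \<le> norm (C * ((u z)\<^sup>2 + (wide_gauss z)\<^sup>2))"
    using order_trans[OF bound mult_left_mono[OF _ \<open>C \<ge> 0\<close>]] \<open>C \<ge> 0\<close> by (intro AE_I2) simp
qed

definition moment :: "(real \<times> real \<Rightarrow> real) \<Rightarrow> real poly \<Rightarrow> real poly \<Rightarrow> real" where
  "moment u p q = (\<integral>z. u z * gauss_prod p q z \<partial>lborel)"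

lemma borel_measurable_gauss_prod [measurable]: "gauss_prod p q \<in> borel_measurable borel"
  using continuous_gauss_prod by (rule borel_measurable_continuous_onI)

lemma integrable_moment:
  assumes u: "continuous_on UNIV u" "integrable lborel (\<lambda>z. (u z)\<^sup>2)"
  shows "integrable lborel (\<lambda>z. u z * gauss_prod p q z)"
proof -
  have [measurable]: "u \<in> borel_measurable borel" using u(1) by (rule borel_measurable_continuous_onI)
  obtain C where C: "C \<ge> 0" "\<And>z. \<bar>gauss_prod p q z\<bar> \<le> C * wide_gauss z" using gauss_prod_bound by blast
  have "\<bar>u z * gauss_prod p q z\<bar> \<le> C * (\<bar>u z\<bar> * wide_gauss z)" for z
    using mult_left_mono[OF C(2)[of z], of "\<bar>u z\<bar>"] by (simp add: abs_mult mult_ac)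
  then show ?thesis by (intro integrable_dominated[OF u _ _ C(1)]) auto
qed

lemma gauss_poly_mult_sq: "x\<^sup>2 * gauss_poly p x = gauss_poly ([:0,0,1:] * p) x"
  by (simp add: gauss_poly_def power2_eq_square)

lemma gauss_poly_four_bounds:
  "\<exists>K\<ge>0. \<forall>x. \<bar>gauss_poly p x\<bar> \<le> K * exp (- x\<^sup>2 / 4) \<and> \<bar>gauss_poly (gauss_deriv p) x\<bar> \<le> K * exp (- x\<^sup>2 / 4) \<and>
     \<bar>gauss_poly (gauss_deriv (gauss_deriv p)) x\<bar> \<le> K * exp (- x\<^sup>2 / 4) \<and> \<bar>x\<^sup>2 * gauss_poly p x\<bar> \<le> K * exp (- x\<^sup>2 / 4)"
proof -
  have *: "\<exists>C\<ge>0. \<forall>x. \<bar>gauss_poly p x\<bar> \<le> C * exp (- x\<^sup>2 / 4)" for p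
    using gauss_poly_exp_bound[of p 0] by simp
  obtain C1 C2 C3 C4 where C: "C1 \<ge> 0" "C2 \<ge> 0" "C3 \<ge> 0" "C4 \<ge> 0"
    "\<And>x. \<bar>gauss_poly p x\<bar> \<le> C1 * exp (- x\<^sup>2 / 4)" "\<And>x. \<bar>gauss_poly (gauss_deriv p) x\<bar> \<le> C2 * exp (- x\<^sup>2 / 4)"
    "\<And>x. \<bar>gauss_poly (gauss_deriv (gauss_deriv p)) x\<bar> \<le> C3 * exp (- x\<^sup>2 / 4)" "\<And>x. \<bar>gauss_poly ([:0,0,1:] * p) x\<bar> \<le> C4 * exp (- x\<^sup>2 / 4)"
    using * by metis
  let ?K = "C1 + C2 + C3 + C4"
  have "C * exp (- x\<^sup>2 / 4) \<le> ?K * exp (- x\<^sup>2 / 4)" if "C \<in> {C1,C2,C3,C4}" for C and x :: real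
    using that C(1-4) by (intro mult_right_mono) auto
  then have le: "y \<le> ?K * exp (- x\<^sup>2 / 4)" if "y \<le> C * exp (- x\<^sup>2 / 4)" "C \<in> {C1,C2,C3,C4}" for y C and x :: real
    using that order_trans by blast
  show ?thesis
    unfolding gauss_poly_mult_sq
    using C(1-4) by (intro exI[of _ ?K] conjI allI le[OF C(5)] le[OF C(6)] le[OF C(7)] le[OF C(8)]) auto
qed

section \<open>The eigenvalue equation tested against Gaussians\<close>

text \<open>
  The cutoff has double zeros at \<open>x = R\<close> and \<open>x = - R\<close>. The other two functions are its derivatives.
\<close>
definition cutoff :: "real \<Rightarrow> real \<Rightarrow> real" where
  "cutoff R x = (1 - x\<^sup>2 / R\<^sup>2)\<^sup>2"
definition cutoff1 :: "real \<Rightarrow> real \<Rightarrow> real" where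
  "cutoff1 R x = - (4 * x / R\<^sup>2) * (1 - x\<^sup>2 / R\<^sup>2)"
definition cutoff2 :: "real \<Rightarrow> real \<Rightarrow> real" where
  "cutoff2 R x = - (4 / R\<^sup>2) * (1 - x\<^sup>2 / R\<^sup>2) + 8 * x\<^sup>2 / R\<^sup>2 / R\<^sup>2"

lemma cutoff_derivs:
  "(cutoff R has_real_derivative cutoff1 R x) (at x)" "(cutoff1 R has_real_derivative cutoff2 R x) (at x)"
proof -
  define c where "c = 1 / R\<^sup>2"
  have 0: "cutoff R = (\<lambda>x. (1 - c * x\<^sup>2)\<^sup>2)" "cutoff1 R = (\<lambda>x. - (4 * c * x) * (1 - c * x\<^sup>2))"
    "cutoff2 R = (\<lambda>x. - (4 * c) * (1 - c * x\<^sup>2) + 8 * c * c * x\<^sup>2)"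
    by (auto simp: fun_eq_iff cutoff_def cutoff1_def cutoff2_def c_def)
  show "(cutoff R has_real_derivative cutoff1 R x) (at x)"
    unfolding 0 by (auto intro!: derivative_eq_intros)
  show "(cutoff1 R has_real_derivative cutoff2 R x) (at x)"
    unfolding 0 by (auto intro!: derivative_eq_intros simp: algebra_simps power2_eq_square)
qed

lemma cutoff_bounds:
  assumes "R \<ge> 1" "\<bar>x\<bar> \<le> R"
  shows "\<bar>cutoff R x\<bar> \<le> 1" "\<bar>cutoff1 R x\<bar> \<le> 4" "\<bar>cutoff2 R x\<bar> \<le> 12"
proof -
  define s where "s = x\<^sup>2 / R\<^sup>2"
  have "x\<^sup>2 \<le> R\<^sup>2" using assms by (metis abs_le_square_iff abs_of_nonneg order_trans zero_le_one)
  then have s: "0 \<le> s" "s \<le> 1" using assms by (auto simp: s_def field_simps)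
  have R2: "1 \<le> R\<^sup>2" using assms(1) by simp
  have x: "\<bar>x\<bar> / R\<^sup>2 \<le> 1" using assms R2 by (simp add: power2_eq_square field_simps) (metis mult_left_mono mult_cancel_left2 order_trans zero_le_one abs_ge_zero mult.commute)
  have c: "0 \<le> 1 / R\<^sup>2" "1 / R\<^sup>2 \<le> 1" using R2 by (auto simp: divide_le_eq)
  show "\<bar>cutoff R x\<bar> \<le> 1" using s by (simp add: cutoff_def s_def[symmetric] abs_square_le_1)
  have "\<bar>cutoff1 R x\<bar> = 4 * (\<bar>x\<bar> / R\<^sup>2) * (1 - s)"
    using s by (simp add: cutoff1_def s_def[symmetric] abs_mult)
  also have "\<dots> \<le> 4 * 1 * 1" using x s by (intro mult_mono) auto
  finally show "\<bar>cutoff1 R x\<bar> \<le> 4" by simp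
  have "cutoff2 R x = (1 / R\<^sup>2) * (12 * s - 4)"
    by (simp add: cutoff2_def s_def algebra_simps)
  moreover have "\<bar>(1 / R\<^sup>2) * (12 * s - 4)\<bar> \<le> 1 * 12"
    unfolding abs_mult using c s by (intro mult_mono) auto
  ultimately show "\<bar>cutoff2 R x\<bar> \<le> 12" by simp
qed

lemma cutoff_boundary:
  assumes "R \<noteq> 0"
  shows "cutoff R R = 0" "cutoff R (-R) = 0" "cutoff1 R R = 0" "cutoff1 R (-R) = 0"
  using assms by (auto simp: cutoff_def cutoff1_def)

lemma cutoff_tendsto:
  "(\<lambda>n. cutoff (real (Suc n)) x) \<longlonglongrightarrow> 1" "(\<lambda>n. cutoff1 (real (Suc n)) x) \<longlonglongrightarrow> 0" "(\<lambda>n. cutoff2 (real (Suc n)) x) \<longlonglongrightarrow> 0"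
proof -
  have c: "(\<lambda>n. inverse (real (Suc n))) \<longlonglongrightarrow> 0" by (rule LIMSEQ_inverse_real_of_nat)
  have 0: "cutoff R x = (1 - (inverse R)\<^sup>2 * x\<^sup>2)\<^sup>2" "cutoff1 R x = - (4 * (inverse R)\<^sup>2 * x) * (1 - (inverse R)\<^sup>2 * x\<^sup>2)"
    "cutoff2 R x = - (4 * (inverse R)\<^sup>2) * (1 - (inverse R)\<^sup>2 * x\<^sup>2) + 8 * (inverse R)\<^sup>2 * (inverse R)\<^sup>2 * x\<^sup>2" for R
    by (auto simp: cutoff_def cutoff1_def cutoff2_def field_simps)
  show "(\<lambda>n. cutoff (real (Suc n)) x) \<longlonglongrightarrow> 1" unfolding 0 by (rule tendsto_eq_intros c | simp)+
  show "(\<lambda>n. cutoff1 (real (Suc n)) x) \<longlonglongrightarrow> 0" unfolding 0 by (rule tendsto_eq_intros c | simp)+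
  show "(\<lambda>n. cutoff2 (real (Suc n)) x) \<longlonglongrightarrow> 0" unfolding 0 by (rule tendsto_eq_intros c | simp)+
qed

lemma eigenspace_laplacian:
  assumes "u \<in> eigenspace \<mu>"
  shows "laplacian u z = ((fst z)\<^sup>2 + (snd z)\<^sup>2 - \<mu>) * u z"
proof -
  have "oscillator u = (\<lambda>p. \<mu> * u p)" using assms unfolding eigenspace_def by blast
  then have "oscillator u z = \<mu> * u z" by (rule fun_cong)
  then show ?thesis by (cases z) (simp add: oscillator_def algebra_simps)
qed

lemma eigenspaceD:
  assumes "u \<in> eigenspace \<mu>"
  shows "C2 u" "continuous_on UNIV u" "integrable lborel (\<lambda>z. (u z)\<^sup>2)"
  using assms C1_continuous by (auto simp: eigenspace_def C2_def)

text \<open>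
  Green's identity on the square of side \<open>2R\<close> is applied to \<open>u\<close> and the test function times a
  cutoff with double zeros on the boundary, so no boundary term ever appears and nothing has to be
  known about the decay of \<open>u\<close> or its gradient beyond square integrability.
\<close>
lemma weak_eigenvalue_equation:
  assumes u: "u \<in> eigenspace \<mu>"
  shows "(\<integral>z. u z * (((fst z)\<^sup>2 + (snd z)\<^sup>2 - \<mu>) * gauss_prod p q z
     - gauss_prod (gauss_deriv (gauss_deriv p)) q z - gauss_prod p (gauss_deriv (gauss_deriv q)) z) \<partial>lborel) = 0"
proof -
  note uC = eigenspaceD[OF u]
  have [measurable]: "u \<in> borel_measurable borel" using uC(2) by (rule borel_measurable_continuous_onI)
  define \<gamma> where "\<gamma> = (\<lambda>p R x. cutoff R x * gauss_poly p x)"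
  define \<gamma>1 where "\<gamma>1 = (\<lambda>p R x. cutoff1 R x * gauss_poly p x + cutoff R x * gauss_poly (gauss_deriv p) x)"
  define \<gamma>2 where "\<gamma>2 = (\<lambda>p R x. cutoff2 R x * gauss_poly p x + 2 * cutoff1 R x * gauss_poly (gauss_deriv p) x + cutoff R x * gauss_poly (gauss_deriv (gauss_deriv p)) x)"
  have d1: "(\<gamma> p R has_real_derivative \<gamma>1 p R x) (at x)" for p R x
    unfolding \<gamma>_def \<gamma>1_def by (rule derivative_eq_intros cutoff_derivs gauss_poly_deriv refl)+ simp
  have d2: "(\<gamma>1 p R has_real_derivative \<gamma>2 p R x) (at x)" for p R x
    unfolding \<gamma>1_def \<gamma>2_def by (rule derivative_eq_intros cutoff_derivs gauss_poly_deriv refl)+ simp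
  have ccut: "continuous_on S (cutoff R)" "continuous_on S (cutoff1 R)" "continuous_on S (cutoff2 R)" for S R
    unfolding cutoff_def cutoff1_def cutoff2_def by (auto intro!: continuous_intros simp: divide_inverse)
  have c\<gamma>: "continuous_on S (\<gamma> p R)" "continuous_on S (\<gamma>2 p R)" for S p R
    unfolding \<gamma>_def \<gamma>2_def by (intro continuous_intros ccut continuous_gauss_poly)+
  have bd: "\<gamma> p R (-R) = 0" "\<gamma> p R R = 0" "\<gamma>1 p R (-R) = 0" "\<gamma>1 p R R = 0" if "R \<noteq> 0" for p R
    using cutoff_boundary[OF that] by (auto simp: \<gamma>_def \<gamma>1_def)
  define B where "B = (\<lambda>n. cbox (- real (Suc n), - real (Suc n)) (real (Suc n), real (Suc n)) :: (real \<times> real) set)"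
  define t where "t = (\<lambda>n z. u z * (((fst z)\<^sup>2 + (snd z)\<^sup>2 - \<mu>) * (\<gamma> p (real (Suc n)) (fst z) * \<gamma> q (real (Suc n)) (snd z))
     - \<gamma>2 p (real (Suc n)) (fst z) * \<gamma> q (real (Suc n)) (snd z) - \<gamma> p (real (Suc n)) (fst z) * \<gamma>2 q (real (Suc n)) (snd z)))"
  define g where "g = (\<lambda>z. u z * (((fst z)\<^sup>2 + (snd z)\<^sup>2 - \<mu>) * gauss_prod p q z
     - gauss_prod (gauss_deriv (gauss_deriv p)) q z - gauss_prod p (gauss_deriv (gauss_deriv q)) z))"
  have comp: "continuous_on UNIV (\<lambda>z::real\<times>real. f (fst z))" "continuous_on UNIV (\<lambda>z::real\<times>real. f (snd z))"
    if "continuous_on UNIV f" for f :: "real \<Rightarrow> real"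
    using continuous_on_compose2[OF that continuous_on_fst[OF continuous_on_id]] continuous_on_compose2[OF that continuous_on_snd[OF continuous_on_id]] by auto
  have ct: "continuous_on UNIV (t n)" for n
    unfolding t_def by (intro continuous_intros uC(2) comp c\<gamma>)
  have zero: "(\<integral>z. indicator (B n) z * t n z \<partial>lborel) = 0" for n
  proof -
    let ?R = "real (Suc n)"
    have nz: "?R \<noteq> 0" by simp
    have "integral (B n) (\<lambda>z. laplacian u z * (\<gamma> p ?R (fst z) * \<gamma> q ?R (snd z)) - u z * (\<gamma>2 p ?R (fst z) * \<gamma> q ?R (snd z) + \<gamma> p ?R (fst z) * \<gamma>2 q ?R (snd z))) = 0"
      unfolding B_def by (rule green_box[OF uC(1) _ d1 d2 c\<gamma>(2) bd[OF nz] d1 d2 c\<gamma>(2) bd[OF nz]]) simp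
    also have "(\<lambda>z. laplacian u z * (\<gamma> p ?R (fst z) * \<gamma> q ?R (snd z)) - u z * (\<gamma>2 p ?R (fst z) * \<gamma> q ?R (snd z) + \<gamma> p ?R (fst z) * \<gamma>2 q ?R (snd z))) = t n"
      by (auto simp: fun_eq_iff t_def eigenspace_laplacian[OF u] algebra_simps)
    finally have "integral (B n) (t n) = 0" .
    moreover have "set_integrable lborel (B n) (t n)"
      unfolding set_integrable_def
      by (rule borel_integrable_compact) (auto simp: B_def intro: continuous_on_subset[OF ct])
    ultimately have "(LINT z:B n|lborel. t n z) = 0"
      by (simp add: set_borel_integral_eq_integral(2))
    then show ?thesis by (simp add: set_lebesgue_integral_def)
  qed
  obtain K where K: "K \<ge> 0" "\<And>x. \<bar>gauss_poly p x\<bar> \<le> K * exp (- x\<^sup>2 / 4)" "\<And>x. \<bar>gauss_poly (gauss_deriv p) x\<bar> \<le> K * exp (- x\<^sup>2 / 4)"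
     "\<And>x. \<bar>gauss_poly (gauss_deriv (gauss_deriv p)) x\<bar> \<le> K * exp (- x\<^sup>2 / 4)" "\<And>x. \<bar>x\<^sup>2 * gauss_poly p x\<bar> \<le> K * exp (- x\<^sup>2 / 4)"
    using gauss_poly_four_bounds by metis
  obtain L where L: "L \<ge> 0" "\<And>x. \<bar>gauss_poly q x\<bar> \<le> L * exp (- x\<^sup>2 / 4)" "\<And>x. \<bar>gauss_poly (gauss_deriv q) x\<bar> \<le> L * exp (- x\<^sup>2 / 4)"
     "\<And>x. \<bar>gauss_poly (gauss_deriv (gauss_deriv q)) x\<bar> \<le> L * exp (- x\<^sup>2 / 4)" "\<And>x. \<bar>x\<^sup>2 * gauss_poly q x\<bar> \<le> L * exp (- x\<^sup>2 / 4)"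
    using gauss_poly_four_bounds by metis
  have b\<gamma>: "\<bar>\<gamma> p R x\<bar> \<le> K * exp (- x\<^sup>2 / 4) \<and> \<bar>x\<^sup>2 * \<gamma> p R x\<bar> \<le> K * exp (- x\<^sup>2 / 4) \<and> \<bar>\<gamma>2 p R x\<bar> \<le> 21 * (K * exp (- x\<^sup>2 / 4))"
    if "R \<ge> 1" "\<bar>x\<bar> \<le> R" and k: "\<bar>gauss_poly p x\<bar> \<le> K * exp (- x\<^sup>2 / 4)" "\<bar>gauss_poly (gauss_deriv p) x\<bar> \<le> K * exp (- x\<^sup>2 / 4)"
     "\<bar>gauss_poly (gauss_deriv (gauss_deriv p)) x\<bar> \<le> K * exp (- x\<^sup>2 / 4)" "\<bar>x\<^sup>2 * gauss_poly p x\<bar> \<le> K * exp (- x\<^sup>2 / 4)" for p K R x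
  proof -
    note cb = cutoff_bounds[OF that(1,2)]
    have m: "\<bar>c * w\<bar> \<le> M * N" if "\<bar>c\<bar> \<le> M" "\<bar>w\<bar> \<le> N" "0 \<le> M" for c w M N :: real
      unfolding abs_mult using that by (intro mult_mono) auto
    have "\<bar>\<gamma>2 p R x\<bar> \<le> 12 * (K * exp (- x\<^sup>2 / 4)) + 8 * (K * exp (- x\<^sup>2 / 4)) + 1 * (K * exp (- x\<^sup>2 / 4))"
    proof -
      have "\<bar>2 * cutoff1 R x\<bar> \<le> 8" using cb(2) by (simp add: abs_mult)
      then have "\<bar>2 * cutoff1 R x * gauss_poly (gauss_deriv p) x\<bar> \<le> 8 * (K * exp (- x\<^sup>2 / 4))" by (rule m[OF _ k(2)]) simp
      moreover have "\<bar>cutoff2 R x * gauss_poly p x\<bar> \<le> 12 * (K * exp (- x\<^sup>2 / 4))" by (rule m[OF cb(3) k(1)]) simp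
      moreover have "\<bar>cutoff R x * gauss_poly (gauss_deriv (gauss_deriv p)) x\<bar> \<le> 1 * (K * exp (- x\<^sup>2 / 4))" by (rule m[OF cb(1) k(3)]) simp
      ultimately show ?thesis unfolding \<gamma>2_def by linarith
    qed
    moreover have "\<bar>\<gamma> p R x\<bar> \<le> 1 * (K * exp (- x\<^sup>2 / 4))" unfolding \<gamma>_def by (rule m[OF cb(1) k(1)]) simp
    moreover have "\<bar>cutoff R x * (x\<^sup>2 * gauss_poly p x)\<bar> \<le> 1 * (K * exp (- x\<^sup>2 / 4))" by (rule m[OF cb(1) k(4)]) simp
    moreover have "x\<^sup>2 * \<gamma> p R x = cutoff R x * (x\<^sup>2 * gauss_poly p x)" by (simp only: \<gamma>_def mult.left_commute)
    ultimately show ?thesis by linarith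
  qed
  have "(\<lambda>n. \<integral>z. indicator (B n) z * t n z \<partial>lborel) \<longlonglongrightarrow> (\<integral>z. g z \<partial>lborel)"
  proof (rule integral_dominated_convergence[where w = "\<lambda>z. (44 + \<bar>\<mu>\<bar>) * K * L * (\<bar>u z\<bar> * wide_gauss z)"])
    have "continuous_on UNIV g"
      unfolding g_def by (intro continuous_intros uC(2) continuous_gauss_prod)
    then have "g \<in> borel_measurable borel" by (rule borel_measurable_continuous_onI)
    then show "g \<in> borel_measurable lborel" by simp
    show "(\<lambda>z. indicator (B n) z * t n z) \<in> borel_measurable lborel" for n
    proof -
      have [measurable]: "t n \<in> borel_measurable borel" using ct by (rule borel_measurable_continuous_onI)
      have [measurable]: "B n \<in> sets borel" by (simp add: B_def)
      show ?thesis by measurable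
    qed
    have "continuous_on UNIV wide_gauss"
      unfolding wide_gauss_def by (auto intro!: continuous_intros)
    then have [measurable]: "wide_gauss \<in> borel_measurable borel" by (rule borel_measurable_continuous_onI)
    have w0: "0 \<le> wide_gauss z" for z by (simp add: wide_gauss_def)
    show "integrable lborel (\<lambda>z. (44 + \<bar>\<mu>\<bar>) * K * L * (\<bar>u z\<bar> * wide_gauss z))"
      by (rule integrable_dominated[OF uC(2,3), where C = "(44 + \<bar>\<mu>\<bar>) * K * L"]) (use K(1) L(1) w0 in \<open>auto simp: abs_mult\<close>)
    show "AE z in lborel. (\<lambda>n. indicator (B n) z * t n z) \<longlonglongrightarrow> g z"
    proof (rule AE_I2)
      fix z :: "real \<times> real"
      have "(\<lambda>n. t n z) \<longlonglongrightarrow> u z * (((fst z)\<^sup>2 + (snd z)\<^sup>2 - \<mu>) * ((1 * gauss_poly p (fst z)) * (1 * gauss_poly q (snd z)))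
        - (0 * gauss_poly p (fst z) + 2 * 0 * gauss_poly (gauss_deriv p) (fst z) + 1 * gauss_poly (gauss_deriv (gauss_deriv p)) (fst z)) * (1 * gauss_poly q (snd z))
        - (1 * gauss_poly p (fst z)) * (0 * gauss_poly q (snd z) + 2 * 0 * gauss_poly (gauss_deriv q) (snd z) + 1 * gauss_poly (gauss_deriv (gauss_deriv q)) (snd z)))"
        unfolding t_def \<gamma>_def \<gamma>2_def by (intro tendsto_intros cutoff_tendsto)
      then have lim: "(\<lambda>n. t n z) \<longlonglongrightarrow> g z" by (simp add: g_def gauss_prod_def algebra_simps)
      obtain N :: nat where N: "\<bar>fst z\<bar> + \<bar>snd z\<bar> \<le> real N" using real_arch_simple by blast
      have "eventually (\<lambda>n. t n z = indicator (B n) z * t n z) sequentially"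
        unfolding eventually_sequentially
      proof (intro exI[of _ N] allI impI)
        fix n assume "N \<le> n"
        then have "z \<in> B n" using N by (cases z) (auto simp: B_def cbox_Pair_eq)
        then show "t n z = indicator (B n) z * t n z" by simp
      qed
      from Lim_transform_eventually[OF lim this] show "(\<lambda>n. indicator (B n) z * t n z) \<longlonglongrightarrow> g z" .
    qed
    show "AE z in lborel. norm (indicator (B n) z * t n z) \<le> (44 + \<bar>\<mu>\<bar>) * K * L * (\<bar>u z\<bar> * wide_gauss z)" for n
    proof (rule AE_I2)
      fix z :: "real \<times> real"
      let ?R = "real (Suc n)"
      show "norm (indicator (B n) z * t n z) \<le> (44 + \<bar>\<mu>\<bar>) * K * L * (\<bar>u z\<bar> * wide_gauss z)"
      proof (cases "z \<in> B n")
        case False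
        then show ?thesis using K(1) L(1) by (simp add: wide_gauss_def)
      next
        case True
        then have z: "\<bar>fst z\<bar> \<le> ?R" "\<bar>snd z\<bar> \<le> ?R" by (cases z; auto simp: B_def cbox_Pair_eq)+
        have R1: "?R \<ge> 1" by simp
        define E where "E = K * exp (- (fst z)\<^sup>2 / 4)"
        define F where "F = L * exp (- (snd z)\<^sup>2 / 4)"
        have EF: "0 \<le> E" "0 \<le> F" using K L by (auto simp: E_def F_def)
        define a where "a = \<gamma> p ?R (fst z)"
        define a2 where "a2 = \<gamma>2 p ?R (fst z)"
        define b where "b = \<gamma> q ?R (snd z)"
        define b2 where "b2 = \<gamma>2 q ?R (snd z)"
        have a: "\<bar>a\<bar> \<le> E" "\<bar>(fst z)\<^sup>2 * a\<bar> \<le> E" "\<bar>a2\<bar> \<le> 21 * E"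
          using b\<gamma>[OF R1 z(1) K(2,3,4,5)] by (simp_all only: a_def a2_def E_def)
        have b: "\<bar>b\<bar> \<le> F" "\<bar>(snd z)\<^sup>2 * b\<bar> \<le> F" "\<bar>b2\<bar> \<le> 21 * F"
          using b\<gamma>[OF R1 z(2) L(2,3,4,5)] by (simp_all only: b_def b2_def F_def)
        have m: "\<bar>c * w\<bar> \<le> M * N" if "\<bar>c\<bar> \<le> M" "\<bar>w\<bar> \<le> N" "0 \<le> M" for c w M N :: real
          unfolding abs_mult using that by (intro mult_mono) auto
        have tri: "\<bar>x1 + x2 - x3 - x4 - x5\<bar> \<le> b1 + b2 + b3 + b4 + b5"
          if "\<bar>x1\<bar> \<le> b1" "\<bar>x2\<bar> \<le> b2" "\<bar>x3\<bar> \<le> b3" "\<bar>x4\<bar> \<le> b4" "\<bar>x5\<bar> \<le> b5" for x1 x2 x3 x4 x5 b1 b2 b3 b4 b5 :: real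
          using that by linarith
        have 1: "\<bar>((fst z)\<^sup>2 * a) * b\<bar> \<le> E * F" by (rule m[OF a(2) b(1) EF(1)])
        have 2: "\<bar>a * ((snd z)\<^sup>2 * b)\<bar> \<le> E * F" by (rule m[OF a(1) b(2) EF(1)])
        have ab: "\<bar>a * b\<bar> \<le> E * F" by (rule m[OF a(1) b(1) EF(1)])
        have 3: "\<bar>\<mu> * (a * b)\<bar> \<le> \<bar>\<mu>\<bar> * (E * F)" by (rule m[OF _ ab]) simp_all
        have 4: "\<bar>a2 * b\<bar> \<le> (21 * E) * F" by (rule m[OF a(3) b(1)]) (use EF in simp)
        have 5: "\<bar>a * b2\<bar> \<le> E * (21 * F)" by (rule m[OF a(1) b(3) EF(1)])
        have "((fst z)\<^sup>2 + (snd z)\<^sup>2 - \<mu>) * (a * b) - a2 * b - a * b2 = ((fst z)\<^sup>2 * a) * b + a * ((snd z)\<^sup>2 * b) - \<mu> * (a * b) - a2 * b - a * b2"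
          by (simp add: algebra_simps)
        moreover have "\<bar>((fst z)\<^sup>2 * a) * b + a * ((snd z)\<^sup>2 * b) - \<mu> * (a * b) - a2 * b - a * b2\<bar> \<le> (E * F + E * F + \<bar>\<mu>\<bar> * (E * F) + (21 * E) * F + E * (21 * F))"
          by (rule tri[OF 1 2 3 4 5])
        ultimately have "\<bar>((fst z)\<^sup>2 + (snd z)\<^sup>2 - \<mu>) * (a * b) - a2 * b - a * b2\<bar> \<le> (44 + \<bar>\<mu>\<bar>) * (E * F)"
          by (simp add: algebra_simps)
        then have "\<bar>u z\<bar> * \<bar>((fst z)\<^sup>2 + (snd z)\<^sup>2 - \<mu>) * (a * b) - a2 * b - a * b2\<bar> \<le> \<bar>u z\<bar> * ((44 + \<bar>\<mu>\<bar>) * (E * F))"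
          by (intro mult_left_mono) auto
        moreover have "t n z = u z * (((fst z)\<^sup>2 + (snd z)\<^sup>2 - \<mu>) * (a * b) - a2 * b - a * b2)"
          by (simp only: t_def a_def a2_def b_def b2_def)
        moreover have "E * F = K * L * wide_gauss z" by (simp only: E_def F_def wide_gauss_def mult_ac)
        ultimately have "\<bar>t n z\<bar> \<le> \<bar>u z\<bar> * ((44 + \<bar>\<mu>\<bar>) * (K * L * wide_gauss z))" by (simp only: abs_mult)
        then show ?thesis using True by (simp add: mult_ac)
      qed
    qed
  qed
  then have "(\<lambda>n::nat. 0) \<longlonglongrightarrow> (\<integral>z. g z \<partial>lborel)" by (simp only: zero)
  then have "(\<integral>z. g z \<partial>lborel) = 0" by (rule LIMSEQ_unique[OF _ tendsto_const])
  then show ?thesis by (simp only: g_def)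
qed

section \<open>Moments determine the function\<close>

text \<open>
  Exponential integrability allows the exponential series to be integrated term by term, so the
  Fourier transform vanishes. The positive and the negative part of \<open>V\<close> are then, after
  normalisation, two probability densities with the same characteristic function.
\<close>
lemma moments_determine_density:
  fixes V :: "real \<Rightarrow> real"
  assumes V [measurable]: "V \<in> borel_measurable borel"
    and int: "\<And>s::nat. integrable lborel (\<lambda>x. V x * exp (real s * \<bar>x\<bar>))"
    and mom: "\<And>k. (\<integral>x. V x * x ^ k \<partial>lborel) = 0"
  shows "AE x in lborel. V x = 0"
proof -
  have intV: "integrable lborel V" using int[of 0] by simp
  have intm: "integrable lborel (\<lambda>x. V x * exp (c * \<bar>x\<bar>))" for c
  proof -
    obtain s :: nat where s: "c \<le> real s" using real_arch_simple by blast
    show ?thesis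
    proof (rule Bochner_Integration.integrable_bound[OF int[of s]])
      show "AE x in lborel. norm (V x * exp (c * \<bar>x\<bar>)) \<le> norm (V x * exp (real s * \<bar>x\<bar>))"
        using s by (intro AE_I2) (auto simp: abs_mult intro!: mult_left_mono mult_right_mono)
    qed measurable
  qed
  have chf: "(\<integral>x. complex_of_real (V x) * iexp (t * x) \<partial>lborel) = 0" for t
  proof -
    define S where "S = (\<lambda>n x. complex_of_real (V x) * (\<Sum>k<n. (\<i> * complex_of_real (t * x)) ^ k / fact k))"
    have intp: "integrable lborel (\<lambda>x. V x * x ^ k)" for k
    proof (rule Bochner_Integration.integrable_bound[OF integrable_mult_right[OF intm[of 1], of "fact k"]])
      have "\<bar>x\<bar> ^ k \<le> fact k * exp \<bar>x\<bar>" for x :: real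
      proof -
        have "\<bar>x\<bar> ^ k / fact k \<le> exp \<bar>x\<bar>"
          using sum_le_suminf[OF summable_exp[of "\<bar>x\<bar>"], of "{k}"] by (simp add: exp_def divide_inverse_commute scaleR_conv_of_real)
        then show ?thesis by (simp add: divide_le_eq mult.commute)
      qed
      then have "\<bar>V x\<bar> * \<bar>x\<bar> ^ k \<le> \<bar>V x\<bar> * (fact k * exp \<bar>x\<bar>)" for x
        by (rule mult_left_mono) simp
      then show "AE x in lborel. norm (V x * x ^ k) \<le> norm (fact k * (V x * exp (1 * \<bar>x\<bar>)))"
        by (intro AE_I2) (simp add: abs_mult power_abs mult.left_commute)
    qed measurable
    have S_eq: "S n x = (\<Sum>k<n. (\<i> * complex_of_real t) ^ k / fact k * complex_of_real (V x * x ^ k))" for n x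
      unfolding S_def sum_distrib_left by (intro sum.cong refl) (simp add: power_mult_distrib)
    have "(\<integral>x. S n x \<partial>lborel) = 0" for n
    proof -
      have "(\<integral>x. S n x \<partial>lborel) = (\<Sum>k<n. (\<i> * complex_of_real t) ^ k / fact k * complex_of_real (\<integral>x. V x * x ^ k \<partial>lborel))"
        unfolding S_eq using intp by (simp add: integral_of_real del: of_real_mult of_real_power)
      then show ?thesis by (simp add: mom)
    qed
    moreover have "(\<lambda>n. \<integral>x. S n x \<partial>lborel) \<longlonglongrightarrow> (\<integral>x. complex_of_real (V x) * iexp (t * x) \<partial>lborel)"
    proof (rule integral_dominated_convergence[where w = "\<lambda>x. norm (V x * exp (\<bar>t\<bar> * \<bar>x\<bar>))"])
      show "integrable lborel (\<lambda>x. norm (V x * exp (\<bar>t\<bar> * \<bar>x\<bar>)))" using intm by (rule integrable_norm)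
      show "AE x in lborel. (\<lambda>n. S n x) \<longlonglongrightarrow> complex_of_real (V x) * iexp (t * x)"
      proof (rule AE_I2)
        fix x
        have "(\<lambda>k. (\<i> * complex_of_real (t * x)) ^ k / fact k) sums exp (\<i> * complex_of_real (t * x))"
          using exp_converges[of "\<i> * complex_of_real (t * x)"] by (simp add: scaleR_conv_of_real divide_inverse mult.commute)
        then show "(\<lambda>n. S n x) \<longlonglongrightarrow> complex_of_real (V x) * iexp (t * x)"
          unfolding S_def sums_def by (intro tendsto_mult tendsto_const) 
      qed
      show "AE x in lborel. norm (S n x) \<le> norm (V x * exp (\<bar>t\<bar> * \<bar>x\<bar>))" for n
      proof (rule AE_I2)
        fix x
        have "norm (\<Sum>k<n. (\<i> * complex_of_real (t * x)) ^ k / fact k) \<le> (\<Sum>k<n. \<bar>t * x\<bar> ^ k / fact k)"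
          by (rule order_trans[OF norm_sum]) (simp add: norm_divide norm_power norm_mult power_mult_distrib abs_mult)
        also have "\<dots> \<le> exp \<bar>t * x\<bar>"
          using sum_le_suminf[OF summable_exp[of "\<bar>t * x\<bar>"], of "{..<n}"] by (simp add: exp_def divide_inverse_commute scaleR_conv_of_real)
        finally show "norm (S n x) \<le> norm (V x * exp (\<bar>t\<bar> * \<bar>x\<bar>))"
          unfolding S_def norm_mult by (simp add: abs_mult mult_left_mono)
      qed
    qed (auto simp: S_def)
    ultimately have "(\<lambda>n::nat. 0) \<longlonglongrightarrow> (\<integral>x. complex_of_real (V x) * iexp (t * x) \<partial>lborel)" by (simp only:)
    then show ?thesis by (rule LIMSEQ_unique[OF _ tendsto_const])
  qed
  define Vp where "Vp = (\<lambda>x. max 0 (V x))"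
  define Vn where "Vn = (\<lambda>x. max 0 (- V x))"
  have Vpn: "V x = Vp x - Vn x" "0 \<le> Vp x" "0 \<le> Vn x" "Vp x + Vn x = \<bar>V x\<bar>" for x by (auto simp: Vp_def Vn_def)
  have [measurable]: "Vp \<in> borel_measurable borel" "Vn \<in> borel_measurable borel" unfolding Vp_def Vn_def by measurable
  have ip: "integrable lborel Vp" "integrable lborel Vn"
    unfolding Vp_def Vn_def using intV by auto
  define m where "m = (\<integral>x. Vp x \<partial>lborel)"
  have "(\<integral>x. V x \<partial>lborel) = 0" using mom[of 0] by simp
  then have mn: "(\<integral>x. Vn x \<partial>lborel) = m" using ip by (simp add: Vpn(1) m_def)
  show ?thesis
  proof (cases "m = 0")
    case True
    have "AE x in lborel. Vp x = 0" "AE x in lborel. Vn x = 0"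
      using integral_nonneg_eq_0_iff_AE[OF ip(1)] integral_nonneg_eq_0_iff_AE[OF ip(2)] Vpn True mn m_def by auto
    then show ?thesis by eventually_elim (simp add: Vpn(1))
  next
    case False
    have "0 \<le> m" unfolding m_def by (intro Bochner_Integration.integral_nonneg Vpn(2))
    then have m: "m > 0" using False by simp
    let ?M = "\<lambda>W. density lborel (\<lambda>x. ennreal (W x / m))"
    have dist: "real_distribution (?M W)" if [measurable]: "W \<in> borel_measurable borel" and "integrable lborel W" "\<And>x. 0 \<le> W x" "(\<integral>x. W x \<partial>lborel) = m" for W
    proof -
      have "(\<integral>\<^sup>+x. ennreal (W x / m) \<partial>lborel) = ennreal (\<integral>x. W x / m \<partial>lborel)"
        using that m by (intro nn_integral_eq_integral) auto
      also have "\<dots> = 1" using that m by simp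
      finally have "emeasure (?M W) (space (?M W)) = 1" by (simp add: emeasure_density)
      then have "prob_space (?M W)" by (rule prob_spaceI)
      then show ?thesis by (simp add: real_distribution_def real_distribution_axioms_def)
    qed
    have char_eq: "char (?M W) t = (\<integral>x. complex_of_real (W x) * iexp (t * x) \<partial>lborel) / of_real m"
      if [measurable]: "W \<in> borel_measurable borel" and "\<And>x. 0 \<le> W x" for W t
    proof -
      have "char (?M W) t = (\<integral>x. (W x / m) *\<^sub>R iexp (t * x) \<partial>lborel)"
        unfolding char_def using that m by (subst integral_density) auto
      also have "\<dots> = (\<integral>x. complex_of_real (W x) * iexp (t * x) / of_real m \<partial>lborel)"
        by (simp add: scaleR_conv_of_real)
      finally show ?thesis by simp
    qed
    have ci: "integrable lborel (\<lambda>x. complex_of_real (W x) * iexp (t * x))" if [measurable]: "W \<in> borel_measurable borel" and "integrable lborel W" for W t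
      by (rule Bochner_Integration.integrable_bound[OF that(2)]) (auto simp: norm_mult)
    have "char (?M Vp) = char (?M Vn)"
    proof
      fix t
      have "(\<integral>x. complex_of_real (Vp x) * iexp (t * x) \<partial>lborel) - (\<integral>x. complex_of_real (Vn x) * iexp (t * x) \<partial>lborel)
         = (\<integral>x. complex_of_real (V x) * iexp (t * x) \<partial>lborel)"
        using ci ip by (subst Bochner_Integration.integral_diff[symmetric]) (auto simp: Vpn(1) left_diff_distrib)
      then show "char (?M Vp) t = char (?M Vn) t" using chf[of t] Vpn by (simp add: char_eq)
    qed
    then have "?M Vp = ?M Vn"
      using ip Vpn mn by (intro Levy_uniqueness dist) (auto simp: m_def)
    then have "AE x in lborel. ennreal (Vp x / m) = ennreal (Vn x / m)"
      by (intro sigma_finite_measure.density_unique[OF sigma_finite_lborel]) auto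
    then show ?thesis
    proof eventually_elim
      case (elim x)
      then show ?case using m Vpn[of x] by (simp add: ennreal_inj)
    qed
  qed
qed

text \<open>
  The one-variable statement is applied twice: first to the partial moments in \<open>y\<close> as functions
  of \<open>x\<close>, then on almost every vertical line. Integer exponents \<open>s\<close> in the integrability hypothesis keep the
  exceptional null sets countable in number.
\<close>
lemma zero_if_moments_zero:
  assumes u: "continuous_on UNIV u" "integrable lborel (\<lambda>z. (u z)\<^sup>2)"
    and mom: "\<And>a b. moment u (monom 1 a) (monom 1 b) = 0"
  shows "u z = 0"
proof -
  have [measurable]: "u \<in> borel_measurable borel" using u(1) by (rule borel_measurable_continuous_onI)
  define U where "U = (\<lambda>z. u z * gauss_prod 1 1 z)"
  have [measurable]: "U \<in> borel_measurable (borel \<Otimes>\<^sub>M borel)" unfolding U_def borel_prod by measurable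
  have mono: "gauss_prod (monom 1 a) (monom 1 b) z = gauss_prod 1 1 z * (fst z ^ a * snd z ^ b)" for a b z
    by (simp add: gauss_prod_def gauss_poly_def poly_monom)
  have intU: "integrable (lborel \<Otimes>\<^sub>M lborel) (\<lambda>z. U z * exp (c * \<bar>fst z\<bar>) * (snd z ^ b * exp (d * \<bar>snd z\<bar>)))" for b c d
  proof -
    obtain C where C: "C \<ge> 0" "\<And>z. \<bar>gauss_prod 1 (monom 1 b) z\<bar> * exp (c * \<bar>fst z\<bar> + d * \<bar>snd z\<bar>) \<le> C * wide_gauss z"
      using gauss_prod_exp_bound by blast
    have "integrable lborel (\<lambda>z. U z * exp (c * \<bar>fst z\<bar>) * (snd z ^ b * exp (d * \<bar>snd z\<bar>)))"
    proof (rule integrable_dominated[OF u _ _ C(1)])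
      have "continuous_on UNIV (\<lambda>z. U z * exp (c * \<bar>fst z\<bar>) * (snd z ^ b * exp (d * \<bar>snd z\<bar>)))"
        unfolding U_def by (intro continuous_intros u continuous_gauss_prod)
      then show "(\<lambda>z. U z * exp (c * \<bar>fst z\<bar>) * (snd z ^ b * exp (d * \<bar>snd z\<bar>))) \<in> borel_measurable borel" by (rule borel_measurable_continuous_onI)
      fix z
      have "gauss_prod 1 (monom 1 b) z = gauss_prod 1 1 z * snd z ^ b" using mono[of 0 b z] by simp
      then have "\<bar>U z * exp (c * \<bar>fst z\<bar>) * (snd z ^ b * exp (d * \<bar>snd z\<bar>))\<bar> = \<bar>u z\<bar> * (\<bar>gauss_prod 1 (monom 1 b) z\<bar> * exp (c * \<bar>fst z\<bar> + d * \<bar>snd z\<bar>))"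
        by (simp add: U_def abs_mult exp_add mult_ac)
      also have "\<dots> \<le> \<bar>u z\<bar> * (C * wide_gauss z)" using C by (intro mult_left_mono) auto
      finally show "\<bar>U z * exp (c * \<bar>fst z\<bar>) * (snd z ^ b * exp (d * \<bar>snd z\<bar>))\<bar> \<le> C * (\<bar>u z\<bar> * wide_gauss z)" by (simp add: mult_ac)
    qed
    then show ?thesis by (simp add: lborel_prod)
  qed
  define Vb where "Vb = (\<lambda>b x. \<integral>y. U (x,y) * y ^ b \<partial>lborel)"
  have Vb0: "AE x in lborel. Vb b x = 0" for b
  proof (rule moments_determine_density)
    show "Vb b \<in> borel_measurable borel" unfolding Vb_def by measurable
    show "integrable lborel (\<lambda>x. Vb b x * exp (real s * \<bar>x\<bar>))" for s
    proof -
      have "integrable lborel (\<lambda>x. \<integral>y. U (x,y) * exp (real s * \<bar>x\<bar>) * (y ^ b * exp (0 * \<bar>y\<bar>)) \<partial>lborel)"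
        using lborel_pair.integrable_fst'[OF intU[of "real s" b 0]] by simp
      moreover have "(\<integral>y. U (x,y) * exp (real s * \<bar>x\<bar>) * (y ^ b * exp (0 * \<bar>y\<bar>)) \<partial>lborel) = Vb b x * exp (real s * \<bar>x\<bar>)" for x
      proof -
        have "(\<integral>y. U (x,y) * exp (real s * \<bar>x\<bar>) * (y ^ b * exp (0 * \<bar>y\<bar>)) \<partial>lborel) = (\<integral>y. (U (x,y) * y ^ b) * exp (real s * \<bar>x\<bar>) \<partial>lborel)"
          by (simp add: mult_ac)
        then show ?thesis by (simp add: Vb_def)
      qed
      ultimately show ?thesis by simp
    qed
    show "(\<integral>x. Vb b x * x ^ a \<partial>lborel) = 0" for a
    proof -
      have i: "integrable (lborel \<Otimes>\<^sub>M lborel) (\<lambda>z. u z * gauss_prod (monom 1 a) (monom 1 b) z)"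
        using integrable_moment[OF u] by (simp add: lborel_prod)
      have "Vb b x * x ^ a = (\<integral>y. u (x,y) * gauss_prod (monom 1 a) (monom 1 b) (x,y) \<partial>lborel)" for x
      proof -
        have "(\<integral>y. u (x,y) * gauss_prod (monom 1 a) (monom 1 b) (x,y) \<partial>lborel) = (\<integral>y. (U (x,y) * y ^ b) * x ^ a \<partial>lborel)"
          by (simp add: mono U_def mult_ac)
        then show ?thesis by (simp add: Vb_def)
      qed
      then have "(\<integral>x. Vb b x * x ^ a \<partial>lborel) = (\<integral>z. u z * gauss_prod (monom 1 a) (monom 1 b) z \<partial>(lborel \<Otimes>\<^sub>M lborel))"
        using lborel_pair.integral_fst'[OF i] by simp
      then show ?thesis using mom[of a b] by (simp add: moment_def lborel_prod)
    qed
  qed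
  have "AE x in lborel. \<forall>b. Vb b x = 0" using Vb0 by (simp add: AE_all_countable)
  moreover have "AE x in lborel. \<forall>s::nat. integrable lborel (\<lambda>y. U (x,y) * exp (real s * \<bar>y\<bar>))"
    unfolding AE_all_countable
  proof
    fix s :: nat
    show "AE x in lborel. integrable lborel (\<lambda>y. U (x,y) * exp (real s * \<bar>y\<bar>))"
      using lborel_pair.AE_integrable_fst'[OF intU[of 0 0 "real s"]] by simp
  qed
  ultimately have "AE x in lborel. AE y in lborel. U (x,y) = 0"
  proof eventually_elim
    case (elim x)
    show ?case
      by (rule moments_determine_density) (use elim in \<open>auto simp: Vb_def\<close>)
  qed
  then have "AE z in lborel \<Otimes>\<^sub>M lborel. U z = 0"
    
  proof (rule lborel_pair.AE_pair_measure[rotated])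
    show "{z \<in> space (lborel \<Otimes>\<^sub>M lborel). U z = 0} \<in> sets (lborel \<Otimes>\<^sub>M lborel)" by measurable
  qed
  then have "AE z in lborel. U z = 0" unfolding lborel_prod .
  then have ae: "AE z in lborel. u z = 0"
    by eventually_elim (simp add: U_def gauss_prod_def gauss_poly_def)
  show "u z = 0"
  proof (rule ccontr)
    assume "u z \<noteq> 0"
    have op: "open (u -` (- {0}))" using open_vimage[OF _ u(1), of "- {0}"] by (simp add: open_Compl)
    have "emeasure lborel (u -` (- {0})) = 0"
      using ae op by (subst (asm) AE_iff_measurable[of "u -` (- {0})"]) auto
    then have "u -` (- {0}) \<in> null_sets lborel" using op by auto
    then have "negligible (u -` (- {0}))" by (simp add: negligible_iff_null_sets null_sets_completionI)
    then have "u -` (- {0}) = {}" using op open_not_negligible by blast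
    then show False using \<open>u z \<noteq> 0\<close> by auto
  qed
qed

section \<open>The eigenspaces\<close>

lemma gauss_deriv2: "gauss_deriv (gauss_deriv p) = pderiv (pderiv p) - Polynomial.smult 2 ([:0,1:] * pderiv p) - p + [:0,0,1:] * p"
  by (simp add: gauss_deriv_def pderiv_diff pderiv_mult pderiv_pCons algebra_simps) (simp add: poly_eq_poly_eq_iff[symmetric] fun_eq_iff algebra_simps)

lemma gauss_deriv2_monom:
  "gauss_poly (gauss_deriv (gauss_deriv (monom 1 a))) x =
     real a * real (a - 1) * gauss_poly (monom 1 (a - 2)) x - (2 * real a + 1) * gauss_poly (monom 1 a) x + x\<^sup>2 * gauss_poly (monom 1 a) x"
proof -
  have x: "x * (real a * x ^ (a - 1)) = real a * x ^ a" by (cases a) auto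
  have "poly (gauss_deriv (gauss_deriv (monom 1 a))) x = real a * real (a - 1) * x ^ (a - 2) - 2 * (x * (real a * x ^ (a - 1))) - x ^ a + x\<^sup>2 * x ^ a"
    by (simp add: gauss_deriv2 pderiv_monom poly_monom power2_eq_square diff_diff_left numeral_2_eq_2 mult_ac)
  then have P: "poly (gauss_deriv (gauss_deriv (monom 1 a))) x = real a * real (a - 1) * x ^ (a - 2) - 2 * (real a * x ^ a) - x ^ a + x\<^sup>2 * x ^ a"
    unfolding x .
  show ?thesis
    unfolding gauss_poly_def P by (simp add: poly_monom algebra_simps)
qed

text \<open>
  The harmonic oscillator maps \<open>x\<^sup>a y\<^sup>b\<close> times the Gaussian to \<open>2 (a + b + 1)\<close> times itself minus terms of total
  degree \<open>a + b - 2\<close>. Truncated subtraction in the exponents is harmless, since the factors \<open>a (a - 1)\<close> and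
  \<open>b (b - 1)\<close> vanish in these cases.
\<close>
lemma moment_recurrence:
  assumes u: "u \<in> eigenspace \<mu>"
  shows "(2 * real (a + b + 1) - \<mu>) * moment u (monom 1 a) (monom 1 b) =
    real a * real (a - 1) * moment u (monom 1 (a - 2)) (monom 1 b) + real b * real (b - 1) * moment u (monom 1 a) (monom 1 (b - 2))"
proof -
  note uC = eigenspaceD(2,3)[OF u]
  note int = integrable_moment[OF uC]
  have "0 = (\<integral>z. (2 * real (a + b + 1) - \<mu>) * (u z * gauss_prod (monom 1 a) (monom 1 b) z) -
     real a * real (a - 1) * (u z * gauss_prod (monom 1 (a - 2)) (monom 1 b) z) -
     real b * real (b - 1) * (u z * gauss_prod (monom 1 a) (monom 1 (b - 2)) z) \<partial>lborel)"
    unfolding weak_eigenvalue_equation[OF u, of "monom 1 a" "monom 1 b", symmetric]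
    by (rule Bochner_Integration.integral_cong) (simp_all add: gauss_prod_def gauss_deriv2_monom algebra_simps)
  also have "\<dots> = (2 * real (a + b + 1) - \<mu>) * moment u (monom 1 a) (monom 1 b) -
    real a * real (a - 1) * moment u (monom 1 (a - 2)) (monom 1 b) - real b * real (b - 1) * moment u (monom 1 a) (monom 1 (b - 2))"
    unfolding moment_def using int by (simp del: of_nat_add)
  finally show ?thesis by linarith
qed

text \<open>
  By induction on \<open>a + b\<close> the recurrence carries the vanishing of the resonant moments, those with
  \<open>2 (a + b + 1) = \<mu>\<close>, to all moments.
\<close>
lemma eigenfunction_zero:
  assumes u: "u \<in> eigenspace \<mu>"
    and level: "\<And>a b. 2 * real (a + b + 1) = \<mu> \<Longrightarrow> moment u (monom 1 a) (monom 1 b) = 0"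
  shows "u = (\<lambda>_. 0)"
proof -
  have "moment u (monom 1 a) (monom 1 b) = 0" for a b
  proof (induction "a + b" arbitrary: a b rule: less_induct)
    case less
    show ?case
    proof (cases "2 * real (a + b + 1) = \<mu>")
      case True
      then show ?thesis by (rule level)
    next
      case False
      have "real a * real (a - 1) * moment u (monom 1 (a - 2)) (monom 1 b) = 0"
        using less[of "a - 2" b] by (cases "a \<le> 1") (auto simp: le_Suc_eq)
      moreover have "real b * real (b - 1) * moment u (monom 1 a) (monom 1 (b - 2)) = 0"
        using less[of a "b - 2"] by (cases "b \<le> 1") (auto simp: le_Suc_eq)
      ultimately have "(2 * real (a + b + 1) - \<mu>) * moment u (monom 1 a) (monom 1 b) = 0"
        using moment_recurrence[OF u, of a b] by (simp only:)
      then show ?thesis using False by simp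
    qed
  qed
  then show ?thesis using zero_if_moments_zero[OF eigenspaceD(2,3)[OF u]] by auto
qed

text \<open>
  Hermite polynomials normalised to leading coefficient \<open>1\<close>.
\<close>
fun hermite :: "nat \<Rightarrow> real poly" where
  "hermite 0 = 1"
| "hermite (Suc 0) = [:0, 1:]"
| "hermite (Suc (Suc n)) = [:0, 1:] * hermite (Suc n) - Polynomial.smult ((real n + 1) / 2) (hermite n)"

lemma pderiv_hermite: "pderiv (hermite (Suc n)) = Polynomial.smult (real n + 1) (hermite n)"
proof (induction n rule: hermite.induct)
  case 1
  then show ?case by (simp add: pderiv_pCons)
next
  case 2
  then show ?case by (simp add: pderiv_pCons pderiv_diff pderiv_smult)
next
  case (3 n)
  have "pderiv (hermite (Suc (Suc (Suc n)))) = hermite (Suc (Suc n)) + [:0, 1:] * pderiv (hermite (Suc (Suc n))) - Polynomial.smult ((real (Suc n) + 1) / 2) (pderiv (hermite (Suc n)))"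
    by (simp only: hermite.simps(3)[of "Suc n"] pderiv_diff pderiv_mult pderiv_smult) (simp add: pderiv_pCons)
  also have "\<dots> = hermite (Suc (Suc n)) + Polynomial.smult (real (Suc n) + 1) ([:0, 1:] * hermite (Suc n) - Polynomial.smult ((real n + 1) / 2) (hermite n))"
    unfolding 3 by (simp add: algebra_simps smult_diff_right)
  also have "\<dots> = Polynomial.smult (real (Suc (Suc n)) + 1) (hermite (Suc (Suc n)))"
    by (intro poly_eq_poly_eq_iff[THEN iffD1] ext) (simp add: field_simps)
  finally show ?case .
qed

lemma degree_hermite: "degree (hermite n) = n \<and> lead_coeff (hermite n) = 1"
proof (induction n rule: hermite.induct)
  case (3 n)
  have 1: "degree ([:0,1:] * hermite (Suc n)) = Suc (Suc n)" "lead_coeff ([:0,1:] * hermite (Suc n)) = 1"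
    using 3 by (auto simp: degree_mult_eq lead_coeff_mult)
  have "degree (Polynomial.smult ((real n + 1) / 2) (hermite n)) < Suc (Suc n)"
    using 3 by (intro le_less_trans[OF degree_smult_le]) auto
  then have "degree (hermite (Suc (Suc n))) = Suc (Suc n)" "coeff (hermite (Suc (Suc n))) (Suc (Suc n)) = 1"
    using 1 degree_add_eq_left[of "- Polynomial.smult ((real n + 1) / 2) (hermite n)" "[:0,1:] * hermite (Suc n)"]
    by (auto simp: coeff_eq_0 simp del: mult_pCons_left)
  then show ?case by simp
qed auto

lemma gauss_deriv2_hermite: "gauss_deriv (gauss_deriv (hermite n)) = [:0,0,1:] * hermite n - Polynomial.smult (2 * real n + 1) (hermite n)"
proof -
  have "pderiv (pderiv (hermite n)) - Polynomial.smult 2 ([:0,1:] * pderiv (hermite n)) = - Polynomial.smult (2 * real n) (hermite n)"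
  proof (cases n rule: hermite.cases)
    case 1
    then show ?thesis by simp
  next
    case 2
    then show ?thesis by (simp add: pderiv_pCons)
  next
    case (3 m)
    show ?thesis unfolding 3 pderiv_hermite pderiv_smult
      by (intro poly_eq_poly_eq_iff[THEN iffD1] ext) (simp add: field_simps)
  qed
  note eq = this
  show ?thesis unfolding gauss_deriv2 eq by (simp add: smult_add_left)
qed

lemma gauss_prod_hermite_eigenspace:
  "gauss_prod (hermite a) (hermite b) \<in> eigenspace (2 * real (a + b + 1))"
proof -
  let ?h = "gauss_prod (hermite a) (hermite b)"
  obtain C where C: "C \<ge> 0" "\<And>z. \<bar>?h z\<bar> \<le> C * wide_gauss z" using gauss_prod_bound by blast
  have "integrable lborel (\<lambda>z. (?h z)\<^sup>2)"
  proof (rule Bochner_Integration.integrable_bound)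
    show "integrable lborel (\<lambda>z. C\<^sup>2 * (wide_gauss z)\<^sup>2)" using integrable_wide_gauss_sq by (rule integrable_mult_right)
    show "AE z in lborel. norm ((?h z)\<^sup>2) \<le> norm (C\<^sup>2 * (wide_gauss z)\<^sup>2)"
    proof (rule AE_I2)
      fix z
      have "\<bar>?h z\<bar>\<^sup>2 \<le> (C * wide_gauss z)\<^sup>2" using C(2) by (rule power_mono) simp
      then show "norm ((?h z)\<^sup>2) \<le> norm (C\<^sup>2 * (wide_gauss z)\<^sup>2)" by (simp add: power_mult_distrib)
    qed
  qed measurable
  moreover have "oscillator ?h = (\<lambda>p. 2 * real (a + b + 1) * ?h p)"
  proof
    fix z
    have d: "gauss_poly (gauss_deriv (gauss_deriv (hermite n))) x = (x\<^sup>2 - (2 * real n + 1)) * gauss_poly (hermite n) x" for n x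
      by (simp add: gauss_deriv2_hermite gauss_poly_def algebra_simps power2_eq_square)
    have "laplacian ?h z = gauss_prod (gauss_deriv (gauss_deriv (hermite a))) (hermite b) z + gauss_prod (hermite a) (gauss_deriv (gauss_deriv (hermite b))) z"
      by (simp add: laplacian_def Basis_real2 partial_gauss_prod)
    then show "oscillator ?h z = 2 * real (a + b + 1) * ?h z"
      by (cases z) (simp add: oscillator_def gauss_prod_def d algebra_simps)
  qed
  ultimately show ?thesis using C2_gauss_prod by (simp add: eigenspace_def)
qed

lemma hermite_functions_independent:
  assumes "\<And>z. (\<Sum>a\<le>k. c a * gauss_prod (hermite a) (hermite (k - a)) z) = 0" and "a \<le> k"
  shows "c a = 0"
proof (rule ccontr)
  assume nz: "c a \<noteq> 0"
  define S where "S = {a. a \<le> k \<and> c a \<noteq> 0}"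
  define m where "m = Max S"
  have S: "finite S" "S \<noteq> {}" using nz assms(2) by (auto simp: S_def)
  have m: "m \<in> S" "\<And>i. i \<in> S \<Longrightarrow> i \<le> m" using S by (auto simp: m_def)
  have "poly (hermite (k - m)) y = 0" for y
  proof -
    define P where "P = (\<Sum>a\<le>k. Polynomial.smult (c a * poly (hermite (k - a)) y) (hermite a))"
    have "poly P x = 0" for x
    proof -
      have "(\<Sum>a\<le>k. c a * gauss_prod (hermite a) (hermite (k - a)) (x,y)) = poly P x * (exp (- x\<^sup>2 / 2) * exp (- y\<^sup>2 / 2))"
        by (simp add: P_def poly_sum gauss_prod_def gauss_poly_def sum_distrib_left sum_distrib_right mult_ac)
      then show ?thesis using assms(1)[of "(x,y)"] by simp
    qed
    then have "P = 0" by (simp add: poly_all_0_iff_0[symmetric])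
    then have "0 = coeff P m" by simp
    also have "\<dots> = (\<Sum>a\<le>k. c a * poly (hermite (k - a)) y * coeff (hermite a) m)" by (simp add: P_def coeff_sum)
    also have "\<dots> = (\<Sum>a\<in>{m}. c a * poly (hermite (k - a)) y * coeff (hermite a) m)"
    proof (rule sum.mono_neutral_right)
      show "\<forall>a\<in>{..k} - {m}. c a * poly (hermite (k - a)) y * coeff (hermite a) m = 0"
      proof
        fix a assume a: "a \<in> {..k} - {m}"
        show "c a * poly (hermite (k - a)) y * coeff (hermite a) m = 0"
        proof (cases "c a = 0")
          case False
          then have "a < m" using a m(2)[of a] by (auto simp: S_def)
          then show ?thesis using degree_hermite by (simp add: coeff_eq_0)
        qed simp
      qed
    qed (use m(1) in \<open>auto simp: S_def\<close>)
    also have "\<dots> = c m * poly (hermite (k - m)) y" 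
    proof -
      have "coeff (hermite m) m = 1" using degree_hermite[of m] by metis
      then show ?thesis by simp
    qed
    finally show ?thesis using m(1) by (simp add: S_def)
  qed
  then have "hermite (k - m) = 0" by (simp add: poly_all_0_iff_0[symmetric])
  then show False using degree_hermite[of "k - m"] by simp
qed

lemma fun_sum_apply: "sum f A z = (\<Sum>a\<in>A. f a z)" for f :: "'i \<Rightarrow> 'a \<Rightarrow> real"
  by (induction A rule: infinite_finite_induct) auto

lemma moment_sum:
  assumes "\<And>i. i \<in> I \<Longrightarrow> continuous_on UNIV (F i) \<and> integrable lborel (\<lambda>z. (F i z)\<^sup>2)"
  shows "moment (\<lambda>z. \<Sum>i\<in>I. v i * F i z) p q = (\<Sum>i\<in>I. v i * moment (F i) p q)"
proof -
  have "(\<lambda>z. (\<Sum>i\<in>I. v i * F i z) * gauss_prod p q z) = (\<lambda>z. \<Sum>i\<in>I. v i * (F i z * gauss_prod p q z))"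
    by (simp add: fun_eq_iff sum_distrib_left sum_distrib_right mult_ac)
  moreover have "integrable lborel (\<lambda>z. F i z * gauss_prod p q z)" if "i \<in> I" for i
    using assms[OF that] integrable_moment by blast
  ultimately show ?thesis unfolding moment_def by (simp add: Bochner_Integration.integral_sum)
qed

text \<open>
  A dimension count: among the \<open>k + 1\<close> Hermite products and \<open>u\<close> there are \<open>k + 2\<close> functions, so some
  nontrivial combination has its \<open>k + 1\<close> resonant moments equal to zero and therefore vanishes. The coefficient of
  \<open>u\<close> in it is not zero, because the Hermite products are independent.
\<close>
lemma eigenspace_hermite_combination:
  assumes sub: "fun_space.subspace (eigenspace (2 * real (k + 1)))" and u: "u \<in> eigenspace (2 * real (k + 1))"
  shows "\<exists>c. u = (\<lambda>z. \<Sum>a\<le>k. c a * gauss_prod (hermite a) (hermite (k - a)) z)"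
proof -
  define F where "F = (\<lambda>i. if i \<le> k then gauss_prod (hermite i) (hermite (k - i)) else u)"
  have FE: "F i \<in> eigenspace (2 * real (k + 1))" for i
  proof (cases "i \<le> k")
    case True
    then show ?thesis using gauss_prod_hermite_eigenspace[of i "k - i"] by (simp add: F_def)
  next
    case False
    then show ?thesis using u by (simp add: F_def)
  qed
  obtain v where v: "\<exists>i\<in>{..Suc k}. v i \<noteq> 0"
    "\<forall>j<Suc k. (\<Sum>i\<in>{..Suc k}. moment (F i) (monom 1 j) (monom 1 (k - j)) * v i) = 0"
    using underdetermined_system[of "{..Suc k}" "Suc k" "\<lambda>j i. moment (F i) (monom 1 j) (monom 1 (k - j))"] by auto
  define w where "w = (\<lambda>z. \<Sum>i\<le>Suc k. v i * F i z)"
  have "w = (\<Sum>i\<le>Suc k. (\<lambda>z. v i * F i z))" by (simp add: w_def fun_eq_iff fun_sum_apply)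
  then have wE: "w \<in> eigenspace (2 * real (k + 1))"
    using fun_space.subspace_sum[OF sub, of "{..Suc k}" "\<lambda>i z. v i * F i z"] fun_space.subspace_scale[OF sub FE] by auto
  have "w = (\<lambda>_. 0)"
  proof (rule eigenfunction_zero[OF wE])
    fix a b assume "2 * real (a + b + 1) = 2 * real (k + 1)"
    then have ab: "a < Suc k" "b = k - a" by auto
    have "moment w (monom 1 a) (monom 1 b) = (\<Sum>i\<le>Suc k. v i * moment (F i) (monom 1 a) (monom 1 b))"
      unfolding w_def by (rule moment_sum) (use eigenspaceD[OF FE] in auto)
    then show "moment w (monom 1 a) (monom 1 b) = 0" using v(2)[rule_format, OF ab(1)] ab(2) by (simp add: mult.commute)
  qed
  then have eq: "(\<Sum>a\<le>k. v a * gauss_prod (hermite a) (hermite (k - a)) z) + v (Suc k) * u z = 0" for z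
  proof -
    have "w z = 0" using \<open>w = (\<lambda>_. 0)\<close> by simp
    then show ?thesis by (simp add: w_def F_def)
  qed
  have nz: "v (Suc k) \<noteq> 0"
  proof
    assume "v (Suc k) = 0"
    then have "v a = 0" if "a \<le> k" for a using hermite_functions_independent[where c = v and k = k and a = a] eq that by simp
    then show False using v(1) \<open>v (Suc k) = 0\<close> by (auto simp: le_Suc_eq)
  qed
  have "u z = (\<Sum>a\<le>k. (- v a / v (Suc k)) * gauss_prod (hermite a) (hermite (k - a)) z)" for z
  proof -
    have "(\<Sum>a\<le>k. (- v a / v (Suc k)) * gauss_prod (hermite a) (hermite (k - a)) z) = - (\<Sum>a\<le>k. v a * gauss_prod (hermite a) (hermite (k - a)) z) / v (Suc k)"
      by (simp add: sum_divide_distrib sum_negf[symmetric])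
    also have "\<dots> = u z" using eq[of z] nz by (simp add: field_simps)
    finally show ?thesis by simp
  qed
  then show ?thesis by (intro exI[of _ "\<lambda>a. - v a / v (Suc k)"]) auto
qed

lemma poly_fun_product:
  assumes "degree p + degree q \<le> k"
  shows "poly_fun k (\<lambda>i j. coeff p i * coeff q j) (x, y) = poly p x * poly q y"
proof -
  have expand: "poly r t = (\<Sum>i\<le>n. coeff r i * t ^ i)" if "degree r \<le> n" for r :: "real poly" and n t
    unfolding poly_altdef using that by (intro sum.mono_neutral_left) (auto simp: coeff_eq_0)
  have "poly_fun k (\<lambda>i j. coeff p i * coeff q j) (x, y) = (\<Sum>i\<le>k. coeff p i * x ^ i * poly q y)"
    unfolding poly_fun_def prod.case
  proof (intro sum.cong refl)
    fix i
    show "(\<Sum>j\<le>k - i. coeff p i * coeff q j * x ^ i * y ^ j) = coeff p i * x ^ i * poly q y"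
    proof (cases "i \<le> degree p")
      case True
      then have "degree q \<le> k - i" using assms by simp
      from expand[OF this, of y] show ?thesis by (simp add: sum_distrib_left mult_ac)
    next
      case False
      then show ?thesis by (simp add: coeff_eq_0)
    qed
  qed
  also have "\<dots> = poly p x * poly q y"
    using expand[of p k x] assms by (simp add: sum_distrib_right)
  finally show ?thesis .
qed

lemma poly_fun_sum: "(\<Sum>a\<in>S. d a * poly_fun k (C a) z) = poly_fun k (\<lambda>i j. \<Sum>a\<in>S. d a * C a i j) z"
proof (cases z)
  case (Pair x y)
  have "(\<Sum>a\<in>S. d a * poly_fun k (C a) z) = (\<Sum>a\<in>S. \<Sum>i\<le>k. \<Sum>j\<le>k - i. d a * C a i j * x ^ i * y ^ j)"
    by (simp add: poly_fun_def Pair sum_distrib_left mult_ac)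
  also have "\<dots> = (\<Sum>i\<le>k. \<Sum>j\<le>k - i. \<Sum>a\<in>S. d a * C a i j * x ^ i * y ^ j)"
    by (subst sum.swap, rule sum.cong[OF refl], rule sum.swap)
  also have "\<dots> = poly_fun k (\<lambda>i j. \<Sum>a\<in>S. d a * C a i j) z"
    by (simp add: poly_fun_def Pair sum_distrib_right)
  finally show ?thesis .
qed

lemma eigenfunction_poly_fun:
  assumes sub: "fun_space.subspace (eigenspace (2 * real (j + 1)))" and u: "u \<in> eigenspace (2 * real (j + 1))" and "j \<le> k"
  shows "\<exists>C. \<forall>z. u z = exp (- ((fst z)\<^sup>2 + (snd z)\<^sup>2) / 2) * poly_fun k C z"
proof -
  obtain c where c: "u = (\<lambda>z. \<Sum>a\<le>j. c a * gauss_prod (hermite a) (hermite (j - a)) z)"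
    using eigenspace_hermite_combination[OF sub u] by blast
  define C where "C = (\<lambda>a m n. coeff (hermite a) m * coeff (hermite (j - a)) n)"
  have "u z = exp (- ((fst z)\<^sup>2 + (snd z)\<^sup>2) / 2) * poly_fun k (\<lambda>m n. \<Sum>a\<le>j. c a * C a m n) z" for z
  proof -
    have "gauss_prod (hermite a) (hermite (j - a)) z = exp (- ((fst z)\<^sup>2 + (snd z)\<^sup>2) / 2) * poly_fun k (C a) z" if "a \<le> j" for a
    proof -
      have "poly_fun k (C a) z = poly (hermite a) (fst z) * poly (hermite (j - a)) (snd z)"
        using poly_fun_product[of "hermite a" "hermite (j - a)" k "fst z" "snd z"] degree_hermite that assms(3) by (simp add: C_def)
      moreover have "exp (- ((fst z)\<^sup>2 + (snd z)\<^sup>2) / 2) = exp (- (fst z)\<^sup>2 / 2) * exp (- (snd z)\<^sup>2 / 2)"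
        by (simp add: mult_exp_exp add_divide_distrib)
      ultimately show ?thesis by (simp add: gauss_prod_def gauss_poly_def mult_ac)
    qed
    then have "u z = (\<Sum>a\<le>j. exp (- ((fst z)\<^sup>2 + (snd z)\<^sup>2) / 2) * (c a * poly_fun k (C a) z))"
      unfolding c by (intro sum.cong refl) (simp add: mult_ac)
    then show ?thesis by (simp add: sum_distrib_left[symmetric] poly_fun_sum)
  qed
  then show ?thesis by blast
qed

section \<open>Counting nodal domains\<close>

text \<open>
  The lower bound for the multiplicity: it says how many eigenfunctions must precede the higher levels.
\<close>
lemma card_eigenbasis_ge:
  assumes fin: "finite B" and span: "fun_space.span B = eigenspace (2 * real (j + 1))"
  shows "j + 1 \<le> card B"
proof -
  let ?h = "\<lambda>a. gauss_prod (hermite a) (hermite (j - a))"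
  have inj: "inj_on ?h {..j}"
  proof (rule inj_onI, rule ccontr)
    fix a b assume ab: "a \<in> {..j}" "b \<in> {..j}" "?h a = ?h b" "a \<noteq> b"
    define c where "c = (\<lambda>i. if i = a then 1 else if i = b then - 1 else (0::real))"
    have "(\<Sum>i\<le>j. c i * ?h i z) = 0" for z
    proof -
      have "(\<Sum>i\<le>j. c i * ?h i z) = (\<Sum>i\<in>{a,b}. c i * ?h i z)"
        using ab by (intro sum.mono_neutral_right) (auto simp: c_def)
      also have "\<dots> = 0" using ab(4) fun_cong[OF ab(3), of z] by (simp add: c_def)
      finally show ?thesis .
    qed
    from hermite_functions_independent[OF this, of a] ab show False by (simp add: c_def)
  qed
  have "fun_space.independent (?h ` {..j})"
  proof
    assume "fun_space.dependent (?h ` {..j})"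
    then obtain u a where u: "(\<Sum>v\<in>?h ` {..j}. (\<lambda>p. u v * v p)) = 0" and a: "a \<in> {..j}" "u (?h a) \<noteq> 0"
      unfolding fun_space.dependent_finite[OF finite_imageI[OF finite_atMost]] by blast
    have "(\<Sum>i\<le>j. u (?h i) * ?h i z) = 0" for z
    proof -
      have "(\<Sum>i\<le>j. u (?h i) * ?h i z) = (\<Sum>v\<in>?h ` {..j}. u v * v z)"
        by (subst sum.reindex[OF inj]) simp
      also have "\<dots> = (\<Sum>v\<in>?h ` {..j}. (\<lambda>p. u v * v p)) z" by (simp add: fun_sum_apply)
      also have "\<dots> = 0" unfolding u by simp
      finally show ?thesis .
    qed
    from hermite_functions_independent[OF this, of a] a show False by simp
  qed
  moreover have "?h ` {..j} \<subseteq> fun_space.span B"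
    unfolding span using gauss_prod_hermite_eigenspace[of _ "j - _"] 
    by (auto simp del: of_nat_add) (metis le_add_diff_inverse)
  ultimately have "card (?h ` {..j}) \<le> card B"
    using fun_space.independent_span_bound[OF fin] by blast
  then show ?thesis by (simp add: card_image[OF inj])
qed

theorem propositionB1:
  fixes f :: "nat \<Rightarrow> real \<times> real \<Rightarrow> real"
    and ev :: "nat \<Rightarrow> real"
    and a :: "nat \<Rightarrow> real"
    and n :: nat
  assumes "ordered_eigenbasis f ev"
    and "n \<ge> 1"
  shows "beta0 (\<lambda>p. \<Sum>i=1..n. a i * f i p) \<le> enat n"
proof -
  define I where "I = (\<lambda>\<mu>. {i. 1 \<le> i \<and> ev i = \<mu>})"
  have mono: "mono_on {1..} ev" and inj: "inj_on f (I \<mu>)" and indep: "fun_space.independent (f ` I \<mu>)"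
    and span: "fun_space.span (f ` I \<mu>) = eigenspace \<mu>" for \<mu>
    using assms(1) by (auto simp: ordered_eigenbasis_def I_def Let_def)
  have sub: "fun_space.subspace (eigenspace \<mu>)" for \<mu>
    unfolding span[symmetric] by (rule fun_space.subspace_span)
  have fE: "f i \<in> eigenspace (ev i)" if "1 \<le> i" for i
    unfolding span[symmetric] using that by (intro fun_space.span_base) (auto simp: I_def)
  have level: "\<exists>j. ev i = 2 * real (j + 1)" if i: "1 \<le> i" for i
  proof (rule ccontr)
    assume no: "\<not> ?thesis"
    have "f i = (\<lambda>_. 0)"
    proof (rule eigenfunction_zero[OF fE[OF i]])
      fix a b assume "2 * real (a + b + 1) = ev i"
      then have "ev i = 2 * real ((a + b) + 1)" by (rule sym)
      then show "moment (f i) (monom 1 a) (monom 1 b) = 0" using no by blast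
    qed
    then have "f i = 0" by (simp add: zero_fun_def)
    moreover have "f i \<in> f ` I (ev i)" using i by (auto simp: I_def)
    ultimately have "0 \<in> f ` I (ev i)" by simp
    then have "fun_space.dependent (f ` I (ev i))" by (rule fun_space.dependent_zero)
    then show False using indep[of "ev i"] by simp
  qed
  obtain k where k: "ev n = 2 * real (k + 1)" using level[OF assms(2)] by blast
  have count: "2 + k * (k + 1) \<le> 2 * n"
  proof -
    define J where "J = (\<lambda>j. I (2 * real (j + 1)))"
    have J_sub: "J j \<subseteq> {1..<n}" if "j < k" for j
    proof
      fix i assume i: "i \<in> J j"
      then have "1 \<le> i" "ev i < ev n" using that k by (auto simp: J_def I_def)
      moreover have "i < n"
      proof (rule ccontr)
        assume "\<not> i < n"
        then have "ev n \<le> ev i" using assms(2) by (intro mono_onD[OF mono]) auto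
        then show False using \<open>ev i < ev n\<close> by simp
      qed
      ultimately show "i \<in> {1..<n}" by simp
    qed
    have finJ: "finite (J j)" if "j < k" for j using finite_subset[OF J_sub[OF that]] by simp
    have cardJ: "j + 1 \<le> card (J j)" if "j < k" for j
      using card_eigenbasis_ge[of "f ` J j" j] finJ[OF that] span inj card_image[of f "J j"] by (simp add: J_def)
    have "(\<Sum>j<k. j + 1) \<le> (\<Sum>j<k. card (J j))" using cardJ by (intro sum_mono) auto
    also have "\<dots> = card (\<Union>j<k. J j)"
      using finJ by (intro card_UN_disjoint[symmetric]) (auto simp: J_def I_def)
    also have "\<dots> \<le> card {1..<n}" using J_sub by (intro card_mono) auto
    finally have "(\<Sum>j<k. j + 1) \<le> n - 1" by simp
    moreover have "2 * (\<Sum>j<k. j + 1) = k * (k + 1)" by (induction k) auto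
    ultimately show ?thesis using assms(2) by linarith
  qed
  define w where "w = (\<lambda>z :: real \<times> real. exp (- ((fst z)\<^sup>2 + (snd z)\<^sup>2) / 2))"
  have "\<exists>C. \<forall>z. f i z = w z * poly_fun k C z" if i: "i \<in> {1..n}" for i
  proof -
    obtain j where j: "ev i = 2 * real (j + 1)" using level i by auto
    have "ev i \<le> ev n" using i by (intro mono_onD[OF mono]) auto
    then have "j \<le> k" using j k by simp
    moreover have "f i \<in> eigenspace (2 * real (j + 1))" unfolding j[symmetric] using i by (intro fE) simp
    ultimately show ?thesis
      unfolding w_def using sub by (intro eigenfunction_poly_fun[of j])
  qed
  then obtain C where C: "\<And>i z. i \<in> {1..n} \<Longrightarrow> f i z = w z * poly_fun k (C i) z" by metis
  define c where "c = (\<lambda>r s. \<Sum>i=1..n. a i * C i r s)"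
  have comb: "(\<Sum>i=1..n. a i * f i z) = w z * poly_fun k c z" for z
  proof -
    have "(\<Sum>i=1..n. a i * f i z) = (\<Sum>i=1..n. w z * (a i * poly_fun k (C i) z))"
      using C by (intro sum.cong refl) (simp add: mult_ac)
    then show ?thesis by (simp add: sum_distrib_left[symmetric] poly_fun_sum c_def)
  qed
  have nd: "nodal_domains (\<lambda>p. \<Sum>i=1..n. a i * f i p) = components {p. poly_fun k c p \<noteq> 0}"
    unfolding nodal_domains_def comb by (rule arg_cong[where f = components]) (auto simp: w_def)
  have bound: "card F \<le> n" if "finite F" "F \<subseteq> components {p. poly_fun k c p \<noteq> 0}" for F
    using card_components_poly_fun[OF that] count by linarith
  have fin: "finite (components {p. poly_fun k c p \<noteq> 0})"
  proof (rule ccontr)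
    assume "infinite (components {p. poly_fun k c p \<noteq> 0})"
    then obtain F where "F \<subseteq> components {p. poly_fun k c p \<noteq> 0}" "finite F" "card F = Suc n"
      using infinite_arbitrarily_large by metis
    then show False using bound[of F] by simp
  qed
  then show ?thesis unfolding beta0_def nd using bound[OF fin] by simp
qed

end
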